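(* Let $p\in[1,\infty)$, $m\ge 1$, and $\lambda\ge 0$. Then $$\lim_{n\to\infty}n^{-(m+2\lambda)/p}\,\mathcal{N}\left(\mathcal{P}_{n,m},L_{p,(1-|x|^2)^{\lambda-1/2}}(\mathfrak{B}^m)\right)$$ $$=A_1\,\mathcal{N}_0\left(B_{1,e}\cap L_{p,|u|^{m+2\lambda-1}}(\mathbb{R}^1),\,L_{p,|u|^{m+2\lambda-1}}(\mathbb{R}^1)\right)=A_2\,\mathcal{N}_0\left(B_{\mathfrak{B}^m}\cap L_{p,|t|^{2\lambda}}(\mathbb{R}^m),\,L_{p,|t|^{2\lambda}}(\mathbb{R}^m)\right),$$ where $$A_1=A_1(m,p,\lambda):=\left(\frac{2\Gamma(\lambda+m/2)}{\pi^{(m-1)/2}\Gamma(\lambda+1/2)}\right)^{1/p},\qquad A_2=A_2(m,p,\lambda):=\left(\frac{2\pi^{1/2}\Gamma(\lambda+m/2)}{\Gamma(m/2)\Gamma(\lambda+1/2)}\right)^{1/p}.$$ In addition, there exists a function $f_0\in\left(B_{\mathfrak{B}^m}\cap L_{p,|t|^{2\lambda}}(\mathbb{R}^m)\right)\setminus\{0\}$ such that $$\lim_{n\to\infty}n^{-(m+2\lambda)/p}\,\mathcal{N}\left(\mathcal{P}_{n,m},L_{p,(1-|x|^2)^{\lambda-1/2}}(\mathfrak{B}^m)\right)=A_2\,|f_0(0)|\,/\,\|f_0\|_{L_{p,|t|^{2\lambda}}(\mathbb{R}^m)}.$$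
   Context: $|x|$ is the Euclidean norm on $\mathbb{R}^m$ and $\mathfrak{B}^m=\{t\in\mathbb{R}^m:|t|\le1\}$ is the closed unit ball. For a measurable $\Omega\subseteq\mathbb{R}^m$ and a locally integrable weight $W:\Omega\to[0,\infty]$, $L_{r,W}(\Omega)$, $0<r<\infty$, is the space of measurable $F:\Omega\to\mathbb{C}$ with $\|F\|_{L_{r,W}(\Omega)}:=\left(\int_\Omega|F(x)|^rW(x)\,dx\right)^{1/r}<\infty$; $\|F\|_{L_\infty(\Omega)}:=\operatorname{ess\,sup}_{x\in\Omega}|F(x)|$. The weight in the subscript is written as a function of the variable ($x\in\mathfrak{B}^m$, $u\in\mathbb{R}^1$, or $t\in\mathbb{R}^m$). For a subspace $B$ of $L_{p,W}(\Omega)$ ($\Omega$ closed), $$\mathcal{N}_{0}(B,L_{p,W}(\Omega)):=\sup_{h\in B\setminus\{0\}}\frac{|h(0)|}{\|h\|_{L_{p,W}(\Omega)}},\qquad \mathcal{N}(B,L_{p,W}(\Omega)):=\sup_{h\in B\setminus\{0\}}\frac{\|h\|_{L_\infty(\Omega)}}{\|h\|_{L_{p,W}(\Omega)}}.$$ $\mathcal{P}_{n,m}$ is the set of all polynomials with complex coefficients in $m$ variables of total degree at most $n$ ($n$ a nonnegative integer). For a centrally symmetric closed convex body $V\subset\mathbb{R}^m$ and $z\in\mathbb{C}^m$ let $\|z\|_V^*:=\sup_{t\in V}\left|\sum_{j=1}^mt_jz_j\right|$. $B_V$ is the set of all entire functions $f:\mathbb{C}^m\to\mathbb{C}$ such that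 for every $\varepsilon>0$ there is a constant $C_0(\varepsilon,f)>0$ with $|f(z)|\le C_0(\varepsilon,f)\exp\left((1+\varepsilon)\|z\|_V^*\right)$ for all $z\in\mathbb{C}^m$. Here $B_{\mathfrak{B}^m}$ is the case $V=\mathfrak{B}^m$, and $B_{1,e}$ is the set of even functions in $B_{[-1,1]}$ (case $m=1$, $V=[-1,1]$). Functions of these classes are identified with their restrictions to $\mathbb{R}^m$ (resp. $\mathbb{R}^1$) when intersected with weighted spaces. *)

theory Defs
  imports "HOL-Analysis.Analysis" "HOL-Probability.Essential_Supremum"
begin

section \<open>Weighted Lebesgue spaces\<close>

text \<open>
  Norms take values in the extended nonnegative reals. A function on \<open>\<Omega>\<close> is represented by a
  total function of which only the values on \<open>\<Omega>\<close> are used; likewise for the weight \<open>W\<close>.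
\<close>

definition wnorm ::
  "real \<Rightarrow> ('a::euclidean_space \<Rightarrow> ennreal) \<Rightarrow> 'a set \<Rightarrow> ('a \<Rightarrow> complex) \<Rightarrow> ennreal" where
  "wnorm r W \<Omega> F =
     (let I = \<integral>\<^sup>+ x. ennreal (cmod (F x) powr r) * W x \<partial>lebesgue_on \<Omega>
      in if I = \<infinity> then \<infinity> else ennreal (enn2real I powr (1 / r)))"

definition wspace ::
  "real \<Rightarrow> ('a::euclidean_space \<Rightarrow> ennreal) \<Rightarrow> 'a set \<Rightarrow> ('a \<Rightarrow> complex) set" where
  "wspace r W \<Omega> = {F. F \<in> borel_measurable (lebesgue_on \<Omega>) \<and> wnorm r W \<Omega> F < \<infinity>}"

definition supnorm :: "'a::euclidean_space set \<Rightarrow> ('a \<Rightarrow> complex) \<Rightarrow> ennreal" where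
  "supnorm \<Omega> F = esssup (lebesgue_on \<Omega>) (\<lambda>x. ennreal (cmod (F x)))"


section \<open>Sharp constants\<close>

text \<open>
  The suprema are taken in the extended nonnegative reals, so that they always exist.
  The zero element is excluded as the zero function on the whole space. For the spaces considered
  below, which consist of traces of polynomials and of entire functions, this is the same as
  excluding the functions that vanish almost everywhere on the ball, or on the whole space.
\<close>

definition N0_const ::
  "('a::euclidean_space \<Rightarrow> complex) set \<Rightarrow> real \<Rightarrow> ('a \<Rightarrow> ennreal) \<Rightarrow> 'a set \<Rightarrow> ennreal" where
  "N0_const B p W \<Omega> = (SUP h \<in> B - {\<lambda>_. 0}. ennreal (cmod (h 0)) / wnorm p W \<Omega> h)"

definition N_const ::
  "('a::euclidean_space \<Rightarrow> complex) set \<Rightarrow> real \<Rightarrow> ('a \<Rightarrow> ennreal) \<Rightarrow> 'a set \<Rightarrow> ennreal" where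
  "N_const B p W \<Omega> = (SUP h \<in> B - {\<lambda>_. 0}. supnorm \<Omega> h / wnorm p W \<Omega> h)"


section \<open>Polynomials of total degree at most n\<close>

definition poly_space :: "nat \<Rightarrow> (real ^ 'm \<Rightarrow> complex) set" where
  "poly_space n =
     {P. \<exists>c :: ('m \<Rightarrow> nat) \<Rightarrow> complex.
           \<forall>x. P x = (\<Sum>\<alpha> | (\<Sum>j\<in>UNIV. \<alpha> j) \<le> n.
                        c \<alpha> * (\<Prod>j\<in>UNIV. complex_of_real (x $ j) ^ \<alpha> j))}"


section \<open>Entire functions of exponential type\<close>

text \<open>Entire: the real Frechet derivative exists at every point and is complex-linear.\<close>

definition entire :: "(complex ^ 'm \<Rightarrow> complex) \<Rightarrow> bool" where
  "entire f \<longleftrightarrow>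
     (\<forall>z. \<exists>D. (f has_derivative D) (at z) \<and> (\<forall>c v. D (c *s v) = c * D v))"

text \<open>This supremum is the intended one when \<open>V\<close> is nonempty and bounded.\<close>

definition dual_norm :: "(real ^ 'm) set \<Rightarrow> complex ^ 'm \<Rightarrow> real" where
  "dual_norm V z = (SUP t\<in>V. cmod (\<Sum>j\<in>UNIV. complex_of_real (t $ j) * z $ j))"

definition exp_type_class :: "(real ^ 'm) set \<Rightarrow> (complex ^ 'm \<Rightarrow> complex) set" where
  "exp_type_class V =
     {f. entire f \<and>
         (\<forall>\<epsilon>>0. \<exists>C>0. \<forall>z. cmod (f z) \<le> C * exp ((1 + \<epsilon>) * dual_norm V z))}"

definition real_trace :: "(complex ^ 'm \<Rightarrow> complex) \<Rightarrow> real ^ 'm \<Rightarrow> complex" where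
  "real_trace f = (\<lambda>t. f (\<chi> j. complex_of_real (t $ j)))"

definition B_ball :: "(real ^ 'm \<Rightarrow> complex) set" where
  "B_ball = real_trace ` exp_type_class (cball 0 1)"

text \<open>The real line is \<open>real ^ 1\<close> here.\<close>

definition B_1e :: "(real ^ 1 \<Rightarrow> complex) set" where
  "B_1e = real_trace ` {f \<in> exp_type_class {t. t $ 1 \<in> {-1..1}}. \<forall>z. f (- z) = f z}"


section \<open>Weights and constants\<close>

text \<open>
  Since \<open>0 powr a = 0\<close> for every \<open>a\<close>, the weights below may differ from the usual convention on
  the unit sphere or at the origin, which are null sets.
\<close>

definition ball_weight :: "real \<Rightarrow> real ^ 'm \<Rightarrow> ennreal" where
  "ball_weight lam x = ennreal ((1 - (norm x)\<^sup>2) powr (lam - 1/2))"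

definition power_weight :: "real \<Rightarrow> real ^ 'm \<Rightarrow> ennreal" where
  "power_weight a t = ennreal (norm t powr a)"

definition A1 :: "real \<Rightarrow> real \<Rightarrow> real \<Rightarrow> real" where
  "A1 m p lam =
     (2 * Gamma (lam + m / 2) / (pi powr ((m - 1) / 2) * Gamma (lam + 1/2))) powr (1 / p)"

definition A2 :: "real \<Rightarrow> real \<Rightarrow> real \<Rightarrow> real" where
  "A2 m p lam =
     (2 * pi powr (1/2) * Gamma (lam + m / 2) / (Gamma (m / 2) * Gamma (lam + 1/2))) powr (1 / p)"

end

theory Submission
  imports Defs "HOL-Complex_Analysis.Complex_Analysis" "HOL-Real_Asymp.Real_Asymp"
begin

text \<open>
  All constants of the theorem are expressed by one extremal problem on the half line. Put
  \<open>a = m + 2 lam - 1\<close>, and let \<open>L\<close> be the least value of the integral of \<open>|f u|^p u^a\<close> over the positive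
  half line, where \<open>f\<close> runs through the even entire functions of exponential type 1 with \<open>f 0 = 1\<close>. With
  \<open>C = ball_const m lam\<close>, the three members of the asserted equation are \<open>C L\<close> to the power \<open>- 1 / p\<close>.

  \<^emph>\<open>From the ball to the half circle.\<close> Let \<open>D n\<close> be the infimum of the integral of \<open>|q (cos \<theta>)|^p sin \<theta>^a\<close>
  over \<open>0 \<le> \<theta> \<le> pi\<close>, where \<open>q\<close> runs through the polynomials of degree at most \<open>n\<close> with \<open>q 1 = 1\<close>. The
  case \<open>lam = 0\<close> is a limit of cases with \<open>lam > 0\<close>. For these, the weight \<open>(1 - |x|^2)\<close> to the power
  \<open>lam - 1/2\<close> is, up to a factor, the marginal of the weight \<open>(1 - |Y|^2)\<close> to the power \<open>lam - 1\<close> on the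
  unit ball of one dimension more, which is invariant under rotations. A point \<open>x\<close> of the
  ball is the projection of a unit vector there, and the larger ball is the union of the curves
  \<open>cos \<theta> X + sin \<theta> W\<close> through this vector \<open>X\<close>. Along the
  projection of such a curve the even part in \<open>\<theta>\<close> of a polynomial
  \<open>P\<close> of degree \<open>n\<close> is a polynomial of degree at most \<open>n\<close> in
  \<open>cos \<theta>\<close> that has the value \<open>P x\<close> at \<open>\<theta> =
  0\<close>. Thus \<open>D n * |P x|^p\<close> is at most its integral, and averaging over all curves
  yields \<open>C * D n * |P x|^p \<le> \<parallel>P\<parallel>^p\<close>, in
  \<open>ball_upper_bound\<close>. Zonal polynomials show that this is sharp
  (\<open>ball_zonal_bound\<close>), so the constant for the ball is \<open>C * D n\<close> to the
  power \<open>- 1 / p\<close>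
  (\<open>N_const_poly_space\<close>).

  \<^emph>\<open>From the half circle to the half line.\<close> The product of \<open>D n\<close> and \<open>n\<close> to the power \<open>a + 1\<close> tends to \<open>L\<close>
  (\<open>scaled_arc_min_limit\<close>). On the one hand, a competitor \<open>f\<close> on the half line can be dilated and damped at
  arbitrarily small cost so that it decays; this needs the growth of \<open>f\<close> off the real axis, which comes
  from a Phragmen-Lindelof argument. The periodization of \<open>f (n z)\<close> is then an even periodic entire
  function of type \<open>n\<close>, hence a polynomial of degree at most \<open>n\<close> in \<open>cos z\<close>, and it is close to \<open>f (n z)\<close> on a period.
  On the other hand, near-minimal polynomials \<open>q\<close>, in the form \<open>q (cos (z / n))\<close>, are uniformly bounded
  on the real line and have type 1. A limit provided by Montel's theorem is a competitor on the half
  line, and Fatou's lemma shows that it is a minimiser.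

  \<^emph>\<open>From the half line to the space.\<close> A minimiser \<open>f\<close> gives the radial function \<open>f |t|\<close>, which is the trace of
  an entire function of the class of the ball. Conversely, the even part of a function of this class
  on any line through 0 is a competitor on the half line, and averaging over the directions in polar
  coordinates bounds its value at 0 (\<open>B_ball_lower_bound\<close>). So the constants for entire functions on
  the line and in the space are powers of multiples of \<open>L\<close>, and \<open>f |t|\<close> is the extremal function.
\<close>

section \<open>Entire functions that factor through the square or the cosine\<close>

lemma continuous_on_compact_bound:
  fixes f :: "'a::topological_space \<Rightarrow> 'b::real_normed_vector"
  assumes "continuous_on S f" "compact S"
  obtains B where "\<And>x. x \<in> S \<Longrightarrow> norm (f x) \<le> B"
  using compact_imp_bounded[OF compact_continuous_image[OF assms]] unfolding bounded_iff by blast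

text \<open>
  Away from the critical values \<open>c\<close> has local holomorphic inverses, so the induced function \<open>q\<close> is
  holomorphic there. Since \<open>c\<close> is an open map, \<open>q\<close> is continuous everywhere, and the finitely many
  critical values are removable singularities.
\<close>

lemma entire_factor_through:
  fixes c f :: "complex \<Rightarrow> complex"
  assumes c: "c holomorphic_on UNIV" and f: "f holomorphic_on UNIV"
    and surj: "surj c"
    and fib: "\<And>a b. c a = c b \<Longrightarrow> f a = f b"
    and crit: "finite (c ` {z. deriv c z = 0})"
  obtains q where "q holomorphic_on UNIV" "\<And>z. f z = q (c z)"
proof -
  define q where "q w = f (inv c w)" for w
  have q: "f z = q (c z)" for z
    unfolding q_def by (rule fib) (simp add: surj surj_f_inv_f)
  have nc: "\<not> c constant_on UNIV"
  proof
    assume "c constant_on UNIV"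
    then obtain k where "\<And>z. c z = k" by (auto simp: constant_on_def)
    moreover obtain z where "c z = k + 1" using surj by (metis surjD)
    ultimately show False by simp
  qed
  have op: "open (c ` U)" if "open U" for U
    using open_mapping_thm[OF c open_UNIV connected_UNIV that subset_UNIV nc] .
  have cont: "continuous_on UNIV q"
  proof (rule continuous_on_open_vimage[OF open_UNIV, THEN iffD2], intro allI impI)
    fix B :: "complex set" assume B: "open B"
    have "q -` B \<inter> UNIV = c ` (f -` B)"
    proof safe
      fix w assume "q w \<in> B"
      moreover obtain z where "w = c z" using surj by (metis surjD)
      ultimately show "w \<in> c ` (f -` B)" by (auto simp: q)
    qed (auto simp: q)
    moreover have "open (f -` B)"
      using B f by (intro open_vimage) (auto intro: holomorphic_on_imp_continuous_on)
    ultimately show "open (q -` B \<inter> UNIV)" using op by simp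
  qed
  have "q field_differentiable at w" if w: "w \<in> UNIV - c ` {z. deriv c z = 0}" for w
  proof -
    obtain z where z: "w = c z" using surj by (metis surjD)
    with w have "deriv c z \<noteq> 0" by auto
    then obtain r where r: "r > 0" "inj_on c (ball z r)"
      using has_complex_derivative_locally_injective[OF c UNIV_I open_UNIV] by metis
    obtain g where g: "g holomorphic_on (c ` ball z r)" "\<And>y. y \<in> ball z r \<Longrightarrow> g (c y) = y"
      using holomorphic_has_inverse[OF holomorphic_on_subset[OF c subset_UNIV] open_ball r(2)] by metis
    have "(f \<circ> g) holomorphic_on (c ` ball z r)"
      using g(1) f by (intro holomorphic_on_compose) (auto intro: holomorphic_on_subset)
    then have "q holomorphic_on (c ` ball z r)"
      by (rule holomorphic_transform) (auto simp: g(2) q)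
    moreover have "open (c ` ball z r)" by (simp add: op)
    moreover have "w \<in> c ` ball z r" using z r by auto
    ultimately show ?thesis using holomorphic_on_imp_differentiable_at by blast
  qed
  then have "q holomorphic_on UNIV - c ` {z. deriv c z = 0}"
    by (auto simp: holomorphic_on_def intro: field_differentiable_at_within)
  then have "q holomorphic_on UNIV"
    using cont crit no_isolated_singularity by blast
  with q that show ?thesis by blast
qed

lemma entire_even_square:
  assumes "f holomorphic_on UNIV" "\<And>z. f (- z) = f z"
  obtains q where "q holomorphic_on UNIV" "\<And>z. f z = q (z\<^sup>2)"
proof (rule entire_factor_through[of "\<lambda>z. z\<^sup>2" f])
  show "surj (\<lambda>z::complex. z\<^sup>2)"
    by (metis power2_csqrt surj_def)
  have "deriv (\<lambda>z::complex. z\<^sup>2) z = 2 * z" for z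
    by (rule DERIV_imp_deriv) (auto intro!: derivative_eq_intros)
  then have "{z. deriv (\<lambda>z::complex. z\<^sup>2) z = 0} = {0}" by auto
  then show "finite ((\<lambda>z::complex. z\<^sup>2) ` {z. deriv (\<lambda>z::complex. z\<^sup>2) z = 0})" by simp
  show "f a = f b" if "a\<^sup>2 = b\<^sup>2" for a b
    using that assms(2) by (metis power2_eq_iff)
qed (use assms that in \<open>auto intro!: holomorphic_intros\<close>)

lemma periodic_int_shift:
  fixes f :: "complex \<Rightarrow> complex"
  assumes per: "\<And>z. f (z + c) = f z"
  shows "f (z + of_int k * c) = f z"
proof -
  have n: "f (z + of_nat k * c) = f z" for z and k :: nat
  proof (induction k)
    case (Suc k)
    have "f (z + of_nat (Suc k) * c) = f (z + of_nat k * c + c)" by (simp add: algebra_simps)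
    then show ?case using per Suc by simp
  qed simp
  show ?thesis
  proof (cases "k \<ge> 0")
    case True
    then show ?thesis using n[of z "nat k"] by simp
  next
    case False
    then show ?thesis using n[of "z + of_int k * c" "nat (- k)"] by (simp add: algebra_simps)
  qed
qed

lemma entire_even_periodic_cos:
  assumes f: "f holomorphic_on UNIV" and ev: "\<And>z. f (- z) = f z"
    and per: "\<And>z. f (z + 2 * of_real pi) = f z"
  obtains q where "q holomorphic_on UNIV" "\<And>z. f z = q (cos z)"
proof (rule entire_factor_through[of "cos" f])
  show "surj (cos :: complex \<Rightarrow> complex)"
    by (metis cos_Arccos surj_def)
  note shift = periodic_int_shift[of f, OF per]
  have dc: "deriv cos z = - sin z" for z :: complex
    by (rule DERIV_imp_deriv) (auto intro!: derivative_eq_intros)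
  have "cos z \<in> {-1, 1}" if "sin z = 0" for z :: complex
    using sin_cos_squared_add[of z] that by (auto simp: power2_eq_1_iff)
  then have "cos ` {z::complex. deriv cos z = 0} \<subseteq> {-1, 1}" by (auto simp: dc)
  then show "finite (cos ` {z::complex. deriv cos z = 0})" by (rule finite_subset) simp
  show "f a = f b" if ab: "cos a = cos b" for a b
  proof -
    obtain n where "n \<in> \<int>" and n: "a = b + of_real (2*n*pi) \<or> a = - b + of_real (2*n*pi)"
      using ab complex_cos_eq by blast
    then obtain k :: int where "n = of_int k" by (metis Ints_cases)
    then show ?thesis using n shift[of b k] shift[of "-b" k] ev by (auto simp: mult_ac)
  qed
qed (use assms that in \<open>auto intro!: holomorphic_intros\<close>)

text \<open>
  This inequality turns exponential growth in the imaginary part of \<open>z\<close> into polynomial growth in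
  \<open>cos z\<close>.
\<close>

lemma cmod_cos_ge: "exp \<bar>Im z\<bar> \<le> 2 * cmod (cos z) + 1"
proof -
  have *: "exp (Im z) \<le> 2 * cmod (cos z) + 1" if "Im z \<ge> 0" for z
  proof -
    have "cmod (exp (-(\<i> * z))) - cmod (exp (\<i> * z)) \<le> cmod (exp (\<i> * z) + exp (-(\<i> * z)))"
      by (metis add.commute norm_diff_ineq)
    moreover have "exp (\<i> * z) + exp (-(\<i> * z)) = 2 * cos z" by (simp add: cos_exp_eq)
    ultimately have "exp (Im z) - exp (- Im z) \<le> 2 * cmod (cos z)" by (simp add: norm_mult)
    moreover have "exp (- Im z) \<le> 1" using that by simp
    ultimately show ?thesis by linarith
  qed
  show ?thesis using *[of z] *[of "-z"] by (cases "Im z \<ge> 0") auto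
qed

text \<open>
  The factor \<open>g\<close> with \<open>f = g \<circ> cos\<close> grows at most like \<open>|w|\<close> to the power \<open>n\<close>, so it is a polynomial
  by Liouville's theorem.
\<close>

lemma periodic_exponential_type_is_cos_poly:
  assumes f: "f holomorphic_on UNIV" and ev: "\<And>z. f (- z) = f z"
    and per: "\<And>z. f (z + 2 * of_real pi) = f z"
    and bd: "\<And>z. cmod (f z) \<le> C * exp (real n * \<bar>Im z\<bar>)"
  obtains q :: "complex poly" where "degree q \<le> n" "\<And>z. f z = poly q (cos z)"
proof -
  obtain g where g: "g holomorphic_on UNIV" "\<And>z. f z = g (cos z)"
    using entire_even_periodic_cos[OF f ev per] by blast
  have C: "C \<ge> 0" using bd[of 0] norm_ge_zero[of "f 0"] by simp (meson order_trans norm_ge_zero)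
  have gb: "cmod (g w) \<le> C * 3 ^ n * cmod w ^ n" if "1 \<le> cmod w" for w
  proof -
    obtain z where z: "w = cos z" by (metis cos_Arccos)
    have "exp \<bar>Im z\<bar> \<le> 3 * cmod w" using cmod_cos_ge[of z] that z by simp
    then have "exp \<bar>Im z\<bar> ^ n \<le> (3 * cmod w) ^ n" by (intro power_mono) auto
    then have "exp (real n * \<bar>Im z\<bar>) \<le> (3 * cmod w) ^ n" by (simp add: exp_of_nat_mult)
    then have "C * exp (real n * \<bar>Im z\<bar>) \<le> C * (3 * cmod w) ^ n" using C by (rule mult_left_mono)
    with bd[of z] show ?thesis
      by (simp add: g(2)[of z] z power_mult_distrib mult.assoc)
  qed
  define q where "q = (\<Sum>k\<le>n. monom ((deriv ^^ k) g 0 / fact k) k)"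
  have "g w = poly q w" for w
    using Liouville_polynomial[OF g(1), of 1 "C * 3 ^ n" n w] gb
    by (simp add: q_def poly_sum poly_monom)
  moreover have "degree q \<le> n" unfolding q_def
    by (intro degree_sum_le) (auto intro: order_trans[OF degree_monom_le])
  ultimately show ?thesis using that g(2) by metis
qed

section \<open>A Phragmen-Lindelof bound for functions of exponential type\<close>

text \<open>
  Estimates for the damping factor of the Phragmen-Lindelof argument below, which is the exponential of
  a negative multiple of \<open>v + 1\<close> to the power 3/2. This exponent lies strictly between the order 1 of
  the functions to be bounded and the critical order 2 of a quadrant; in the sector
  \<open>|Im v| \<le> Re v\<close> the power has a real part of full order.
\<close>

lemma Re_cube_csqrt_ge:
  fixes v :: complex
  assumes v: "\<bar>Im v\<bar> \<le> Re v"
  defines "s \<equiv> csqrt (v + 1)"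
  shows "Re (s ^ 3) \<ge> 0" "sqrt (cmod v / 2) * cmod v / 8 \<le> Re (s ^ 3)"
proof -
  define p q where "p = Re s" and "q = Im s"
  have s2: "s\<^sup>2 = v + 1" by (simp add: s_def)
  have "Re (s\<^sup>2) = p\<^sup>2 - q\<^sup>2" "Im (s\<^sup>2) = 2 * p * q"
    by (simp_all add: p_def q_def power2_eq_square)
  then have pq: "p\<^sup>2 - q\<^sup>2 = Re v + 1" "2 * p * q = Im v" by (simp_all add: s2)
  have p0: "p \<ge> 0" using csqrt_principal[of "v+1"] unfolding p_def s_def by auto
  have "2 * p * \<bar>q\<bar> \<le> p\<^sup>2 - q\<^sup>2"
  proof -
    have "2 * p * \<bar>q\<bar> = \<bar>Im v\<bar>" using p0 by (simp add: abs_mult flip: pq(2))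
    with pq(1) v show ?thesis by linarith
  qed
  have q: "\<bar>q\<bar> \<le> p / 2"
  proof (rule ccontr)
    assume "\<not> ?thesis"
    then have "p * (p / 2) \<le> p * \<bar>q\<bar>" using p0 by (intro mult_left_mono) auto
    then have "p\<^sup>2 \<le> 2 * p * \<bar>q\<bar>" by (simp add: power2_eq_square)
    with \<open>2 * p * \<bar>q\<bar> \<le> p\<^sup>2 - q\<^sup>2\<close> have "q\<^sup>2 \<le> 0" by linarith
    then have "q = 0" by simp
    with \<open>\<not> ?thesis\<close> p0 show False by simp
  qed
  then have q2: "q\<^sup>2 \<le> p\<^sup>2 / 4"
    using power_mono[of "\<bar>q\<bar>" "p / 2" 2] by (simp add: power_divide)
  have "Re (s ^ 3) = p * (p\<^sup>2 - 3 * q\<^sup>2)"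
    by (simp add: p_def q_def power3_eq_cube power2_eq_square algebra_simps)
  moreover have "p * (p\<^sup>2 / 4) \<le> p * (p\<^sup>2 - 3 * q\<^sup>2)"
    using q2 p0 by (intro mult_left_mono) auto
  ultimately have s3: "p * (p\<^sup>2 / 4) \<le> Re (s ^ 3)" by simp
  then show "Re (s ^ 3) \<ge> 0" using p0 by (meson order_trans mult_nonneg_nonneg zero_le_divide_iff zero_le_power2 zero_le_numeral)
  have "cmod v \<le> \<bar>Re v\<bar> + \<bar>Im v\<bar>" by (rule cmod_le)
  also have "\<dots> \<le> 2 * (p\<^sup>2 - q\<^sup>2)" 
  proof -
    have "0 \<le> Re v" by (rule order_trans[OF abs_ge_zero v])
    then show ?thesis unfolding pq(1) using v by simp
  qed
  also have "\<dots> \<le> 2 * p\<^sup>2" by simp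
  finally have vp: "cmod v / 2 \<le> p\<^sup>2" by simp
  then have "sqrt (cmod v / 2) \<le> p" using p0 by (simp add: real_le_lsqrt)
  then have "sqrt (cmod v / 2) * (cmod v / 8) \<le> p * (p\<^sup>2 / 4)"
    using vp p0 by (intro mult_mono) auto
  from order_trans[OF this s3] show "sqrt (cmod v / 2) * cmod v / 8 \<le> Re (s ^ 3)" by simp
qed

text \<open>
  The function is multiplied by \<open>exp (- \<delta> s^3)\<close>, where \<open>s^3\<close> is the 3/2 power of the lemma above in
  coordinates in which the quadrant is symmetric about the positive axis. The product decays, so the
  maximum principle applies to a large quarter disc, and then \<open>\<delta>\<close> tends to 0.
\<close>

lemma phragmen_lindelof_quadrant:
  fixes G :: "complex \<Rightarrow> complex"
  assumes hol: "G holomorphic_on {z. Re z > 0 \<and> Im z > 0}"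
    and cont: "continuous_on {z. Re z \<ge> 0 \<and> Im z \<ge> 0} G"
    and growth: "\<And>z. Re z \<ge> 0 \<Longrightarrow> Im z \<ge> 0 \<Longrightarrow> cmod (G z) \<le> C * exp (k * cmod z)"
    and re: "\<And>x. x \<ge> 0 \<Longrightarrow> cmod (G (of_real x)) \<le> M"
    and im: "\<And>y. y \<ge> 0 \<Longrightarrow> cmod (G (\<i> * of_real y)) \<le> M"
    and M: "M > 0" and z: "Re z \<ge> 0" "Im z \<ge> 0"
  shows "cmod (G z) \<le> M"
proof -
  \<comment> \<open>rotation by an eighth of a turn makes the quadrant the sector of the damping lemma\<close>
  define e where "e = Complex (sqrt (1/2)) (- sqrt (1/2))"
  define v where "v w = e * w" for w
  have "cmod e = 1" by (simp add: e_def cmod_def)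
  then have cv: "cmod (v w) = cmod w" for w
    by (simp add: v_def norm_mult)
  have Rv: "Re (v w) = sqrt (1/2) * (Re w + Im w)" and Iv: "Im (v w) = sqrt (1/2) * (Im w - Re w)" for w
    by (simp_all add: v_def e_def algebra_simps)
  have vv: "\<bar>Im (v w)\<bar> \<le> Re (v w)" if "Re w \<ge> 0" "Im w \<ge> 0" for w
    unfolding Rv Iv abs_mult using that by (intro mult_mono) auto
  define s where "s w = csqrt (v w + 1)" for w
  have nn: "v w + 1 \<notin> \<real>\<^sub>\<le>\<^sub>0" if "Re w \<ge> 0" "Im w \<ge> 0" for w
    using vv[OF that] by (auto simp: complex_nonpos_Reals_iff)
  have vh: "v holomorphic_on A" and vc: "continuous_on A v" for A
    unfolding v_def[abs_def] by (intro holomorphic_intros continuous_intros)+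
  have sh: "s holomorphic_on {z. Re z > 0 \<and> Im z > 0}"
    unfolding s_def by (intro holomorphic_intros vh nn) auto
  have sc: "continuous_on {z. Re z \<ge> 0 \<and> Im z \<ge> 0} s"
    unfolding s_def by (intro continuous_intros vc continuous_on_compose2[OF continuous_on_csqrt]) (use nn in auto)
  have key: "cmod (G z) \<le> M * exp (\<delta> * Re (s z ^ 3))" if d: "\<delta> > 0" for \<delta>
  proof -
    define H where "H w = G w * exp (- of_real \<delta> * s w ^ 3)" for w
    have Hn: "cmod (H w) = cmod (G w) * exp (- \<delta> * Re (s w ^ 3))" for w
    proof -
      have "Re (- of_real \<delta> * x) = - \<delta> * Re x" for x by simp
      then show ?thesis unfolding H_def norm_mult norm_exp_eq_Re by presburger
    qed
    have Hle: "cmod (H w) \<le> cmod (G w)" if "Re w \<ge> 0" "Im w \<ge> 0" for w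
    proof -
      have "0 \<le> \<delta> * Re (s w ^ 3)"
        unfolding s_def using Re_cube_csqrt_ge(1)[OF vv[OF that]] d by (intro mult_nonneg_nonneg) auto
      then have "exp (- \<delta> * Re (s w ^ 3)) \<le> 1" by simp
      then show ?thesis unfolding Hn by (intro mult_left_le) auto
    qed
    \<comment> \<open>on the arc of radius \<open>R\<close> the damping beats both \<open>exp (k R)\<close> and the quotient of \<open>C\<close> and \<open>M\<close>\<close>
    obtain R where R: "cmod z + 1 \<le> R" "ln (\<bar>C\<bar> / M + 1) \<le> R" "2 * (8 * (\<bar>k\<bar> + 1) / \<delta>)\<^sup>2 \<le> R"
    proof -
      have "\<exists>R. a \<le> R \<and> b \<le> R \<and> c \<le> R" for a b c :: real
        by (rule exI[of _ "max a (max b c)"]) (simp add: le_max_iff_disj)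
      then show ?thesis using that by blast
    qed
    have R0: "R > 0" using R(1) norm_ge_zero[of z] by linarith
    have far: "cmod (H w) \<le> M" if w: "Re w \<ge> 0" "Im w \<ge> 0" "cmod w = R" for w
    proof -
      have "8 * (\<bar>k\<bar> + 1) / \<delta> \<le> sqrt (R / 2)"
        using R(3) by (intro real_le_rsqrt) simp
      then have "\<bar>k\<bar> + 1 \<le> \<delta> * (sqrt (R / 2) / 8)" using d by (simp add: field_simps)
      then have "(\<bar>k\<bar> + 1) * R \<le> \<delta> * (sqrt (R / 2) / 8) * R" using R0 by (intro mult_right_mono) auto
      also have "\<dots> = \<delta> * (sqrt (cmod (v w) / 2) * cmod (v w) / 8)" by (simp add: cv w)
      also have "\<dots> \<le> \<delta> * Re (s w ^ 3)"
        using Re_cube_csqrt_ge(2)[OF vv[OF w(1,2)]] d unfolding s_def by (intro mult_left_mono) auto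
      finally have e: "(\<bar>k\<bar> + 1) * R \<le> \<delta> * Re (s w ^ 3)" .
      have "k * R \<le> \<bar>k\<bar> * R" using R0 by (intro mult_right_mono) auto
      with e have "k * R - \<delta> * Re (s w ^ 3) \<le> - R" by (simp add: algebra_simps)
      then have "exp (k * R) * exp (- \<delta> * Re (s w ^ 3)) \<le> exp (- R)"
        by (simp add: exp_add[symmetric])
      moreover have "cmod (G w) \<le> \<bar>C\<bar> * exp (k * R)"
        using growth[OF w(1,2)] mult_right_mono[OF abs_ge_self, of "exp (k * R)" C] unfolding w(3) by (rule order_trans) simp
      ultimately have "cmod (H w) \<le> \<bar>C\<bar> * exp (- R)"
      proof -
        assume a: "exp (k * R) * exp (- \<delta> * Re (s w ^ 3)) \<le> exp (- R)" and b: "cmod (G w) \<le> \<bar>C\<bar> * exp (k * R)"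
        have "cmod (H w) \<le> (\<bar>C\<bar> * exp (k * R)) * exp (- \<delta> * Re (s w ^ 3))"
          unfolding Hn by (rule mult_right_mono[OF b]) simp
        also have "\<dots> \<le> \<bar>C\<bar> * exp (- R)" unfolding mult.assoc by (rule mult_left_mono[OF a]) simp
        finally show ?thesis .
      qed
      also have "\<bar>C\<bar> / M + 1 \<le> exp R"
      proof -
        have "\<bar>C\<bar> / M + 1 > 0" using M by (intro add_nonneg_pos) auto
        then show ?thesis using R(2) by (metis exp_le_cancel_iff exp_ln)
      qed
      then have "\<bar>C\<bar> \<le> M * exp R" using M by (simp add: field_simps)
      then have "\<bar>C\<bar> * exp (- R) \<le> M" by (simp add: exp_minus field_simps)
      finally show ?thesis .
    qed
    define S where "S = {z. Re z > 0 \<and> Im z > 0 \<and> cmod z < R}"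
    have openS: "open S" unfolding S_def
      by (intro open_Collect_conj open_Collect_less continuous_intros)
    have "closed {z. Re z \<ge> 0 \<and> Im z \<ge> 0 \<and> cmod z \<le> R}"
      by (intro closed_Collect_conj closed_Collect_le continuous_intros)
    then have clS: "closure S \<subseteq> {z. Re z \<ge> 0 \<and> Im z \<ge> 0 \<and> cmod z \<le> R}"
      by (intro closure_minimal) (auto simp: S_def)
    have hS: "H holomorphic_on S" unfolding H_def
      by (intro holomorphic_intros holomorphic_on_subset[OF hol] holomorphic_on_subset[OF sh]) (auto simp: S_def)
    have cS: "continuous_on {z. Re z \<ge> 0 \<and> Im z \<ge> 0} H" unfolding H_def
      by (intro continuous_intros cont sc)
    have bS: "bounded S" unfolding S_def
      by (rule bounded_subset[OF bounded_ball[of 0 R]]) auto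
    have fr: "cmod (H w) \<le> M" if "w \<in> frontier S" for w
    proof -
      have w: "w \<in> closure S" "w \<notin> S" using that openS by (auto simp: frontier_def interior_open)
      with clS have w': "Re w \<ge> 0" "Im w \<ge> 0" "cmod w \<le> R" by auto
      with w(2) consider "Re w = 0" | "Im w = 0" | "cmod w = R" unfolding S_def by fastforce
      then show ?thesis
      proof cases
        case 1
        then have "w = \<i> * of_real (Im w)" by (simp add: complex_eq_iff)
        then show ?thesis using im[of "Im w"] Hle[OF w'(1,2)] w' by (metis order_trans)
      next
        case 2
        then have "w = of_real (Re w)" by (simp add: complex_eq_iff)
        then show ?thesis using re[of "Re w"] Hle[OF w'(1,2)] w' by (metis order_trans)
      next
        case 3
        then show ?thesis using far w' by blast
      qed
    qed
    have S_in: "cmod (H w) \<le> M" if "w \<in> S" for w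
    proof (rule maximum_modulus_frontier[OF _ _ bS fr that])
      show "H holomorphic_on interior S" using hS openS by (simp add: interior_open)
      show "continuous_on (closure S) H" using clS by (intro continuous_on_subset[OF cS]) auto
    qed
    have "cmod (H z) \<le> M"
    proof (cases "z \<in> S")
      case True then show ?thesis by (rule S_in)
    next
      case False
      with R z consider "Re z = 0" | "Im z = 0" unfolding S_def by fastforce
      then show ?thesis
      proof cases
        case 1
        then have "z = \<i> * of_real (Im z)" by (simp add: complex_eq_iff)
        then show ?thesis using im[of "Im z"] Hle[OF z] z by (metis order_trans)
      next
        case 2
        then have "z = of_real (Re z)" by (simp add: complex_eq_iff)
        then show ?thesis using re[of "Re z"] Hle[OF z] z by (metis order_trans)
      qed
    qed
    then show ?thesis unfolding Hn by (simp add: exp_minus field_simps)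
  qed
  have "((\<lambda>\<delta>. M * exp (\<delta> * Re (s z ^ 3))) \<longlongrightarrow> M * exp (0 * Re (s z ^ 3))) (at_right 0)"
    by (intro tendsto_intros)
  moreover have "\<forall>\<^sub>F \<delta> in at_right 0. cmod (G z) \<le> M * exp (\<delta> * Re (s z ^ 3))"
    using key by (auto simp: eventually_at_filter)
  ultimately have "cmod (G z) \<le> M * exp (0 * Re (s z ^ 3))"
    by (rule tendsto_lowerbound) simp
  then show ?thesis by simp
qed

text \<open>
  The Phragmen-Lindelof principle is applied to \<open>f z * exp (\<i> \<sigma> z) / (z + 1)\<close>: the exponential compensates
  the growth along the imaginary axis, the denominator the linear growth along the real axis.
\<close>

lemma exp_type_linear_growth_quadrant:
  fixes f :: "complex \<Rightarrow> complex"
  assumes hol: "f holomorphic_on UNIV"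
    and growth: "\<And>z. cmod (f z) \<le> C * exp (\<sigma> * cmod z)"
    and re: "\<And>x. x \<ge> 0 \<Longrightarrow> cmod (f (of_real x)) \<le> C * (1 + x)"
    and C: "C > 0" and s: "\<sigma> > 0" and z: "Re z \<ge> 0" "Im z \<ge> 0"
  shows "cmod (f z) \<le> C * (1 + cmod z) * exp (\<sigma> * Im z)"
proof -
  define G where "G w = f w * exp (\<i> * of_real \<sigma> * w) / (w + 1)" for w
  have n0: "cmod (w + 1) \<ge> 1" if "Re w \<ge> 0" for w
    using abs_Re_le_cmod[of "w + 1"] that by simp
  then have n0': "w + 1 \<noteq> 0" if "Re w \<ge> 0" for w using that by fastforce
  have Gn: "cmod (G w) = cmod (f w) * exp (- \<sigma> * Im w) / cmod (w + 1)" for w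
    by (simp add: G_def norm_mult norm_divide)
  have Gle: "cmod (G w) \<le> cmod (f w) * exp (- \<sigma> * Im w)" if "Re w \<ge> 0" for w
  proof -
    have "cmod (f w) * exp (- \<sigma> * Im w) / cmod (w + 1) \<le> cmod (f w) * exp (- \<sigma> * Im w) / 1"
      using n0[OF that] by (intro divide_left_mono) auto
    then show ?thesis unfolding Gn by simp
  qed
  have "cmod (G z) \<le> C"
  proof (rule phragmen_lindelof_quadrant[OF _ _ _ _ _ C z])
    show "G holomorphic_on {z. Re z > 0 \<and> Im z > 0}" unfolding G_def
      using n0' by (intro holomorphic_intros holomorphic_on_subset[OF hol]) auto
    show "continuous_on {z. Re z \<ge> 0 \<and> Im z \<ge> 0} G" unfolding G_def
      using n0' by (intro continuous_intros holomorphic_on_imp_continuous_on holomorphic_on_subset[OF hol]) auto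
    show "cmod (G w) \<le> C * exp (\<sigma> * cmod w)" if "Re w \<ge> 0" "Im w \<ge> 0" for w
    proof -
      have "exp (- \<sigma> * Im w) \<le> 1" using s that by simp
      then have "cmod (f w) * exp (- \<sigma> * Im w) \<le> cmod (f w)" by (intro mult_left_le) auto
      then show ?thesis using Gle[OF that(1)] growth[of w] by linarith
    qed
    show "cmod (G (of_real x)) \<le> C" if "x \<ge> 0" for x
    proof -
      have "cmod (of_real x + 1) = 1 + x" using that by (metis abs_of_nonneg add.commute add_nonneg_nonneg norm_of_real of_real_1 of_real_add zero_le_one)
      then show ?thesis unfolding Gn using re[OF that] that by (simp add: divide_le_eq add.commute)
    qed
    show "cmod (G (\<i> * of_real y)) \<le> C" if "y \<ge> 0" for y
    proof -
      have "cmod (f (\<i> * of_real y)) \<le> C * exp (\<sigma> * y)" using growth[of "\<i> * of_real y"] that by (simp add: norm_mult)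
      then have "cmod (f (\<i> * of_real y)) * exp (- \<sigma> * y) \<le> C" by (simp add: exp_minus field_simps)
      then show ?thesis using Gle[of "\<i> * of_real y"] by simp
    qed
  qed
  then have "cmod (f z) * exp (- \<sigma> * Im z) \<le> C * cmod (z + 1)"
    unfolding Gn using n0[OF z(1)] n0'[OF z(1)] by (simp add: divide_le_eq)
  also have "\<dots> \<le> C * (1 + cmod z)" using C norm_triangle_ineq[of z 1] by (intro mult_left_mono) auto
  finally show ?thesis by (simp add: exp_minus field_simps)
qed

text \<open>
  The other quadrants are reached by the symmetries \<open>z \<mapsto> - z\<close> and \<open>z \<mapsto> - cnj z\<close>.
\<close>

lemma exp_type_linear_growth:
  fixes f :: "complex \<Rightarrow> complex"
  assumes hol: "f holomorphic_on UNIV"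
    and growth: "\<And>z. cmod (f z) \<le> C * exp (\<sigma> * cmod z)"
    and re: "\<And>x::real. cmod (f (of_real x)) \<le> C * (1 + \<bar>x\<bar>)"
    and C: "C > 0" and s: "\<sigma> > 0"
  shows "cmod (f z) \<le> C * (1 + cmod z) * exp (\<sigma> * \<bar>Im z\<bar>)"
proof -
  have up: "cmod (f z) \<le> C * (1 + cmod z) * exp (\<sigma> * Im z)"
    if hol: "f holomorphic_on UNIV"
      and growth: "\<And>z. cmod (f z) \<le> C * exp (\<sigma> * cmod z)"
      and re: "\<And>x::real. cmod (f (of_real x)) \<le> C * (1 + \<bar>x\<bar>)" and z: "Im z \<ge> 0" for f z
  proof (cases "Re z \<ge> 0")
    case True
    show ?thesis
    proof (rule exp_type_linear_growth_quadrant[OF hol growth _ C s True z])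
      show "cmod (f (of_real x)) \<le> C * (1 + x)" if "x \<ge> 0" for x using re[of x] that by simp
    qed
  next
    case False
    have "(cnj \<circ> f \<circ> cnj) holomorphic_on UNIV"
      by (rule holomorphic_on_compose_cnj_cnj) (auto intro: holomorphic_on_subset[OF hol])
    then have "((cnj \<circ> f \<circ> cnj) \<circ> uminus) holomorphic_on UNIV"
      by (intro holomorphic_on_compose[of uminus UNIV]) (auto intro!: holomorphic_intros elim: holomorphic_on_subset)
    then have "cmod (((cnj \<circ> f \<circ> cnj) \<circ> uminus) (- cnj z)) \<le> C * (1 + cmod (- cnj z)) * exp (\<sigma> * Im (- cnj z))"
    proof (rule exp_type_linear_growth_quadrant[OF _ _ _ C s])
      show "cmod (((cnj \<circ> f \<circ> cnj) \<circ> uminus) w) \<le> C * exp (\<sigma> * cmod w)" for w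
        using growth[of "- cnj w"] by simp
      show "cmod (((cnj \<circ> f \<circ> cnj) \<circ> uminus) (of_real x)) \<le> C * (1 + x)" if "x \<ge> 0" for x
        using re[of "- x"] that by simp
    qed (use False z in auto)
    then show ?thesis by simp
  qed
  show ?thesis
  proof (cases "Im z \<ge> 0")
    case True
    then show ?thesis using up[OF hol growth re True] by simp
  next
    case False
    have "(f \<circ> uminus) holomorphic_on UNIV"
      using hol by (intro holomorphic_on_compose[of uminus UNIV]) (auto intro!: holomorphic_intros elim: holomorphic_on_subset)
    then have "cmod ((f \<circ> uminus) (- z)) \<le> C * (1 + cmod (- z)) * exp (\<sigma> * Im (- z))"
    proof (rule up)
      show "cmod ((f \<circ> uminus) w) \<le> C * exp (\<sigma> * cmod w)" for w using growth[of "- w"] by simp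
      show "cmod ((f \<circ> uminus) (of_real x)) \<le> C * (1 + \<bar>x\<bar>)" for x using re[of "- x"] by simp
    qed (use False in auto)
    then show ?thesis using False by simp
  qed
qed

section \<open>Polynomials in the cosine\<close>

text \<open>
  With \<open>\<zeta> = exp (\<i> z)\<close> the product of \<open>\<zeta>^n\<close> and \<open>q (cos z)\<close> is a polynomial in \<open>\<zeta>\<close>. It is bounded by
  \<open>M\<close> on the unit circle, hence on the unit disc.
\<close>

lemma poly_cos_growth:
  fixes q :: "complex poly"
  assumes deg: "degree q \<le> n"
    and bd: "\<And>x::real. \<bar>x\<bar> \<le> 1 \<Longrightarrow> cmod (poly q (of_real x)) \<le> M"
  shows "cmod (poly q (cos z)) \<le> M * exp (real n * \<bar>Im z\<bar>)"
proof -
  \<comment> \<open>\<open>H (exp (\<i> z))\<close> is \<open>exp (\<i> z)^n\<close> times \<open>q (cos z)\<close>\<close>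
  define H where "H \<zeta> = (\<Sum>i\<le>degree q. coeff q i * \<zeta> ^ (n - i) * ((\<zeta>\<^sup>2 + 1) / 2) ^ i)" for \<zeta>
  have H: "H (exp (\<i> * z)) = exp (\<i> * z) ^ n * poly q (cos z)" for z
  proof -
    have c: "((exp (\<i> * z))\<^sup>2 + 1) / 2 = exp (\<i> * z) * cos z"
      by (simp add: cos_exp_eq power2_eq_square algebra_simps exp_add[symmetric] divide_simps)
    have "coeff q i * exp (\<i> * z) ^ (n - i) * (((exp (\<i> * z))\<^sup>2 + 1) / 2) ^ i
        = exp (\<i> * z) ^ n * (coeff q i * cos z ^ i)" if "i \<le> degree q" for i
    proof -
      have "exp (\<i> * z) ^ n = exp (\<i> * z) ^ (n - i) * exp (\<i> * z) ^ i"
        using that deg by (simp flip: power_add)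
      then show ?thesis unfolding c by (simp add: power_mult_distrib mult_ac)
    qed
    then show ?thesis unfolding H_def poly_altdef sum_distrib_left by (intro sum.cong) auto
  qed
  have H1: "cmod (H \<zeta>) \<le> M" if "cmod \<zeta> \<le> 1" for \<zeta>
  proof -
    have fr: "cmod (H w) \<le> M" if "w \<in> frontier (cball 0 1)" for w
    proof -
      have w: "cmod w = 1" using that by (simp add: frontier_cball)
      have "w = exp (\<i> * of_real (Arg w))" using w by (metis complex_norm_eq_1_exp_eq)
      then have "H w = w ^ n * poly q (of_real (cos (Arg w)))"
        using H[of "of_real (Arg w)"] by (simp add: cos_of_real)
      then show ?thesis using bd[of "cos (Arg w)"] w by (simp add: norm_mult norm_power)
    qed
    have hh: "H holomorphic_on A" for A
      unfolding H_def by (intro holomorphic_intros) auto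
    show ?thesis
      by (rule maximum_modulus_frontier[of H "cball 0 1"])
        (use fr hh that in \<open>auto intro: holomorphic_on_imp_continuous_on\<close>)
  qed
  have *: "cmod (poly q (cos z)) \<le> M * exp (real n * Im z)" if "Im z \<ge> 0" for z
  proof -
    have "cmod (H (exp (\<i> * z))) \<le> M" by (rule H1) (simp add: that)
    then have "exp (- Im z) ^ n * cmod (poly q (cos z)) \<le> M" by (simp add: H norm_mult norm_power)
    then show ?thesis by (simp add: exp_minus exp_of_nat2_mult exp_of_nat_mult power_inverse field_simps)
  qed
  show ?thesis using *[of z] *[of "-z"] by (cases "Im z \<ge> 0") auto
qed

text \<open>
  Cauchy's estimate on discs of radius \<open>1 / n\<close> turns the growth bound into a weak form of Bernstein's
  inequality: the derivative of \<open>q (cos t)\<close> is at most \<open>3 n M\<close> at real \<open>t\<close>.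
\<close>

lemma poly_cos_lower_near_max:
  fixes q :: "complex poly"
  assumes deg: "degree q \<le> n" and n: "n \<ge> 1"
    and bd: "\<And>x::real. \<bar>x\<bar> \<le> 1 \<Longrightarrow> cmod (poly q (of_real x)) \<le> M"
    and t: "\<bar>t - t0\<bar> \<le> 1 / (6 * real n)"
    and t0: "cmod (poly q (of_real (cos t0))) = M"
  shows "M / 2 \<le> cmod (poly q (of_real (cos t)))"
proof -
  define f where "f z = poly q (cos z)" for z
  have M: "M \<ge> 0" using t0 by (metis norm_ge_zero)
  have fh: "f holomorphic_on A" for A unfolding f_def by (intro holomorphic_intros)
  have der: "cmod (deriv f x) \<le> 3 * real n * M" if "x \<in> \<real>" for x
  proof -
    have "cmod ((deriv ^^ 1) f x) \<le> fact 1 * (M * 3) / (1 / real n) ^ 1"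
    proof (rule Cauchy_inequality)
      show "cmod (f y) \<le> M * 3" if y: "cmod (x - y) = 1 / real n" for y
      proof -
        have "Im x = 0" using \<open>x \<in> \<real>\<close> by (simp add: complex_is_Real_iff)
        then have "\<bar>Im y\<bar> \<le> 1 / real n" using abs_Im_le_cmod[of "x - y"] y by simp
        then have "real n * \<bar>Im y\<bar> \<le> 1" using n by (simp add: field_simps)
        then have "exp (real n * \<bar>Im y\<bar>) \<le> exp 1" by simp
        also have "exp (1::real) \<le> 3" by (rule exp_le)
        finally have "M * exp (real n * \<bar>Im y\<bar>) \<le> M * 3" using M by (rule mult_left_mono)
        with poly_cos_growth[OF deg bd, of y] show ?thesis unfolding f_def by simp
      qed
    qed (use n fh holomorphic_on_imp_continuous_on in auto)
    then show ?thesis by (simp add: mult_ac)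
  qed
  have "cmod (f (of_real t) - f (of_real t0)) \<le> (3 * real n * M) * cmod (of_real t - of_real t0 :: complex)"
  proof (rule field_differentiable_bound[OF convex_Reals])
    show "(f has_field_derivative deriv f z) (at z within \<real>)" for z
      using fh[of UNIV] by (metis DERIV_subset UNIV_I holomorphic_derivI open_UNIV subset_UNIV)
  qed (use der in auto)
  also have "cmod (of_real t - of_real t0 :: complex) = \<bar>t - t0\<bar>"
    by (metis norm_of_real of_real_diff)
  also have "3 * real n * M * \<bar>t - t0\<bar> \<le> 3 * real n * M * (1 / (6 * real n))"
    using t M by (intro mult_left_mono) auto
  also have "\<dots> = M / 2" using n by simp
  finally have "cmod (f (of_real t) - f (of_real t0)) \<le> M / 2" .
  moreover have "cmod (f (of_real t0)) = M" using t0 by (simp add: f_def cos_of_real)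
  ultimately have "M / 2 \<le> cmod (f (of_real t))"
    using norm_triangle_ineq2[of "f (of_real t0)" "f (of_real t)"] by (simp add: norm_minus_commute)
  then show ?thesis by (simp add: f_def cos_of_real)
qed

text \<open>
  In the variable \<open>u = n \<theta>\<close> the integrand converges as \<open>n\<close> grows; with \<open>\<theta>\<close> as variable this is
  \<open>n\<close> to the power \<open>a + 1\<close> times an integral over the half circle (see \<open>scaled_arc_int_eq_arc_int\<close>).
\<close>

definition scaled_arc_int :: "real \<Rightarrow> real \<Rightarrow> nat \<Rightarrow> complex poly \<Rightarrow> ennreal" where
  "scaled_arc_int p a n q = (\<integral>\<^sup>+u. ennreal (cmod (poly q (of_real (cos (u / real n)))) powr p *
      (real n * sin (u / real n)) powr a) * indicator {0..pi * real n} u \<partial>lborel)"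

definition half_line_int :: "real \<Rightarrow> real \<Rightarrow> (complex \<Rightarrow> complex) \<Rightarrow> ennreal" where
  "half_line_int p a f = (\<integral>\<^sup>+u. ennreal (cmod (f (of_real u)) powr p * u powr a) * indicator {0..} u \<partial>lborel)"

definition even_exp_type :: "(complex \<Rightarrow> complex) set" where
  "even_exp_type = {f. f holomorphic_on UNIV \<and> (\<forall>z. f (- z) = f z) \<and>
     (\<forall>\<epsilon>>0. \<exists>C>0. \<forall>z. cmod (f z) \<le> C * exp ((1 + \<epsilon>) * cmod z))}"

lemma sin_ge_quarter:
  fixes x :: real assumes "0 \<le> x" "x \<le> pi / 2" shows "x / 4 \<le> sin x"
proof -
  have *: "5 / 6 * x \<le> sin x" if "0 \<le> x" "x \<le> 1" for x :: real
  proof -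
    have "(\<Sum>m<3. sin_coeff m * x ^ m) = x"
      by (simp add: sin_coeff_def numeral_3_eq_3)
    then have "\<bar>sin x - x\<bar> \<le> \<bar>x\<bar> ^ 3 / 6"
      using Maclaurin_sin_bound[of x 3] by (simp add: fact_numeral)
    moreover have "x * x\<^sup>2 \<le> x * 1" using that by (intro mult_left_mono) (auto simp: power_le_one)
    ultimately show ?thesis using that by (simp add: power3_eq_cube power2_eq_square abs_if split: if_splits)
  qed
  show ?thesis
  proof (cases "x \<le> 1")
    case True
    then show ?thesis using *[of x] assms by simp
  next
    case False
    have "sin 1 \<le> sin x" using False assms by (intro sin_monotone_2pi_le) auto
    then show ?thesis using *[of 1] assms pi_less_4 by simp
  qed
qed

lemma scaled_sin_ge:
  assumes u: "1/24 \<le> u" "u \<le> pi * real n - 1/24" and n: "n \<ge> 1"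
  shows "1/96 \<le> real n * sin (u / real n)"
proof (cases "u / real n \<le> pi / 2")
  case True
  have "u / real n / 4 \<le> sin (u / real n)" using True u by (intro sin_ge_quarter) auto
  then have "real n * (u / real n / 4) \<le> real n * sin (u / real n)" by (intro mult_left_mono) auto
  then show ?thesis using u n by simp
next
  case False
  have "u / real n \<le> pi" using u n by (simp add: divide_le_eq)
  then have "(pi - u / real n) / 4 \<le> sin (pi - u / real n)" using False by (intro sin_ge_quarter) auto
  then have "real n * ((pi - u / real n) / 4) \<le> real n * sin (u / real n)" by (intro mult_left_mono) auto
  moreover have "real n * ((pi - u / real n) / 4) = (pi * real n - u) / 4" using n by (simp add: field_simps)
  ultimately show ?thesis using u by simp
qed

text \<open>
  The weight collected on an interval of length 1/24 on which the polynomial keeps half of its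
  maximum and the base of the weight is at least 1/96.
\<close>

definition nikolskii_const :: "real \<Rightarrow> real \<Rightarrow> real" where
  "nikolskii_const p a = (1 / 2) powr p * (1 / 96) powr a * (1 / 24)"

lemma nikolskii_const_pos: "nikolskii_const p a > 0" by (simp add: nikolskii_const_def)

text \<open>
  The constant is independent of \<open>n\<close>: in the scaled variable the polynomial keeps half of its maximum
  within distance 1/6 of the point \<open>u0\<close> where the maximum is attained, and a piece of this
  neighbourhood has distance 1/24 from both zeros of the weight.
\<close>

lemma scaled_arc_int_nikolskii:
  fixes q :: "complex poly"
  assumes p: "p \<ge> 0" and a: "a \<ge> 0" and deg: "degree q \<le> n" and n: "n \<ge> 1" and x: "\<bar>x::real\<bar> \<le> 1"
  shows "ennreal (nikolskii_const p a * cmod (poly q (of_real x)) powr p) \<le> scaled_arc_int p a n q"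
proof -
  have "\<exists>x0\<in>{-1..1}. \<forall>x\<in>{-1..1}. cmod (poly q (of_real x)) \<le> cmod (poly q (of_real (x0::real)))"
    by (intro continuous_attains_sup continuous_intros) auto
  then obtain x0 :: real where x0: "\<bar>x0\<bar> \<le> 1"
    and mx: "\<And>x. \<bar>x\<bar> \<le> 1 \<Longrightarrow> cmod (poly q (of_real x)) \<le> cmod (poly q (of_real x0))"
    by (auto simp: abs_le_iff)
  define M where "M = cmod (poly q (of_real x0))"
  define u0 where "u0 = real n * arccos x0"
  have u0: "0 \<le> u0" "u0 \<le> pi * real n" "x0 = cos (u0 / real n)"
    using x0 n arccos_lbound[of x0] arccos_ubound[of x0] by (auto simp: u0_def abs_le_iff mult.commute cos_arccos)
  \<comment> \<open>the piece lies on that side of \<open>u0\<close> that is farther from the ends of the range\<close>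
  define l where "l = (if u0 \<le> pi * real n / 2 then u0 + 1/24 else u0 - 1/12)"
  have pn: "3 \<le> pi * real n" using n pi_gt3 by (smt (verit) mult_le_cancel_left1 of_nat_1 of_nat_mono)
  have I: "1/24 \<le> u" "u \<le> pi * real n - 1/24" "\<bar>u - u0\<bar> \<le> 1/6" if "u \<in> {l..l+1/24}" for u
    using that u0 pn unfolding l_def by (auto split: if_splits)
  have "ennreal (nikolskii_const p a * M powr p) = (\<integral>\<^sup>+u. ennreal ((M / 2) powr p * (1/96) powr a) * indicator {l..l+1/24} u \<partial>lborel)"
    by (subst nn_integral_cmult_indicator)
       (auto simp: nikolskii_const_def M_def powr_divide ennreal_mult'[symmetric] mult_ac)
  also have "\<dots> \<le> scaled_arc_int p a n q"
    unfolding scaled_arc_int_def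
  proof (intro nn_integral_mono)
    fix u :: real
    show "ennreal ((M / 2) powr p * (1/96) powr a) * indicator {l..l+1/24} u
       \<le> ennreal (cmod (poly q (of_real (cos (u / real n)))) powr p * (real n * sin (u / real n)) powr a) * indicator {0..pi * real n} u"
    proof (cases "u \<in> {l..l+1/24}")
      case True
      note I = I[OF True]
      have "M / 2 \<le> cmod (poly q (of_real (cos (u / real n))))"
      proof (rule poly_cos_lower_near_max[OF deg n])
        show "cmod (poly q (of_real x)) \<le> M" if "\<bar>x\<bar> \<le> 1" for x using mx[OF that] by (simp add: M_def)
        show "\<bar>u / real n - u0 / real n\<bar> \<le> 1 / (6 * real n)"
          using I(3) n by (simp add: diff_divide_distrib[symmetric] divide_simps)
        show "cmod (poly q (of_real (cos (u0 / real n)))) = M" by (simp add: M_def u0(3))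
      qed
      moreover have "1/96 \<le> real n * sin (u / real n)" using I n by (intro scaled_sin_ge) auto
      ultimately have "(M / 2) powr p * (1/96) powr a \<le> cmod (poly q (of_real (cos (u / real n)))) powr p * (real n * sin (u / real n)) powr a"
        using p a by (intro mult_mono powr_mono2) (auto simp: M_def)
      then show ?thesis using I True by (auto simp: ennreal_leI)
    qed simp
  qed
  finally have "ennreal (nikolskii_const p a * M powr p) \<le> scaled_arc_int p a n q" .
  moreover have "nikolskii_const p a * cmod (poly q (of_real x)) powr p \<le> nikolskii_const p a * M powr p"
    using mx[OF x] p nikolskii_const_pos[of p a] by (intro mult_left_mono powr_mono2) (auto simp: M_def)
  ultimately show ?thesis by (meson ennreal_leI order_trans)
qed

lemma scaled_integrand_measurable [measurable]:
  "(\<lambda>u. poly q (complex_of_real (cos (u / real n)))) \<in> borel_measurable borel"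
  "(\<lambda>u. (real n * sin (u / real n)) powr a) \<in> borel_measurable borel"
proof -
  show "(\<lambda>u. poly q (complex_of_real (cos (u / real n)))) \<in> borel_measurable borel"
    by (intro borel_measurable_continuous_onI) (cases "n = 0"; auto intro!: continuous_intros)
  have "(\<lambda>u. real n * sin (u / real n)) \<in> borel_measurable borel"
    by (intro borel_measurable_continuous_onI) (cases "n = 0"; auto intro!: continuous_intros)
  then show "(\<lambda>u. (real n * sin (u / real n)) powr a) \<in> borel_measurable borel" by measurable
qed

text \<open>
  The functions \<open>q k (cos (z / N k))\<close> are uniformly bounded on the real line by the preceding inequality,
  hence locally bounded in the plane by the growth bound, and Montel's theorem provides a limit. It
  inherits the growth bound, so it has type 1, and Fatou's lemma bounds its integral.
\<close>

lemma extremal_polynomials_converge: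
  fixes q :: "nat \<Rightarrow> complex poly" and N :: "nat \<Rightarrow> nat"
  assumes p: "p \<ge> 1" and a: "a \<ge> 0" and N1: "\<And>k. N k \<ge> 1" and N: "filterlim N at_top sequentially"
    and deg: "\<And>k. degree (q k) \<le> N k" and one: "\<And>k. poly (q k) 1 = 1"
    and B: "\<And>k. scaled_arc_int p a (N k) (q k) \<le> ennreal B"
    and L: "(\<lambda>k. scaled_arc_int p a (N k) (q k)) \<longlonglongrightarrow> L"
  obtains f where "f \<in> even_exp_type" "f 0 = 1" "half_line_int p a f \<le> L"
proof -
  define M where "M = (\<bar>B\<bar> / nikolskii_const p a) powr (1 / p)"
  have M: "cmod (poly (q k) (of_real x)) \<le> M" if "\<bar>x\<bar> \<le> 1" for k x
  proof -
    have "ennreal (nikolskii_const p a * cmod (poly (q k) (of_real x)) powr p) \<le> ennreal \<bar>B\<bar>"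
    proof -
      have "ennreal (nikolskii_const p a * cmod (poly (q k) (of_real x)) powr p) \<le> scaled_arc_int p a (N k) (q k)"
        using p by (intro scaled_arc_int_nikolskii a deg N1 that) auto
      also have "\<dots> \<le> ennreal B" by (rule B)
      also have "\<dots> \<le> ennreal \<bar>B\<bar>" by (intro ennreal_leI) auto
      finally show ?thesis .
    qed
    then have "nikolskii_const p a * cmod (poly (q k) (of_real x)) powr p \<le> \<bar>B\<bar>" by (simp add: ennreal_le_iff)
    then have "cmod (poly (q k) (of_real x)) powr p \<le> \<bar>B\<bar> / nikolskii_const p a"
      using nikolskii_const_pos[of p a] by (simp add: field_simps)
    then have "(cmod (poly (q k) (of_real x)) powr p) powr (1 / p) \<le> M"
      unfolding M_def using p by (intro powr_mono2) auto
    then show ?thesis using p by (simp add: powr_powr)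
  qed
  define F where "F k z = poly (q k) (cos (z / of_nat (N k)))" for k z
  have Fb: "cmod (F k z) \<le> M * exp \<bar>Im z\<bar>" for k z
  proof -
    have "real (N k) * \<bar>Im (z / of_nat (N k))\<bar> = \<bar>Im z\<bar>"
      using N1[of k] by (simp add: Im_divide_of_nat)
    then show ?thesis
      using poly_cos_growth[OF deg[of k], of M "z / of_nat (N k)"] M unfolding F_def by simp
  qed
  have Fh: "F k holomorphic_on UNIV" for k
    unfolding F_def using N1[of k] by (intro holomorphic_intros) auto
  have M0: "M \<ge> 0" by (simp add: M_def)
  obtain g r where g: "g holomorphic_on UNIV" "strict_mono (r :: nat \<Rightarrow> nat)"
      and lim: "\<And>x. (\<lambda>n. F (r n) x) \<longlonglongrightarrow> g x"
  proof (rule Montel[of UNIV "range F" F])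
    show "\<exists>B. \<forall>h\<in>range F. \<forall>z\<in>K. cmod (h z) \<le> B" if "compact K" for K
    proof -
      from that obtain b where b: "\<And>z. z \<in> K \<Longrightarrow> cmod z \<le> b" by (meson bounded_iff compact_imp_bounded)
      have "cmod (F k z) \<le> M * exp b" if "z \<in> K" for k z
      proof -
        have "M * exp \<bar>Im z\<bar> \<le> M * exp b" using M0 b[OF that] abs_Im_le_cmod[of z] by (intro mult_left_mono) auto
        then show ?thesis using Fb[of k z] by linarith
      qed
      then show ?thesis by blast
    qed
  qed (use Fh in auto)
  have gb: "cmod (g z) \<le> M * exp \<bar>Im z\<bar>" for z
    using lim[of z, THEN tendsto_norm] Fb by (rule tendsto_upperbound[OF _ always_eventually[OF allI]]) simp_all
  have "g \<in> even_exp_type"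
  proof -
    have "g (- z) = g z" for z
    proof -
      have "F k (- z) = F k z" for k by (simp add: F_def)
      then show ?thesis using lim[of z] lim[of "-z"] LIMSEQ_unique by simp
    qed
    moreover have "cmod (g z) \<le> (M + 1) * exp ((1 + e) * cmod z)" if "e > 0" for e z
    proof -
      have "\<bar>Im z\<bar> \<le> (1 + e) * cmod z" using abs_Im_le_cmod[of z] that
        by (smt (verit) mult_le_cancel_right1 norm_ge_zero)
      then have "M * exp \<bar>Im z\<bar> \<le> (M + 1) * exp ((1 + e) * cmod z)" using M0 by (intro mult_mono) auto
      with gb[of z] show ?thesis by linarith
    qed
    moreover have "M + 1 > 0" using M0 by simp
    ultimately show ?thesis unfolding even_exp_type_def using g(1) by blast
  qed
  moreover have "g 0 = 1"
  proof -
    have "F k 0 = 1" for k by (simp add: F_def one)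
    then show ?thesis using lim[of 0] LIMSEQ_unique[OF _ tendsto_const] by simp
  qed
  moreover have "half_line_int p a g \<le> L"
  proof -
    define G where "G k u = ennreal (cmod (poly (q k) (of_real (cos (u / real (N k))))) powr p *
      (real (N k) * sin (u / real (N k))) powr a) * indicator {0..pi * real (N k)} u" for k u
    have Gm: "G k \<in> borel_measurable lborel" for k
      unfolding G_def by measurable
    have Nr: "filterlim (\<lambda>k. N (r k)) at_top sequentially"
      using filterlim_compose[OF N filterlim_subseq[OF g(2)]] .
    then have Nr': "filterlim (\<lambda>k. real (N (r k))) at_top sequentially"
      by (rule filterlim_compose[OF filterlim_real_sequentially])
    have pt: "(\<lambda>k. G (r k) u) \<longlonglongrightarrow> ennreal (cmod (g (of_real u)) powr p * u powr a)" if u: "u > 0" for u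
    proof -
      have "((\<lambda>x. x * sin (u / x)) \<longlongrightarrow> u) at_top" using u by real_asymp
      then have "(\<lambda>k. real (N (r k)) * sin (u / real (N (r k)))) \<longlonglongrightarrow> u"
        by (rule filterlim_compose[OF _ Nr'])
      then have 1: "(\<lambda>k. (real (N (r k)) * sin (u / real (N (r k)))) powr a) \<longlonglongrightarrow> u powr a"
        using u by (intro tendsto_powr tendsto_const) auto
      have "F (r k) (of_real u) = poly (q (r k)) (of_real (cos (u / real (N (r k)))))" for k
        by (simp add: F_def cos_of_real[symmetric])
      then have "(\<lambda>k. cmod (poly (q (r k)) (of_real (cos (u / real (N (r k)))))) powr p) \<longlonglongrightarrow> cmod (g (of_real u)) powr p"
        using lim[of "of_real u", THEN tendsto_norm] p by (intro tendsto_powr' tendsto_const) auto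
      from tendsto_mult[OF this 1]
      have "(\<lambda>k. ennreal (cmod (poly (q (r k)) (of_real (cos (u / real (N (r k)))))) powr p *
          (real (N (r k)) * sin (u / real (N (r k)))) powr a)) \<longlonglongrightarrow> ennreal (cmod (g (of_real u)) powr p * u powr a)"
        by (rule tendsto_ennrealI)
      moreover have "\<forall>\<^sub>F k in sequentially. G (r k) u = ennreal (cmod (poly (q (r k)) (of_real (cos (u / real (N (r k)))))) powr p *
          (real (N (r k)) * sin (u / real (N (r k)))) powr a)"
        using filterlim_at_top[THEN iffD1, rule_format, OF Nr', of "u / pi"]
      proof eventually_elim
        case (elim k)
        then have "u \<le> pi * real (N (r k))" by (simp add: divide_le_eq mult.commute)
        then show ?case using u by (simp add: G_def)
      qed
      ultimately show ?thesis by (simp add: tendsto_cong)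
    qed
    have "half_line_int p a g \<le> (\<integral>\<^sup>+u. liminf (\<lambda>k. G (r k) u) \<partial>lborel)"
      unfolding half_line_int_def
    proof (rule nn_integral_mono)
      fix u :: real
      consider "u < 0" | "u = 0" | "u > 0" by linarith
      then show "ennreal (cmod (g (of_real u)) powr p * u powr a) * indicator {0..} u \<le> liminf (\<lambda>k. G (r k) u)"
      proof cases
        case 3
        then show ?thesis using lim_imp_Liminf[OF _ pt[OF 3]] by simp
      qed auto
    qed
    also have "\<dots> \<le> liminf (\<lambda>k. integral\<^sup>N lborel (G (r k)))"
      by (rule nn_integral_liminf) (rule Gm)
    also have "\<dots> = L"
    proof -
      have "(\<lambda>k. scaled_arc_int p a (N (r k)) (q (r k))) \<longlonglongrightarrow> L"
        using LIMSEQ_subseq_LIMSEQ[OF L g(2)] by (simp add: o_def)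
      then show ?thesis unfolding scaled_arc_int_def G_def by (intro lim_imp_Liminf) auto
    qed
    finally show ?thesis .
  qed
  ultimately show ?thesis using that by blast
qed

section \<open>Even functions of exponential type\<close>

lemma half_line_int_measurable:
  assumes "f holomorphic_on UNIV"
  shows "(\<lambda>u. ennreal (cmod (f (of_real u)) powr p * u powr a) * indicator {0..} u) \<in> borel_measurable lborel"
proof -
  have "continuous_on UNIV (\<lambda>u::real. f (of_real u))"
    by (intro continuous_on_compose2[OF holomorphic_on_imp_continuous_on[OF assms]] continuous_intros) auto
  then have [measurable]: "(\<lambda>u::real. f (of_real u)) \<in> borel_measurable borel"
    by (rule borel_measurable_continuous_onI)
  show ?thesis by measurable
qed

text \<open>
  An integrable power does not bound \<open>f\<close> pointwise in an elementary way, but it bounds a primitive: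
  \<open>|f|\<close> is at most \<open>1 + |f|^p u^a\<close> for \<open>u \<ge> 1\<close>, and this integrates to linear growth.
\<close>

lemma even_exp_type_real_primitive_bound:
  assumes f: "f holomorphic_on UNIV" and F: "\<And>z. (F has_field_derivative f z) (at z)"
    and p: "p \<ge> 1" and a: "a \<ge> 0" and fin: "half_line_int p a f < \<infinity>"
  shows "\<exists>C>0. \<forall>x\<ge>0. cmod (F (of_real x) - F 0) \<le> C * (1 + x)"
proof -
  define h where "h u = cmod (f (of_real u)) powr p * u powr a * indicator {0..} u" for u :: real
  have cont: "continuous_on UNIV (\<lambda>u::real. f (of_real u))"
    by (intro continuous_on_compose2[OF holomorphic_on_imp_continuous_on[OF f]] continuous_intros) auto
  then have [measurable]: "(\<lambda>u::real. f (of_real u)) \<in> borel_measurable borel"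
    by (rule borel_measurable_continuous_onI)
  have h0: "h u \<ge> 0" for u by (simp add: h_def)
  have "(\<integral>\<^sup>+u. ennreal (norm (h u)) \<partial>lborel) = half_line_int p a f"
    unfolding half_line_int_def by (intro nn_integral_cong) (auto simp: h_def split: split_indicator)
  then have hint: "integrable lborel h" using fin unfolding h_def by (intro integrableI_bounded) auto
  then have hHK: "h integrable_on UNIV" by (rule integrable_on_lborel)
  have hHK': "h integrable_on {0..x}" for x
    using hHK h0 by (intro integrable_on_subinterval[of h UNIV]) auto
  obtain K where K: "\<And>u. u \<in> {0..1} \<Longrightarrow> cmod (f (of_real u)) \<le> K"
    using continuous_on_compact_bound[OF continuous_on_subset[OF cont, of "{0..1}"]] by auto
  have pt: "cmod (f (of_real u)) \<le> (\<bar>K\<bar> + 1) + h u" if u: "u \<ge> 0" for u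
  proof (cases "u \<le> 1")
    case True
    then show ?thesis using K[of u] u h0[of u] by auto
  next
    case False
    then have "1 \<le> u powr a" using a by (simp add: ge_one_powr_ge_zero)
    have "cmod (f (of_real u)) \<le> 1 + cmod (f (of_real u)) powr p"
    proof (cases "cmod (f (of_real u)) \<le> 1")
      case True
      then show ?thesis by (simp add: add_increasing2)
    next
      case False
      then have "cmod (f (of_real u)) powr 1 \<le> cmod (f (of_real u)) powr p" using p by (intro powr_mono) auto
      then show ?thesis using False by simp
    qed
    moreover have "cmod (f (of_real u)) powr p * 1 \<le> cmod (f (of_real u)) powr p * u powr a"
      using \<open>1 \<le> u powr a\<close> by (intro mult_left_mono) auto
    ultimately show ?thesis using u by (simp add: h_def)
  qed
  define H where "H = integral UNIV h"
  have H0: "H \<ge> 0" unfolding H_def by (intro integral_nonneg hHK) (use h0 in auto)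
  have main: "cmod (F (of_real x) - F 0) \<le> (\<bar>K\<bar> + 1) * x + H" if x: "x \<ge> 0" for x
  proof -
    have "((\<lambda>u. f (of_real u)) has_integral (F (of_real x) - F (of_real 0))) {0..x}"
    proof (rule fundamental_theorem_of_calculus[OF x])
      fix u :: real
      show "((\<lambda>u. F (of_real u)) has_vector_derivative f (of_real u)) (at u within {0..x})"
        by (rule has_vector_derivative_real_field[OF F])
    qed
    then have i: "integral {0..x} (\<lambda>u. f (of_real u)) = F (of_real x) - F 0" "(\<lambda>u. f (of_real u)) integrable_on {0..x}"
      by (auto simp: integral_unique)
    have "cmod (integral {0..x} (\<lambda>u. f (of_real u))) \<le> integral {0..x} (\<lambda>u. (\<bar>K\<bar> + 1) + h u)"
      using pt hHK' by (intro Henstock_Kurzweil_Integration.integral_norm_bound_integral i integrable_add) auto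
    also have "\<dots> = (\<bar>K\<bar> + 1) * x + integral {0..x} h"
      using hHK' x by (subst integral_add) (auto simp: mult.commute)
    also have "integral {0..x} h \<le> H" unfolding H_def
      using hHK hHK' h0 by (intro integral_subset_le) auto
    finally show ?thesis using i by simp
  qed
  have "cmod (F (of_real x) - F 0) \<le> (\<bar>K\<bar> + 1 + H) * (1 + x)" if "x \<ge> 0" for x
  proof -
    have "0 \<le> H * x" using H0 that by simp
    then show ?thesis using main[OF that] by (simp add: algebra_simps)
  qed
  then show ?thesis using H0 by (intro exI[of _ "\<bar>K\<bar> + 1 + H"]) auto
qed

text \<open>
  The Phragmen-Lindelof bound applies to the primitive \<open>F\<close> that vanishes at 0, which is odd because \<open>f\<close>
  is even. Cauchy's estimate on circles of radius 1 transfers it to \<open>f = F'\<close>.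
\<close>

lemma even_exp_type_growth:
  assumes f: "f \<in> even_exp_type" and p: "p \<ge> 1" and a: "a \<ge> 0" and fin: "half_line_int p a f < \<infinity>"
    and \<sigma>: "\<sigma> > 1"
  shows "\<exists>C>0. \<forall>z. cmod (f z) \<le> C * (1 + cmod z) * exp (\<sigma> * \<bar>Im z\<bar>)"
proof -
  have fh: "f holomorphic_on UNIV" and ev: "\<And>z. f (- z) = f z" using f by (auto simp: even_exp_type_def)
  obtain F0 where F0: "\<And>z. (F0 has_field_derivative f z) (at z)"
    using holomorphic_convex_primitive'[OF convex_UNIV open_UNIV fh] by (auto simp: has_field_derivative_at_within)
  define F where "F z = F0 z - F0 0" for z
  have F: "(F has_field_derivative f z) (at z)" for z
    unfolding F_def by (auto intro!: derivative_eq_intros F0)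
  have Fz: "F 0 = 0" by (simp add: F_def)
  have Fh: "F holomorphic_on UNIV" using F by (auto simp: holomorphic_on_def field_differentiable_def)
  have odd: "F (- z) = - F z" for z
  proof -
    have "((\<lambda>z. F z + F (- z)) has_field_derivative 0) (at z)" for z
      using DERIV_chain'[OF DERIV_minus[OF DERIV_ident] F[of "- z"], of UNIV] F[of z]
      by (auto intro!: derivative_eq_intros DERIV_chain2[of F] F simp: ev)
    then obtain c where "\<And>z. F z + F (- z) = c"
      using has_field_derivative_zero_constant[OF convex_UNIV, of "\<lambda>z. F z + F (- z)"] by auto
    from this[of 0] this[of z] show ?thesis by (simp add: Fz add_eq_0_iff)
  qed
  obtain C1 where C1: "C1 > 0" "\<And>x::real. x \<ge> 0 \<Longrightarrow> cmod (F (of_real x)) \<le> C1 * (1 + x)"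
    using even_exp_type_real_primitive_bound[OF fh F p a fin] by (auto simp: Fz)
  have C1': "cmod (F (of_real x)) \<le> C1 * (1 + \<bar>x\<bar>)" for x :: real
    using C1(2)[of x] C1(2)[of "- x"] odd[of "of_real x"] by (cases "x \<ge> 0") auto
  define e where "e = (\<sigma> - 1) / 2"
  have e: "e > 0" "1 + e + e = \<sigma>" using \<sigma> by (auto simp: e_def field_simps)
  obtain C2 where C2: "C2 > 0" "\<And>z. cmod (f z) \<le> C2 * exp ((1 + e) * cmod z)"
    using f e(1) unfolding even_exp_type_def by blast
  have g: "cmod (F z) \<le> C2 / e * exp (\<sigma> * cmod z)" for z
  proof -
    have "cmod (F z - F 0) \<le> C2 * exp ((1 + e) * cmod z) * cmod (z - 0)"
    proof (rule field_differentiable_bound[of "cball 0 (cmod z)"])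
      show "cmod (f w) \<le> C2 * exp ((1 + e) * cmod z)" if "w \<in> cball 0 (cmod z)" for w
      proof -
        have "C2 * exp ((1 + e) * cmod w) \<le> C2 * exp ((1 + e) * cmod z)"
          using that C2 e by (intro mult_left_mono) auto
        then show ?thesis using C2(2)[of w] by linarith
      qed
    qed (auto intro: has_field_derivative_at_within F)
    also have "cmod (z - 0) \<le> exp (e * cmod z) / e"
    proof -
      have "e * cmod z \<le> exp (e * cmod z)" using exp_ge_add_one_self[of "e * cmod z"] by linarith
      then show ?thesis using e(1) by (simp add: field_simps)
    qed
    then have "C2 * exp ((1 + e) * cmod z) * cmod (z - 0) \<le> C2 * exp ((1 + e) * cmod z) * (exp (e * cmod z) / e)"
      using C2 by (intro mult_left_mono) auto
    also have "\<dots> = C2 / e * exp (\<sigma> * cmod z)"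
      by (simp add: exp_add[symmetric] e(2)[symmetric] algebra_simps)
    finally show ?thesis by (simp add: Fz)
  qed
  define C where "C = max C1 (C2 / e)"
  have C0: "C > 0" using C1 by (simp add: C_def)
  have FC: "cmod (F z) \<le> C * (1 + cmod z) * exp (\<sigma> * \<bar>Im z\<bar>)" for z
  proof (rule exp_type_linear_growth[OF Fh _ _ C0])
    show "cmod (F z) \<le> C * exp (\<sigma> * cmod z)" for z
      using g[of z] by (smt (verit) C_def exp_ge_zero mult_right_mono)
    show "cmod (F (of_real x)) \<le> C * (1 + \<bar>x\<bar>)" for x :: real
      using C1'[of x] by (smt (verit) C_def abs_ge_zero mult_right_mono)
  qed (use \<sigma> in auto)
  have "cmod (f z) \<le> (2 * C * exp \<sigma>) * (1 + cmod z) * exp (\<sigma> * \<bar>Im z\<bar>)" for z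
  proof -
    have "cmod ((deriv ^^ 1) F z) \<le> fact 1 * ((2 * C * exp \<sigma>) * (1 + cmod z) * exp (\<sigma> * \<bar>Im z\<bar>)) / 1 ^ 1"
    proof (rule Cauchy_inequality)
      show "cmod (F w) \<le> (2 * C * exp \<sigma>) * (1 + cmod z) * exp (\<sigma> * \<bar>Im z\<bar>)" if "cmod (z - w) = 1" for w
      proof -
        have "cmod w \<le> cmod z + 1" using that by (smt (verit) norm_minus_commute norm_triangle_sub)
        moreover have "\<sigma> * \<bar>Im w\<bar> \<le> \<sigma> * (\<bar>Im z\<bar> + 1)" using \<sigma> that abs_Im_le_cmod[of "z - w"] by (intro mult_left_mono) auto
        moreover have "\<bar>Im w\<bar> \<le> \<bar>Im z\<bar> + 1" using that abs_Im_le_cmod[of "z - w"] by simp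
        moreover have "1 + cmod w \<le> 2 * (1 + cmod z)" 
        proof -
          have "cmod w \<le> cmod z + 1" using that norm_triangle_sub[of w z] by (simp add: norm_minus_commute)
          then show ?thesis using norm_ge_zero[of z] unfolding distrib_left by linarith
        qed
        ultimately have "C * (1 + cmod w) * exp (\<sigma> * \<bar>Im w\<bar>) \<le> C * (2 * (1 + cmod z)) * exp (\<sigma> * (\<bar>Im z\<bar> + 1))"
          using C0 \<sigma> by (intro mult_mono) auto
        also have "\<dots> = (2 * C * exp \<sigma>) * (1 + cmod z) * exp (\<sigma> * \<bar>Im z\<bar>)"
          by (simp add: exp_add algebra_simps)
        finally show ?thesis using FC[of w] by linarith
      qed
    qed (use Fh in \<open>auto intro: holomorphic_on_imp_continuous_on holomorphic_on_subset\<close>)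
    moreover have "deriv F z = f z" using F by (rule DERIV_imp_deriv)
    ultimately show ?thesis by simp
  qed
  then show ?thesis using C0 by (intro exI[of _ "2 * C * exp \<sigma>"]) auto
qed

lemma entire_compose:
  fixes f g :: "complex \<Rightarrow> complex"
  assumes "f holomorphic_on UNIV" "g holomorphic_on A"
  shows "(\<lambda>z. f (g z)) holomorphic_on A"
  using holomorphic_on_compose_gen[OF assms(2,1)] by (simp add: o_def)

definition csinc :: "complex \<Rightarrow> complex" where
  "csinc z = (if z = 0 then 1 else sin z / z)"

lemma csinc_holomorphic: "csinc holomorphic_on UNIV"
proof -
  have "deriv sin (0::complex) = 1" by (rule DERIV_imp_deriv) (auto intro!: derivative_eq_intros)
  then have "csinc = (\<lambda>z. if z = 0 then deriv sin 0 else (sin z - sin 0) / (z - 0))"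
    by (auto simp: csinc_def fun_eq_iff)
  moreover have "(\<lambda>z::complex. if z = 0 then deriv sin 0 else (sin z - sin 0) / (z - 0)) holomorphic_on UNIV"
    by (intro pole_lemma holomorphic_intros) auto
  ultimately show ?thesis by simp
qed

lemma csinc_decay: "\<exists>B>0. \<forall>z. cmod (csinc z) * (1 + cmod z) \<le> B * exp \<bar>Im z\<bar>"
proof -
  obtain b where b: "\<And>z. z \<in> cball 0 1 \<Longrightarrow> cmod (csinc z) \<le> b"
    by (rule continuous_on_compact_bound[of "cball 0 1" csinc])
      (auto intro: holomorphic_on_imp_continuous_on holomorphic_on_subset[OF csinc_holomorphic])
  have "cmod (csinc z) * (1 + cmod z) \<le> (2 * \<bar>b\<bar> + 2) * exp \<bar>Im z\<bar>" for z
  proof (cases "cmod z \<le> 1")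
    case True
    then have "cmod (csinc z) \<le> \<bar>b\<bar>" using b[of z] by force
    then have "cmod (csinc z) * (1 + cmod z) \<le> \<bar>b\<bar> * 2" using True by (intro mult_mono) auto
    also have "\<dots> \<le> (2 * \<bar>b\<bar> + 2) * 1" by simp
    also have "\<dots> \<le> (2 * \<bar>b\<bar> + 2) * exp \<bar>Im z\<bar>" by (intro mult_left_mono) auto
    finally show ?thesis .
  next
    case False
    then have "z \<noteq> 0" by auto
    have "cmod (csinc z) * (1 + cmod z) \<le> cmod (csinc z) * (2 * cmod z)" using False by (intro mult_left_mono) auto
    also have "\<dots> = 2 * cmod (sin z)" using \<open>z \<noteq> 0\<close> by (simp add: csinc_def norm_divide)
    also have "\<dots> \<le> 2 * exp \<bar>Im z\<bar>" using cmod_sin_le_exp[of 1 z] by simp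
    also have "\<dots> \<le> (2 * \<bar>b\<bar> + 2) * exp \<bar>Im z\<bar>" by (intro mult_right_mono) auto
    finally show ?thesis .
  qed
  then show ?thesis by (intro exI[of _ "2 * \<bar>b\<bar> + 2"]) auto
qed

lemma csinc_real_le_1: "cmod (csinc (of_real x)) \<le> 1"
proof (cases "x = 0")
  case False
  then have "csinc (of_real x) = of_real (sin x / x)" by (simp add: csinc_def sin_of_real)
  then have "cmod (csinc (of_real x)) = \<bar>sin x\<bar> / \<bar>x\<bar>" by (simp del: of_real_divide)
  then show ?thesis using abs_sin_x_le_abs_x[of x] False by simp
qed (simp add: csinc_def)

lemma csinc_even: "csinc (- z) = csinc z" by (simp add: csinc_def)

text \<open>
  Decay of any order \<open>k\<close> costs only the type \<open>k * \<delta>\<close>, which is as small as desired.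
\<close>

lemma csinc_power_decay:
  assumes "\<delta> > 0"
  shows "\<exists>B>0. \<forall>z. cmod (csinc (of_real \<delta> * z) ^ k) * (1 + cmod z) ^ k \<le> B * exp (real k * \<delta> * \<bar>Im z\<bar>)"
proof -
  obtain B where B: "B > 0" "\<And>z. cmod (csinc z) * (1 + cmod z) \<le> B * exp \<bar>Im z\<bar>" using csinc_decay by blast
  \<comment> \<open>\<open>D\<close> compares \<open>1 + |z|\<close> with \<open>1 + |\<delta> z|\<close>\<close>
  define D where "D = max 1 (1 / \<delta>)"
  have D: "D \<ge> 1" "1 \<le> D * \<delta>" using assms by (auto simp: D_def max_def field_simps)
  have "cmod (csinc (of_real \<delta> * z) ^ k) * (1 + cmod z) ^ k \<le> (D * B) ^ k * exp (real k * \<delta> * \<bar>Im z\<bar>)" for z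
  proof -
    have "1 * cmod z \<le> D * \<delta> * cmod z" using D by (intro mult_right_mono) auto
    then have "1 + cmod z \<le> D * (1 + cmod (of_real \<delta> * z))" using D assms by (simp add: norm_mult algebra_simps)
    then have "cmod (csinc (of_real \<delta> * z)) * (1 + cmod z) \<le> cmod (csinc (of_real \<delta> * z)) * (D * (1 + cmod (of_real \<delta> * z)))"
      by (intro mult_left_mono) auto
    also have "\<dots> = D * (cmod (csinc (of_real \<delta> * z)) * (1 + cmod (of_real \<delta> * z)))" by simp
    also have "\<dots> \<le> D * (B * exp \<bar>Im (of_real \<delta> * z)\<bar>)" using B(2)[of "of_real \<delta> * z"] D by (intro mult_left_mono) auto
    also have "\<dots> = D * B * exp (\<delta> * \<bar>Im z\<bar>)" using assms by (simp add: abs_mult)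
    finally have "(cmod (csinc (of_real \<delta> * z)) * (1 + cmod z)) ^ k \<le> (D * B * exp (\<delta> * \<bar>Im z\<bar>)) ^ k"
      by (intro power_mono) auto
    then show ?thesis by (simp add: power_mult_distrib norm_power exp_of_nat_mult mult.assoc)
  qed
  then show ?thesis using B D by (intro exI[of _ "(D * B) ^ k"]) auto
qed

lemma one_plus_powr_neg2_integral: "(\<integral>\<^sup>+u. ennreal ((1 + u) powr (-2)) * indicator {0..} u \<partial>lborel) = 1"
proof -
  have "(\<integral>\<^sup>+u. ennreal ((1 + u) powr (-2)) * indicator {0..} u \<partial>lborel) = ennreal (0 - (- (1 / (1 + 0))))"
  proof (rule nn_integral_FTC_atLeast)
    show "DERIV (\<lambda>u. - (1 / (1 + u))) u :> (1 + u) powr (-2)" if "0 \<le> u" for u :: real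
      using that by (auto intro!: derivative_eq_intros simp: powr_minus powr_numeral field_simps power2_eq_square)
    show "((\<lambda>u::real. - (1 / (1 + u))) \<longlongrightarrow> 0) at_top" by real_asymp
  qed auto
  then show ?thesis by simp
qed

text \<open>
  A common majorant for functions with polynomial decay. The variable \<open>w\<close> stands for \<open>u\<close> or for
  \<open>n sin (u / n)\<close>.
\<close>

lemma decay_integrand_bound:
  fixes u :: real
  assumes p: "p \<ge> 1" and a: "a \<ge> 0" and j: "real j \<ge> a + 2" and u: "u \<ge> 0"
    and x: "0 \<le> x" "x * (1 + u) ^ j \<le> E" and w: "0 \<le> w" "w \<le> u"
  shows "x powr p * w powr a \<le> E powr p * (1 + u) powr (-2)"
proof -
  have "x \<le> E * (1 + u) powr (- real j)"
    using x u by (simp add: powr_minus powr_realpow field_simps)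
  then have "x powr p \<le> (E * (1 + u) powr (- real j)) powr p" using x p by (intro powr_mono2) auto
  also have "\<dots> = E powr p * (1 + u) powr (- real j * p)"
  proof -
    have "0 \<le> x * (1 + u) ^ j" using x u by simp
    then have "E \<ge> 0" using x by linarith
    then show ?thesis by (simp add: powr_mult powr_powr)
  qed
  also have "(1 + u) powr (- real j * p) \<le> (1 + u) powr (- real j * 1)"
    using u p by (intro powr_mono) (use mult_left_mono[of 1 p "real j"] in auto)
  finally have 1: "x powr p \<le> E powr p * (1 + u) powr (- real j)" by (simp add: mult_left_mono)
  have 2: "w powr a \<le> (1 + u) powr a" using w a by (intro powr_mono2) auto
  have "x powr p * w powr a \<le> (E powr p * (1 + u) powr (- real j)) * (1 + u) powr a"
    using 1 2 by (intro mult_mono) auto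
  also have "\<dots> = E powr p * (1 + u) powr (a - real j)"
    by (simp add: powr_add[symmetric] mult.assoc)
  also have "\<dots> \<le> E powr p * (1 + u) powr (-2)"
    using j u by (intro mult_left_mono powr_mono) auto
  finally show ?thesis .
qed

lemma half_line_int_finite:
  assumes p: "p \<ge> 1" and a: "a \<ge> 0" and j: "real j \<ge> a + 2"
    and E: "\<And>u. u \<ge> 0 \<Longrightarrow> cmod (f (of_real u)) * (1 + u) ^ j \<le> E"
  shows "half_line_int p a f < \<infinity>"
proof -
  have "half_line_int p a f \<le> (\<integral>\<^sup>+u. ennreal (E powr p) * (ennreal ((1 + u) powr (-2)) * indicator {0..} u) \<partial>lborel)"
    unfolding half_line_int_def
  proof (rule nn_integral_mono)
    fix u :: real
    show "ennreal (cmod (f (of_real u)) powr p * u powr a) * indicator {0..} u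
       \<le> ennreal (E powr p) * (ennreal ((1 + u) powr (-2)) * indicator {0..} u)"
      using decay_integrand_bound[OF p a j, of u "cmod (f (of_real u))" E u] E[of u]
      by (auto simp: ennreal_mult'[symmetric] split: split_indicator intro!: ennreal_leI)
  qed
  also have "\<dots> = ennreal (E powr p)"
    by (subst nn_integral_cmult) (auto simp: one_plus_powr_neg2_integral)
  finally show ?thesis by (rule le_less_trans) simp
qed

text \<open>
  A power of the function \<open>sin z / z\<close>, dilated so that the type is 1.
\<close>

lemma even_exp_type_nontrivial:
  assumes p: "p \<ge> 1" and a: "a \<ge> 0"
  obtains f where "f \<in> even_exp_type" "f 0 = 1" "half_line_int p a f < \<infinity>"
proof -
  define j where "j = nat \<lceil>a\<rceil> + 2"
  have j: "real j \<ge> a + 2" "j > 0" using a by (auto simp: j_def)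
  define f where "f z = csinc (of_real (1 / real j) * z) ^ j" for z
  obtain B where B: "B > 0" "\<And>z. cmod (f z) * (1 + cmod z) ^ j \<le> B * exp (real j * (1 / real j) * \<bar>Im z\<bar>)"
    using csinc_power_decay[of "1 / real j" j] j unfolding f_def by auto
  have "f \<in> even_exp_type"
  proof -
    have "f holomorphic_on UNIV" unfolding f_def
      by (intro holomorphic_intros entire_compose[OF csinc_holomorphic])
    moreover have "f (- z) = f z" for z using csinc_even[of "of_real (1 / real j) * z"] by (simp add: f_def)
    moreover have "cmod (f z) \<le> B * exp ((1 + e) * cmod z)" if "e > 0" for e z
    proof -
      have "cmod (f z) * 1 \<le> cmod (f z) * (1 + cmod z) ^ j" by (intro mult_left_mono) auto
      also have "\<dots> \<le> B * exp \<bar>Im z\<bar>" using B(2)[of z] j by simp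
      also have "\<dots> \<le> B * exp ((1 + e) * cmod z)"
      proof -
        have "\<bar>Im z\<bar> \<le> cmod z" by (rule abs_Im_le_cmod)
        also have "\<dots> \<le> (1 + e) * cmod z" using that by (simp add: distrib_right)
        finally show ?thesis using B by (intro mult_left_mono) auto
      qed
      finally show ?thesis by simp
    qed
    ultimately show ?thesis unfolding even_exp_type_def using B(1) by blast
  qed
  moreover have "f 0 = 1" by (simp add: f_def csinc_def)
  moreover have "half_line_int p a f < \<infinity>"
  proof (rule half_line_int_finite[OF p a j(1)])
    show "cmod (f (of_real u)) * (1 + u) ^ j \<le> B" if "u \<ge> 0" for u
      using B(2)[of "of_real u"] that by simp
  qed
  ultimately show ?thesis using that by blast
qed

lemma half_line_int_dilate:
  assumes h: "f holomorphic_on UNIV" and \<rho>: "\<rho> > 0"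
  shows "half_line_int p a (\<lambda>z. f (of_real \<rho> * z)) = ennreal (\<rho> powr (- (a + 1))) * half_line_int p a f"
proof -
  have m: "(\<lambda>u. ennreal (cmod (f (of_real u)) powr p * u powr a) * indicator {0..} u) \<in> borel_measurable borel"
    using half_line_int_measurable[OF h] by simp
  have "half_line_int p a f = \<bar>\<rho>\<bar> * (\<integral>\<^sup>+u. ennreal (cmod (f (of_real (0 + \<rho> * u))) powr p * (0 + \<rho> * u) powr a) * indicator {0..} (0 + \<rho> * u) \<partial>lborel)"
    unfolding half_line_int_def by (rule nn_integral_real_affine[OF m, of \<rho> 0]) (use \<rho> in simp)
  also have "(\<integral>\<^sup>+u. ennreal (cmod (f (of_real (0 + \<rho> * u))) powr p * (0 + \<rho> * u) powr a) * indicator {0..} (0 + \<rho> * u) \<partial>lborel)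
     = (\<integral>\<^sup>+u. ennreal (\<rho> powr a) * (ennreal (cmod (f (of_real \<rho> * of_real u)) powr p * u powr a) * indicator {0..} u) \<partial>lborel)"
    using \<rho> by (intro nn_integral_cong)
      (auto simp: zero_le_mult_iff powr_mult ennreal_mult'[symmetric] mult_ac split: split_indicator)
  also have "\<dots> = ennreal (\<rho> powr a) * half_line_int p a (\<lambda>z. f (of_real \<rho> * z))"
  proof -
    have "(\<lambda>z. f (of_real \<rho> * z)) holomorphic_on UNIV"
      by (intro entire_compose[OF h] holomorphic_intros)
    from half_line_int_measurable[OF this] show ?thesis unfolding half_line_int_def by (intro nn_integral_cmult) auto
  qed
  finally have "half_line_int p a f = ennreal (\<rho> powr (a + 1)) * half_line_int p a (\<lambda>z. f (of_real \<rho> * z))"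
    using \<rho> by (simp add: mult.assoc[symmetric] ennreal_mult'[symmetric] powr_add mult_ac)
  then have "ennreal (\<rho> powr (- (a + 1))) * half_line_int p a f =
     ennreal (\<rho> powr (- (a + 1)) * \<rho> powr (a + 1)) * half_line_int p a (\<lambda>z. f (of_real \<rho> * z))"
    by (simp add: mult.assoc[symmetric] ennreal_mult'[symmetric])
  also have "\<rho> powr (- (a + 1)) * \<rho> powr (a + 1) = 1" using \<rho> by (simp flip: powr_add)
  finally show ?thesis by simp
qed

text \<open>
  A dilation by \<open>\<rho> < 1\<close> lowers the type and leaves room for a damping factor, which is at most 1 on
  the real line and so does not increase the integral. The growth assumption for \<open>\<sigma>\<close> slightly above 1
  is used with \<open>\<rho> * \<sigma> = (1 + \<rho>) / 2\<close>, and the damping factor has the remaining type \<open>(1 - \<rho>) / 2\<close>.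
\<close>

lemma damped_competitor:
  assumes f: "f \<in> even_exp_type" "f 0 = 1"
    and growth: "\<And>\<sigma>. \<sigma> > 1 \<Longrightarrow> \<exists>C>0. \<forall>z. cmod (f z) \<le> C * (1 + cmod z) * exp (\<sigma> * \<bar>Im z\<bar>)"
    and \<rho>: "0 < \<rho>" "\<rho> < 1" and p: "p \<ge> 1"
  obtains g B where "g holomorphic_on UNIV" "\<And>z. g (- z) = g z" "g 0 = 1" "B > 0"
    "\<And>z. cmod (g z) * (1 + cmod z) ^ j \<le> B * exp \<bar>Im z\<bar>"
    "half_line_int p a g \<le> ennreal (\<rho> powr (- (a + 1))) * half_line_int p a f"
proof -
  define \<sigma> where "\<sigma> = (1 + 1 / \<rho>) / 2"
  have \<sigma>: "\<sigma> > 1" "\<rho> * \<sigma> = (1 + \<rho>) / 2" using \<rho> by (auto simp: \<sigma>_def field_simps)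
  \<comment> \<open>type of \<open>Suc j\<close> damping factors: one more than \<open>j\<close>, for the linear growth of \<open>f\<close>\<close>
  define \<delta> where "\<delta> = (1 - \<rho>) / (2 * real (Suc j))"
  have \<delta>: "\<delta> > 0" "real (Suc j) * \<delta> = (1 - \<rho>) / 2" using \<rho> by (auto simp: \<delta>_def divide_simps)
  obtain C where C: "C > 0" "\<And>z. cmod (f z) \<le> C * (1 + cmod z) * exp (\<sigma> * \<bar>Im z\<bar>)" using growth[OF \<sigma>(1)] by blast
  obtain B where B: "B > 0" "\<And>z. cmod (csinc (of_real \<delta> * z) ^ Suc j) * (1 + cmod z) ^ Suc j \<le> B * exp (real (Suc j) * \<delta> * \<bar>Im z\<bar>)"
    using csinc_power_decay[OF \<delta>(1), of "Suc j"] by blast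
  define g where "g z = f (of_real \<rho> * z) * csinc (of_real \<delta> * z) ^ Suc j" for z
  have fh: "f holomorphic_on UNIV" and ev: "\<And>z. f (- z) = f z" using f by (auto simp: even_exp_type_def)
  have gh: "g holomorphic_on UNIV" unfolding g_def
    by (intro holomorphic_intros entire_compose[OF csinc_holomorphic] entire_compose[OF fh])
  moreover have "g (- z) = g z" for z
    using ev[of "of_real \<rho> * z"] csinc_even[of "of_real \<delta> * z"] by (simp add: g_def)
  moreover have "g 0 = 1" using f by (simp add: g_def csinc_def)
  moreover have "cmod (g z) * (1 + cmod z) ^ j \<le> (C * B) * exp \<bar>Im z\<bar>" for z
  proof -
    have "cmod (f (of_real \<rho> * z)) \<le> C * (1 + cmod (of_real \<rho> * z)) * exp (\<sigma> * \<bar>Im (of_real \<rho> * z)\<bar>)" by (rule C)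
    also have "\<dots> \<le> C * (1 + cmod z) * exp ((1 + \<rho>) / 2 * \<bar>Im z\<bar>)"
    proof -
      have "\<sigma> * \<bar>Im (of_real \<rho> * z)\<bar> = (1 + \<rho>) / 2 * \<bar>Im z\<bar>"
        using \<rho> by (simp add: abs_mult \<sigma>(2)[symmetric] mult_ac)
      moreover have "cmod (of_real \<rho> * z) \<le> cmod z" using \<rho> by (simp add: norm_mult mult_left_le_one_le)
      ultimately show ?thesis using C by (intro mult_mono mult_left_mono) auto
    qed
    finally have 1: "cmod (f (of_real \<rho> * z)) \<le> C * (1 + cmod z) * exp ((1 + \<rho>) / 2 * \<bar>Im z\<bar>)" .
    have "cmod (g z) * (1 + cmod z) ^ j * (1 + cmod z)
        = cmod (f (of_real \<rho> * z)) * (cmod (csinc (of_real \<delta> * z) ^ Suc j) * (1 + cmod z) ^ Suc j)"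
      by (simp add: g_def norm_mult)
    also have "\<dots> \<le> (C * (1 + cmod z) * exp ((1 + \<rho>) / 2 * \<bar>Im z\<bar>)) * (B * exp (real (Suc j) * \<delta> * \<bar>Im z\<bar>))"
      by (rule mult_mono[OF 1 B(2)]) (use C(1) in auto)
    also have "\<dots> = C * B * (exp ((1 + \<rho>) / 2 * \<bar>Im z\<bar>) * exp ((1 - \<rho>) / 2 * \<bar>Im z\<bar>)) * (1 + cmod z)"
      unfolding \<delta>(2) by simp
    also have "exp ((1 + \<rho>) / 2 * \<bar>Im z\<bar>) * exp ((1 - \<rho>) / 2 * \<bar>Im z\<bar>) = exp \<bar>Im z\<bar>"
      by (simp add: exp_add[symmetric] field_simps)
    finally show ?thesis using norm_ge_zero[of z] by (subst (asm) mult_le_cancel_right) linarith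
  qed
  moreover have "half_line_int p a g \<le> ennreal (\<rho> powr (- (a + 1))) * half_line_int p a f"
  proof -
    have "half_line_int p a g \<le> half_line_int p a (\<lambda>z. f (of_real \<rho> * z))"
      unfolding half_line_int_def
    proof (rule nn_integral_mono)
      fix u :: real
      have "cmod (csinc (of_real \<delta> * of_real u)) \<le> 1" using csinc_real_le_1[of "\<delta> * u"] by simp
      then have "cmod (csinc (of_real \<delta> * of_real u)) ^ Suc j \<le> 1" by (intro power_le_one) auto
      then have "cmod (g (of_real u)) \<le> cmod (f (of_real \<rho> * of_real u))"
        unfolding g_def norm_mult norm_power by (intro mult_left_le) auto
      then have "cmod (g (of_real u)) powr p \<le> cmod (f (of_real \<rho> * of_real u)) powr p"
        using p by (intro powr_mono2) auto
      then show "ennreal (cmod (g (of_real u)) powr p * u powr a) * indicator {0..} u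
        \<le> ennreal (cmod (f (of_real \<rho> * of_real u)) powr p * u powr a) * indicator {0..} u"
        by (intro mult_right_mono ennreal_leI) auto
    qed
    then show ?thesis by (simp add: half_line_int_dilate[OF fh \<rho>(1)])
  qed
  ultimately show ?thesis using that[of g "C * B"] C B by auto
qed

section \<open>Periodization\<close>

text \<open>
  The integers are enumerated by \<open>int_decode\<close>, whose \<open>n\<close>-th value has modulus at least \<open>(n - 1) / 2\<close>.
\<close>

lemma summable_on_int_inverse_power:
  assumes "j \<ge> 2"
  shows "(\<lambda>k::int. 1 / (1 + real_of_int \<bar>k\<bar>) ^ j) summable_on UNIV"
proof -
  have "(\<lambda>n. 1 / (1 + real_of_int \<bar>int_decode n\<bar>) ^ j) summable_on UNIV"
  proof (subst summable_on_UNIV_nonneg_real_iff)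
    have 1: "summable (\<lambda>n. 4 * (1 / (real (Suc n)) ^ 2))"
      by (intro summable_mult) (use inverse_power_summable[of 2] summable_Suc_iff[of "\<lambda>n. inverse (real n ^ 2)"] in \<open>simp add: field_simps\<close>)
    show "summable (\<lambda>n. 1 / (1 + real_of_int \<bar>int_decode n\<bar>) ^ j)"
    proof (rule summable_comparison_test[OF _ 1], intro exI allI impI)
      fix n :: nat
      have "int n \<le> 2 * \<bar>int_decode n\<bar> + 1"
        by (auto simp: int_decode_def sum_decode_def elim!: evenE oddE)
      then have "real_of_int (int n) \<le> real_of_int (2 * \<bar>int_decode n\<bar> + 1)" by (subst of_int_le_iff)
      then have "real (Suc n) / 2 \<le> 1 + real_of_int \<bar>int_decode n\<bar>" by simp
      then have "(real (Suc n) / 2) ^ 2 \<le> (1 + real_of_int \<bar>int_decode n\<bar>) ^ 2" by (intro power_mono) auto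
      also have "\<dots> \<le> (1 + real_of_int \<bar>int_decode n\<bar>) ^ j" using assms by (intro power_increasing) auto
      finally have "1 / (1 + real_of_int \<bar>int_decode n\<bar>) ^ j \<le> 1 / (real (Suc n) / 2) ^ 2"
        by (intro divide_left_mono) auto
      then show "norm (1 / (1 + real_of_int \<bar>int_decode n\<bar>) ^ j) \<le> 4 * (1 / (real (Suc n)) ^ 2)"
        by (simp add: power_divide)
    qed
  qed simp
  then show ?thesis
    using summable_on_reindex_bij_betw[OF bij_int_decode, of "\<lambda>k. 1 / (1 + real_of_int \<bar>k\<bar>) ^ j"] by simp
qed

definition invsum :: "nat \<Rightarrow> real" where
  "invsum j = (\<Sum>\<^sub>\<infinity>k::int. 1 / (1 + real_of_int \<bar>k\<bar>) ^ j)"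

definition periodization :: "(complex \<Rightarrow> complex) \<Rightarrow> nat \<Rightarrow> complex \<Rightarrow> complex" where
  "periodization g n z = (\<Sum>\<^sub>\<infinity>k::int. g (of_nat n * (z + of_int k * (2 * of_real pi))))"

text \<open>
  On the strip \<open>|Re z| \<le> R\<close> the translate by \<open>2 pi k\<close> has modulus at least \<open>|k| - R\<close>, which is comparable
  to \<open>|k|\<close> with the constant \<open>1 + R\<close>.
\<close>

lemma periodization_term_bound:
  assumes g: "\<And>z. cmod (g z) * (1 + cmod z) ^ j \<le> B * exp \<bar>Im z\<bar>"
    and n: "n \<ge> 1" and R: "\<bar>Re z\<bar> \<le> R" and B: "B > 0"
  shows "cmod (g (of_nat n * (z + of_int k * (2 * of_real pi))))
    \<le> B * (1 + R) ^ j * exp (real n * \<bar>Im z\<bar>) * (1 / (1 + real_of_int \<bar>k\<bar>) ^ j)"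
proof -
  define w where "w = of_nat n * (z + of_int k * (2 * of_real pi))"
  have R0: "R \<ge> 0" using R by linarith
  have "Re (z + of_int k * (2 * of_real pi)) = Re z + 2 * pi * real_of_int k" by simp
  then have "\<bar>2 * pi * real_of_int k\<bar> - R \<le> \<bar>Re (z + of_int k * (2 * of_real pi))\<bar>"
    using R by linarith
  also have "\<dots> \<le> cmod (z + of_int k * (2 * of_real pi))" by (rule abs_Re_le_cmod)
  also have "1 * \<dots> \<le> real n * \<dots>" using n by (intro mult_right_mono) auto
  then have "cmod (z + of_int k * (2 * of_real pi)) \<le> cmod w" by (simp add: w_def norm_mult)
  finally have "\<bar>2 * pi * real_of_int k\<bar> \<le> cmod w + R" by simp
  moreover have "1 * \<bar>real_of_int k\<bar> \<le> (2 * pi) * \<bar>real_of_int k\<bar>"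
    using pi_gt3 by (intro mult_right_mono) auto
  ultimately have "\<bar>real_of_int k\<bar> \<le> cmod w + R" by (simp add: abs_mult)
  moreover have "0 \<le> R * cmod w" using R0 by simp
  ultimately have "1 + real_of_int \<bar>k\<bar> \<le> (1 + R) * (1 + cmod w)" by (simp add: algebra_simps)
  then have "(1 + real_of_int \<bar>k\<bar>) ^ j \<le> ((1 + R) * (1 + cmod w)) ^ j" by (intro power_mono) auto
  then have "cmod (g w) * (1 + real_of_int \<bar>k\<bar>) ^ j \<le> cmod (g w) * ((1 + R) * (1 + cmod w)) ^ j"
    by (intro mult_left_mono) auto
  also have "\<dots> = (1 + R) ^ j * (cmod (g w) * (1 + cmod w) ^ j)" by (simp add: power_mult_distrib)
  also have "\<dots> \<le> (1 + R) ^ j * (B * exp \<bar>Im w\<bar>)" using g R0 by (intro mult_left_mono) auto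
  also have "\<bar>Im w\<bar> = real n * \<bar>Im z\<bar>" by (simp add: w_def abs_mult)
  finally show ?thesis unfolding w_def[symmetric]
    by (simp add: pos_le_divide_eq mult_ac)
qed

lemma periodization_summable:
  assumes g: "\<And>z. cmod (g z) * (1 + cmod z) ^ j \<le> B * exp \<bar>Im z\<bar>"
    and n: "n \<ge> 1" and B: "B > 0" and j: "j \<ge> 2"
  shows "(\<lambda>k::int. norm (g (of_nat n * (z + of_int k * (2 * of_real pi))))) summable_on UNIV"
proof (rule Infinite_Sum.abs_summable_on_comparison_test)
  let ?M = "\<lambda>k::int. (B * (1 + \<bar>Re z\<bar>) ^ j * exp (real n * \<bar>Im z\<bar>)) * (1 / (1 + real_of_int \<bar>k\<bar>) ^ j)"
  have "?M summable_on UNIV" by (intro summable_on_cmult_right summable_on_int_inverse_power j)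
  then show "(\<lambda>k. norm (?M k)) summable_on UNIV" using B by (simp add: abs_mult)
  show "norm (g (of_nat n * (z + of_int k * (2 * of_real pi)))) \<le> norm (?M k)" for k
    using order_trans[OF periodization_term_bound[OF g n order_refl B, of z k] abs_ge_self] unfolding real_norm_def .
qed

lemma periodization_periodic: "periodization g n (z + 2 * of_real pi) = periodization g n z"
proof -
  have "bij_betw (\<lambda>k::int. k + 1) UNIV UNIV"
    by (rule bij_betw_byWitness[of _ "\<lambda>k. k - 1"]) auto
  from infsum_reindex_bij_betw[OF this, of "\<lambda>k. g (of_nat n * (z + of_int k * (2 * of_real pi)))"]
  show ?thesis unfolding periodization_def by (simp add: algebra_simps)
qed

lemma periodization_even:
  assumes "\<And>z. g (- z) = g z"
  shows "periodization g n (- z) = periodization g n z"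
proof -
  have "bij_betw (\<lambda>k::int. - k) UNIV UNIV"
    by (rule bij_betw_byWitness[of _ "\<lambda>k. - k"]) auto
  from infsum_reindex_bij_betw[OF this, of "\<lambda>k. g (of_nat n * (- z + of_int k * (2 * of_real pi)))"]
  have 1: "periodization g n (- z) = (\<Sum>\<^sub>\<infinity>k::int. g (of_nat n * (- z + of_int (- k) * (2 * of_real pi))))"
    by (simp add: periodization_def)
  have 2: "of_nat n * (- z + of_int (- k) * (2 * of_real pi)) = - (of_nat n * (z + of_int k * (2 * of_real pi)))" for k :: int
    by (simp add: algebra_simps)
  show ?thesis unfolding 1 unfolding 2 assms periodization_def by (rule refl)
qed

lemma periodization_bound_strip:
  assumes g: "\<And>z. cmod (g z) * (1 + cmod z) ^ j \<le> B * exp \<bar>Im z\<bar>"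
    and n: "n \<ge> 1" and B: "B > 0" and j: "j \<ge> 2" and R: "\<bar>Re z\<bar> \<le> R"
  shows "cmod (periodization g n z) \<le> (B * (1 + R) ^ j * invsum j) * exp (real n * \<bar>Im z\<bar>)"
proof -
  have "cmod (periodization g n z) \<le> (B * (1 + R) ^ j * exp (real n * \<bar>Im z\<bar>)) * invsum j"
    unfolding periodization_def
  proof (rule norm_infsum_le)
    show "((\<lambda>k. g (of_nat n * (z + of_int k * (2 * of_real pi)))) has_sum
        (\<Sum>\<^sub>\<infinity>k::int. g (of_nat n * (z + of_int k * (2 * of_real pi))))) UNIV"
      by (rule has_sum_infsum[OF Infinite_Sum.abs_summable_summable[OF periodization_summable[OF g n B j]]])
    show "((\<lambda>k::int. (B * (1 + R) ^ j * exp (real n * \<bar>Im z\<bar>)) * (1 / (1 + real_of_int \<bar>k\<bar>) ^ j)) has_sum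
        (B * (1 + R) ^ j * exp (real n * \<bar>Im z\<bar>)) * invsum j) UNIV"
      unfolding invsum_def by (intro has_sum_cmult_right has_sum_infsum summable_on_int_inverse_power j)
    show "cmod (g (of_nat n * (z + of_int k * (2 * of_real pi)))) \<le> (B * (1 + R) ^ j * exp (real n * \<bar>Im z\<bar>)) * (1 / (1 + real_of_int \<bar>k\<bar>) ^ j)" for k
      by (rule periodization_term_bound[OF g n R B])
  qed
  then show ?thesis by (simp add: mult_ac)
qed

text \<open>
  By periodicity only the strip \<open>|Re z| \<le> pi\<close> matters.
\<close>

lemma periodization_bound:
  assumes g: "\<And>z. cmod (g z) * (1 + cmod z) ^ j \<le> B * exp \<bar>Im z\<bar>"
    and n: "n \<ge> 1" and B: "B > 0" and j: "j \<ge> 2"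
  shows "cmod (periodization g n z) \<le> (B * (1 + pi) ^ j * invsum j) * exp (real n * \<bar>Im z\<bar>)"
proof -
  define F where "F = periodization g n"
  have shift: "F (z + of_int k * (2 * of_real pi)) = F z" for z and k :: int
    by (rule periodic_int_shift) (simp add: F_def periodization_periodic)
  \<comment> \<open>the period by which \<open>z\<close> is moved into the strip\<close>
  define k where "k = - round (Re z / (2 * pi))"
  define w where "w = z + of_int k * (2 * of_real pi)"
  have "\<bar>Re z / (2 * pi) - of_int (round (Re z / (2 * pi)))\<bar> \<le> 1 / 2"
    using of_int_round_abs_le[of "Re z / (2 * pi)"] by (simp add: abs_minus_commute)
  then have "(2 * pi) * \<bar>Re z / (2 * pi) - of_int (round (Re z / (2 * pi)))\<bar> \<le> (2 * pi) * (1 / 2)"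
    by (intro mult_left_mono) auto
  also have "(2 * pi) * \<bar>Re z / (2 * pi) - of_int (round (Re z / (2 * pi)))\<bar> = \<bar>(2 * pi) * (Re z / (2 * pi) - of_int (round (Re z / (2 * pi))))\<bar>"
    by (simp add: abs_mult)
  also have "(2 * pi) * (Re z / (2 * pi) - of_int (round (Re z / (2 * pi)))) = Re w"
    by (simp add: w_def k_def right_diff_distrib)
  finally have "\<bar>Re w\<bar> \<le> pi" by simp
  moreover have "Im w = Im z" by (simp add: w_def)
  moreover have "F w = F z" by (simp add: w_def shift)
  ultimately show ?thesis using periodization_bound_strip[OF g n B j, of w pi] by (simp add: F_def)
qed

lemma periodization_holomorphic:
  assumes g: "\<And>z. cmod (g z) * (1 + cmod z) ^ j \<le> B * exp \<bar>Im z\<bar>"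
    and gh: "g holomorphic_on UNIV"
    and n: "n \<ge> 1" and B: "B > 0" and j: "j \<ge> 2"
  shows "periodization g n holomorphic_on UNIV"
proof -
  have "periodization g n holomorphic_on ball z0 1" for z0
  proof -
    define M where "M k = (B * (1 + (cmod z0 + 1)) ^ j * exp (real n * (cmod z0 + 1))) * (1 / (1 + real_of_int \<bar>k\<bar>) ^ j)" for k
    have ul: "uniform_limit (cball z0 1) (\<lambda>X z. \<Sum>k\<in>X. g (of_nat n * (z + of_int k * (2 * of_real pi))))
       (periodization g n) (finite_subsets_at_top UNIV)"
      unfolding periodization_def[abs_def]
    proof (rule Weierstrass_m_test_general[where M = M])
      fix k :: int and z assume "z \<in> cball z0 1"
      then have "cmod z \<le> cmod z0 + 1" using norm_triangle_sub[of z z0] by (simp add: dist_norm norm_minus_commute)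
      then have R: "\<bar>Re z\<bar> \<le> cmod z0 + 1" "\<bar>Im z\<bar> \<le> cmod z0 + 1"
        using abs_Re_le_cmod[of z] abs_Im_le_cmod[of z] by linarith+
      have "cmod (g (of_nat n * (z + of_int k * (2 * of_real pi)))) \<le> B * (1 + (cmod z0 + 1)) ^ j * exp (real n * \<bar>Im z\<bar>) * (1 / (1 + real_of_int \<bar>k\<bar>) ^ j)"
        by (rule periodization_term_bound[OF g n R(1) B])
      also have "\<dots> \<le> M k" unfolding M_def using R(2) B by (intro mult_right_mono mult_left_mono) (auto intro!: mult_left_mono)
      finally show "cmod (g (of_nat n * (z + of_int k * (2 * of_real pi)))) \<le> M k" .
    next
      show "M summable_on UNIV" unfolding M_def by (intro summable_on_cmult_right summable_on_int_inverse_power j)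
    qed
    have hol: "(\<lambda>z. \<Sum>k\<in>X. g (of_nat n * (z + of_int k * (2 * of_real pi)))) holomorphic_on A" for X :: "int set" and A
    proof (intro holomorphic_on_sum)
      fix k :: int
      show "(\<lambda>z. g (of_nat n * (z + of_int k * (2 * of_real pi)))) holomorphic_on A"
        by (intro entire_compose[OF gh] holomorphic_intros)
    qed
    show ?thesis
      by (rule holomorphic_uniform_limit[OF _ ul])
         (auto intro!: always_eventually hol holomorphic_on_imp_continuous_on)
  qed
  then have "periodization g n field_differentiable at z" for z
    using holomorphic_on_imp_differentiable_at[OF _ open_ball, of "periodization g n" z 1 z] by simp
  then show ?thesis by (auto simp: holomorphic_on_def field_differentiable_at_within)
qed

text \<open>
  The term \<open>k = 0\<close> of the periodization is \<open>g (n x)\<close>. In all other terms the argument has modulus at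
  least \<open>n |k|\<close>.
\<close>

lemma periodization_close:
  assumes g: "\<And>z. cmod (g z) * (1 + cmod z) ^ j \<le> B * exp \<bar>Im z\<bar>"
    and n: "n \<ge> 1" and B: "B > 0" and j: "j \<ge> 2" and x: "\<bar>x\<bar> \<le> pi"
  shows "cmod (periodization g n (of_real x) - g (of_nat n * of_real x)) \<le> B * 2 ^ j * invsum j / real n ^ j"
proof -
  let ?t = "\<lambda>k::int. g (of_nat n * (of_real x + of_int k * (2 * of_real pi)))"
  have sm: "?t summable_on UNIV" using periodization_summable[OF g n B j] by (rule Infinite_Sum.abs_summable_summable)
  have "periodization g n (of_real x) = infsum ?t (insert 0 (UNIV - {0}))"
    by (simp add: periodization_def insert_absorb)
  also have "\<dots> = ?t 0 + infsum ?t (UNIV - {0})"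
    by (rule infsum_insert) (auto intro: summable_on_subset_banach[OF sm])
  finally have eq: "periodization g n (of_real x) - g (of_nat n * of_real x) = infsum ?t (UNIV - {0})" by simp
  have "cmod (infsum ?t (UNIV - {0})) \<le> (B * 2 ^ j / real n ^ j) * (\<Sum>\<^sub>\<infinity>k\<in>UNIV - {0}. 1 / (1 + real_of_int \<bar>k\<bar>) ^ j)"
  proof (rule norm_infsum_le)
    show "(?t has_sum infsum ?t (UNIV - {0})) (UNIV - {0})"
      by (intro has_sum_infsum summable_on_subset_banach[OF sm]) auto
    show "((\<lambda>k. (B * 2 ^ j / real n ^ j) * (1 / (1 + real_of_int \<bar>k\<bar>) ^ j)) has_sum
       (B * 2 ^ j / real n ^ j) * (\<Sum>\<^sub>\<infinity>k\<in>UNIV - {0}. 1 / (1 + real_of_int \<bar>k\<bar>) ^ j)) (UNIV - {0})"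
      by (intro has_sum_cmult_right has_sum_infsum summable_on_subset_banach[OF summable_on_int_inverse_power[OF j]]) auto
    show "cmod (?t k) \<le> (B * 2 ^ j / real n ^ j) * (1 / (1 + real_of_int \<bar>k\<bar>) ^ j)" if "k \<in> UNIV - {0}" for k
    proof -
      define w where "w = complex_of_nat n * (of_real x + of_int k * (2 * of_real pi))"
      have w: "w = of_real (real n * (x + 2 * pi * real_of_int k))" by (simp add: w_def)
      have k1: "1 \<le> \<bar>real_of_int k\<bar>" using that by (metis Diff_iff UNIV_I insertI1 of_int_abs of_int_1_le_iff zero_less_abs_iff int_one_le_iff_zero_less insert_iff)
      have "pi * 1 \<le> pi * \<bar>real_of_int k\<bar>" using k1 by (intro mult_left_mono) auto
      moreover have "\<bar>2 * pi * real_of_int k\<bar> = 2 * (pi * \<bar>real_of_int k\<bar>)" by (simp add: abs_mult)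
      ultimately have "pi * \<bar>real_of_int k\<bar> \<le> \<bar>2 * pi * real_of_int k\<bar> - \<bar>x\<bar>" using x by linarith
      also have "\<dots> \<le> \<bar>x + 2 * pi * real_of_int k\<bar>" by linarith
      finally have 1: "pi * \<bar>real_of_int k\<bar> \<le> \<bar>x + 2 * pi * real_of_int k\<bar>" .
      have "(1 + \<bar>real_of_int k\<bar>) / 2 \<le> \<bar>real_of_int k\<bar>" using k1 by simp
      also have "\<dots> \<le> pi * \<bar>real_of_int k\<bar>" using pi_gt3 by (intro mult_le_cancel_right1[THEN iffD2]) auto
      also note 1
      finally have "real n * ((1 + \<bar>real_of_int k\<bar>) / 2) \<le> real n * \<bar>x + 2 * pi * real_of_int k\<bar>"
        by (intro mult_left_mono) auto
      also have "\<dots> = cmod w" unfolding w norm_of_real by (simp add: abs_mult)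
      also have "\<dots> \<le> 1 + cmod w" by simp
      finally have "(real n * ((1 + \<bar>real_of_int k\<bar>) / 2)) ^ j \<le> (1 + cmod w) ^ j" by (intro power_mono) auto
      then have "cmod (g w) * (real n * ((1 + \<bar>real_of_int k\<bar>) / 2)) ^ j \<le> cmod (g w) * (1 + cmod w) ^ j"
        by (intro mult_left_mono) auto
      also have "\<dots> \<le> B * exp \<bar>Im w\<bar>" by (rule g)
      also have "\<dots> = B" by (simp add: w)
      finally have *: "cmod (g w) * (real n * ((1 + \<bar>real_of_int k\<bar>) / 2)) ^ j \<le> B" .
      have pos: "0 < real n ^ j" "0 < (1 + \<bar>real_of_int k\<bar>) ^ j" using n by (auto intro!: zero_less_power add_pos_nonneg)
      have "cmod (g w) * (real n ^ j * (1 + \<bar>real_of_int k\<bar>) ^ j / 2 ^ j) \<le> B"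
        using * by (simp only: power_mult_distrib power_divide times_divide_eq_right)
      then have "cmod (g w) \<le> B / (real n ^ j * (1 + \<bar>real_of_int k\<bar>) ^ j / 2 ^ j)"
        using pos by (subst pos_le_divide_eq) auto
      then show ?thesis unfolding w_def[symmetric] by simp
    qed
  qed
  also have "\<dots> \<le> (B * 2 ^ j / real n ^ j) * invsum j"
    unfolding invsum_def using B
    by (intro mult_left_mono infsum_mono_neutral summable_on_int_inverse_power j
        summable_on_subset_banach[OF summable_on_int_inverse_power[OF j]]) auto
  finally show ?thesis unfolding eq by (simp add: mult_ac)
qed

text \<open>
  The periodization of a decaying even function of type 1, dilated by \<open>n\<close>, is periodic and of type
  \<open>n\<close>, so it is a polynomial of degree at most \<open>n\<close> in the cosine.
\<close>

lemma cosine_polynomials_approximate: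
  assumes gh: "g holomorphic_on UNIV" and ev: "\<And>z. g (- z) = g z"
    and g: "\<And>z. cmod (g z) * (1 + cmod z) ^ j \<le> B * exp \<bar>Im z\<bar>" and B: "B > 0" and j: "j \<ge> 2"
  obtains D where "D \<ge> 0" "\<And>n. n \<ge> 1 \<Longrightarrow> \<exists>q :: complex poly. degree q \<le> n \<and>
     (\<forall>x. \<bar>x\<bar> \<le> pi \<longrightarrow> cmod (poly q (of_real (cos x)) - g (of_nat n * of_real x)) \<le> D / real n ^ j)"
proof -
  have D0: "B * 2 ^ j * invsum j \<ge> 0" unfolding invsum_def using B by (intro mult_nonneg_nonneg infsum_nonneg) auto
  have "\<exists>q :: complex poly. degree q \<le> n \<and>
     (\<forall>x. \<bar>x\<bar> \<le> pi \<longrightarrow> cmod (poly q (of_real (cos x)) - g (of_nat n * of_real x)) \<le> B * 2 ^ j * invsum j / real n ^ j)"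
    if n: "n \<ge> 1" for n
  proof -
    obtain q :: "complex poly" where q: "degree q \<le> n" "\<And>z. periodization g n z = poly q (cos z)"
      using periodic_exponential_type_is_cos_poly[OF periodization_holomorphic[OF g gh n B j]
          periodization_even[of g, OF ev] periodization_periodic periodization_bound[OF g n B j]] by metis
    then show ?thesis using periodization_close[OF g n B j] by (metis cos_of_real)
  qed
  with that D0 show ?thesis by blast
qed

section \<open>The extremal problem on the line as a limit\<close>

text \<open>
  The extremal problem on the circle whose limit is the extremal problem on the half line.
\<close>

definition scaled_arc_min :: "real \<Rightarrow> real \<Rightarrow> nat \<Rightarrow> ennreal" where
  "scaled_arc_min p a n = (INF q\<in>{q. degree q \<le> n \<and> poly q 1 = 1}. scaled_arc_int p a n q)"

lemma scaled_arc_int_smult: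
  "scaled_arc_int p a n (smult c q) = ennreal (cmod c powr p) * scaled_arc_int p a n q"
proof -
  have "scaled_arc_int p a n (smult c q) = (\<integral>\<^sup>+u. ennreal (cmod c powr p) * (ennreal (cmod (poly q (of_real (cos (u / real n)))) powr p *
      (real n * sin (u / real n)) powr a) * indicator {0..pi * real n} u) \<partial>lborel)"
    unfolding scaled_arc_int_def
    by (intro nn_integral_cong) (auto simp: norm_mult powr_mult ennreal_mult'[symmetric] mult_ac split: split_indicator)
  also have "\<dots> = ennreal (cmod c powr p) * scaled_arc_int p a n q"
    unfolding scaled_arc_int_def by (intro nn_integral_cmult) measurable
  finally show ?thesis .
qed

lemma divide_Suc_power_tendsto_0:
  assumes "real j > 0"
  shows "(\<lambda>n. D / real (Suc n) ^ j) \<longlonglongrightarrow> 0"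
proof -
  have "filterlim (\<lambda>n. real (Suc n) ^ j) at_top sequentially"
    using assms by (intro filterlim_pow_at_top filterlim_compose[OF filterlim_real_sequentially filterlim_Suc]) simp
  then show ?thesis by (intro tendsto_divide_0[OF tendsto_const] filterlim_at_top_imp_at_infinity)
qed

text \<open>
  Dominated convergence: \<open>n\<close> is at least \<open>u / pi\<close> on the domain of integration, so the error of order
  \<open>n\<close> to the power \<open>- j\<close> is also an error of order \<open>(1 + u)\<close> to the power \<open>- j\<close>.
\<close>

lemma scaled_arc_int_tendsto_half_line_int:
  assumes p: "p \<ge> 1" and a: "a \<ge> 0" and j: "real j \<ge> a + 2"
    and gh: "g holomorphic_on UNIV" 
    and g: "\<And>z. cmod (g z) * (1 + cmod z) ^ j \<le> B * exp \<bar>Im z\<bar>"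
    and D: "D \<ge> 0"
    and q: "\<And>n x. n \<ge> 1 \<Longrightarrow> \<bar>x\<bar> \<le> pi \<Longrightarrow> cmod (poly (q n) (of_real (cos x)) - g (of_nat n * of_real x)) \<le> D / real n ^ j"
  shows "(\<lambda>n. scaled_arc_int p a (Suc n) (q (Suc n))) \<longlonglongrightarrow> half_line_int p a g"
proof -
  \<comment> \<open>\<open>B\<close> is the share of \<open>g\<close> in the decay bound, the rest is that of the error, where \<open>1 + u\<close> is at most \<open>Suc n * (1 + pi)\<close>\<close>
  define E where "E = B + D * (1 + pi) ^ j"
  define G where "G n u = ennreal (cmod (poly (q (Suc n)) (of_real (cos (u / real (Suc n))))) powr p *
      (real (Suc n) * sin (u / real (Suc n))) powr a) * indicator {0..pi * real (Suc n)} u" for n u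
  have close: "cmod (poly (q (Suc n)) (of_real (cos (u / real (Suc n)))) - g (of_real u)) \<le> D / real (Suc n) ^ j"
    if "0 \<le> u" "u \<le> pi * real (Suc n)" for n u
  proof -
    have "\<bar>u / real (Suc n)\<bar> \<le> pi" using that by (simp add: divide_le_eq)
    have "complex_of_nat (Suc n) * of_real (u / real (Suc n)) = of_real (real (Suc n) * (u / real (Suc n)))"
      by (simp only: of_real_mult of_real_of_nat_eq)
    also have "\<dots> = of_real u" by (simp del: of_nat_Suc)
    finally show ?thesis using q[OF _ \<open>\<bar>u / real (Suc n)\<bar> \<le> pi\<close>, of "Suc n"] by simp
  qed
  have qb: "cmod (poly (q (Suc n)) (of_real (cos (u / real (Suc n))))) * (1 + u) ^ j \<le> E"
    if u: "0 \<le> u" "u \<le> pi * real (Suc n)" for n u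
  proof -
    have "cmod (poly (q (Suc n)) (of_real (cos (u / real (Suc n))))) \<le> cmod (g (of_real u)) + D / real (Suc n) ^ j"
      using close[OF u] norm_triangle_sub[of "poly (q (Suc n)) (of_real (cos (u / real (Suc n))))" "g (of_real u)"] by linarith
    then have "cmod (poly (q (Suc n)) (of_real (cos (u / real (Suc n))))) * (1 + u) ^ j
       \<le> (cmod (g (of_real u)) + D / real (Suc n) ^ j) * (1 + u) ^ j"
      using u by (intro mult_right_mono) auto
    also have "\<dots> = cmod (g (of_real u)) * (1 + u) ^ j + D / real (Suc n) ^ j * (1 + u) ^ j" by (rule distrib_right)
    also have "cmod (g (of_real u)) * (1 + u) ^ j \<le> B" using g[of "of_real u"] u by simp
    also have "D / real (Suc n) ^ j * (1 + u) ^ j \<le> D / real (Suc n) ^ j * (real (Suc n) * (1 + pi)) ^ j"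
    proof -
      have "1 + u \<le> real (Suc n) * (1 + pi)" using u by (simp add: algebra_simps)
      then show ?thesis using u D by (intro mult_left_mono power_mono) auto
    qed
    also have "\<dots> = D * (1 + pi) ^ j" by (simp add: power_mult_distrib del: of_nat_Suc)
    finally show ?thesis by (simp add: E_def)
  qed
  have "(\<lambda>n. \<integral>\<^sup>+u. G n u \<partial>lborel) \<longlonglongrightarrow> (\<integral>\<^sup>+u. ennreal (cmod (g (of_real u)) powr p * u powr a) * indicator {0..} u \<partial>lborel)"
  proof (rule nn_integral_dominated_convergence[where w = "\<lambda>u. ennreal (E powr p) * (ennreal ((1 + u) powr (-2)) * indicator {0..} u)"])
    show "G n \<in> borel_measurable lborel" for n unfolding G_def by measurable
    show "(\<lambda>u. ennreal (cmod (g (of_real u)) powr p * u powr a) * indicator {0..} u) \<in> borel_measurable lborel"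
      by (rule half_line_int_measurable[OF gh])
    show "(\<integral>\<^sup>+u. ennreal (E powr p) * (ennreal ((1 + u) powr (-2)) * indicator {0..} u) \<partial>lborel) < \<infinity>"
      by (subst nn_integral_cmult) (auto simp: one_plus_powr_neg2_integral)
    show "AE u in lborel. G n u \<le> ennreal (E powr p) * (ennreal ((1 + u) powr (-2)) * indicator {0..} u)" for n
    proof (rule AE_I2)
      fix u :: real
      show "G n u \<le> ennreal (E powr p) * (ennreal ((1 + u) powr (-2)) * indicator {0..} u)"
      proof (cases "0 \<le> u \<and> u \<le> pi * real (Suc n)")
        case True
        then have u: "0 \<le> u" "u \<le> pi * real (Suc n)" by auto
        have "u / real (Suc n) \<le> pi" using u by (simp add: divide_le_eq)
        then have "0 \<le> sin (u / real (Suc n))" using u by (intro sin_ge_zero) auto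
        then have w0: "0 \<le> real (Suc n) * sin (u / real (Suc n))" by (intro mult_nonneg_nonneg) auto
        have "sin (u / real (Suc n)) \<le> u / real (Suc n)" using u by (intro sin_x_le_x) auto
        then have "real (Suc n) * sin (u / real (Suc n)) \<le> real (Suc n) * (u / real (Suc n))" by (intro mult_left_mono) auto
        then have w1: "real (Suc n) * sin (u / real (Suc n)) \<le> u" by (simp del: of_nat_Suc)
        have "cmod (poly (q (Suc n)) (of_real (cos (u / real (Suc n))))) powr p * (real (Suc n) * sin (u / real (Suc n))) powr a
           \<le> E powr p * (1 + u) powr (-2)"
          by (rule decay_integrand_bound[OF p a j u(1) norm_ge_zero qb[OF u] w0 w1])
        then show ?thesis using u by (simp add: G_def ennreal_mult'[symmetric] ennreal_leI del: of_nat_Suc)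
      qed (auto simp: G_def split: split_indicator)
    qed
    show "AE u in lborel. (\<lambda>n. G n u) \<longlonglongrightarrow> ennreal (cmod (g (of_real u)) powr p * u powr a) * indicator {0..} u"
    proof (rule AE_I2)
      fix u :: real
      consider "u < 0" | "u = 0" | "u > 0" by linarith
      then show "(\<lambda>n. G n u) \<longlonglongrightarrow> ennreal (cmod (g (of_real u)) powr p * u powr a) * indicator {0..} u"
      proof cases
        case 3
        have ev: "\<forall>\<^sub>F n in sequentially. u \<le> pi * real (Suc n)"
        proof -
          have "\<forall>\<^sub>F n in sequentially. u / pi \<le> real (Suc n)"
            using filterlim_at_top[THEN iffD1, rule_format, OF filterlim_compose[OF filterlim_real_sequentially filterlim_Suc], of "u / pi"] .
          then show ?thesis by eventually_elim (simp add: divide_le_eq mult.commute)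
        qed
        have "((\<lambda>x. x * sin (u / x)) \<longlongrightarrow> u) at_top" using 3 by real_asymp
        then have "(\<lambda>n. real (Suc n) * sin (u / real (Suc n))) \<longlonglongrightarrow> u"
          by (rule filterlim_compose[OF _ filterlim_compose[OF filterlim_real_sequentially filterlim_Suc]])
        then have 1: "(\<lambda>n. (real (Suc n) * sin (u / real (Suc n))) powr a) \<longlonglongrightarrow> u powr a"
          using 3 by (intro tendsto_powr tendsto_const) auto
        have "(\<lambda>n. D / real (Suc n) ^ j) \<longlonglongrightarrow> 0"
          by (rule divide_Suc_power_tendsto_0) (use j a in linarith)
        then have "(\<lambda>n. poly (q (Suc n)) (of_real (cos (u / real (Suc n)))) - g (of_real u)) \<longlonglongrightarrow> 0"
          by (rule Lim_null_comparison[rotated]) (use ev close 3 in \<open>auto elim!: eventually_mono\<close>)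
        then have "(\<lambda>n. poly (q (Suc n)) (of_real (cos (u / real (Suc n))))) \<longlonglongrightarrow> g (of_real u)"
          by (rule LIM_zero_cancel)
        then have "(\<lambda>n. cmod (poly (q (Suc n)) (of_real (cos (u / real (Suc n))))) powr p) \<longlonglongrightarrow> cmod (g (of_real u)) powr p"
          using p by (intro tendsto_powr' tendsto_const tendsto_norm) auto
        from tendsto_mult[OF this 1]
        have "(\<lambda>n. ennreal (cmod (poly (q (Suc n)) (of_real (cos (u / real (Suc n))))) powr p *
            (real (Suc n) * sin (u / real (Suc n))) powr a)) \<longlonglongrightarrow> ennreal (cmod (g (of_real u)) powr p * u powr a)"
          by (rule tendsto_ennrealI)
        moreover have "\<forall>\<^sub>F n in sequentially. G n u = ennreal (cmod (poly (q (Suc n)) (of_real (cos (u / real (Suc n))))) powr p *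
            (real (Suc n) * sin (u / real (Suc n))) powr a)"
          using ev by eventually_elim (use 3 in \<open>simp add: G_def del: of_nat_Suc\<close>)
        ultimately show ?thesis using 3 by (simp add: tendsto_cong)
      qed (auto simp: G_def)
    qed
  qed simp
  then show ?thesis unfolding G_def scaled_arc_int_def half_line_int_def .
qed

text \<open>
  A competitor \<open>f\<close> on the half line is replaced by a damped one, which is approximated by polynomials in
  the cosine. Their values at 1 tend to 1, and normalising them gives competitors on the circle. In the
  end the dilation factor \<open>\<rho>\<close> tends to 1.
\<close>

lemma limsup_scaled_arc_min_le:
  assumes p: "p \<ge> 1" and a: "a \<ge> 0" and f: "f \<in> even_exp_type" "f 0 = 1" 
  shows "limsup (\<lambda>n. scaled_arc_min p a (Suc n)) \<le> half_line_int p a f"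
proof (cases "half_line_int p a f < \<infinity>")
  case False
  then show ?thesis by (simp add: less_top[symmetric])
next
  case fin: True
  define j where "j = nat \<lceil>a\<rceil> + 2"
  \<comment> \<open>order \<open>a + 2\<close> makes the integrand integrable, order 2 makes the periodization converge\<close>
  have j: "real j \<ge> a + 2" "j \<ge> 2" using a by (auto simp: j_def)
  have main: "limsup (\<lambda>n. scaled_arc_min p a (Suc n)) \<le> ennreal (\<rho> powr (- (a + 1))) * half_line_int p a f" if \<rho>: "0 < \<rho>" "\<rho> < 1" for \<rho>
  proof -
    obtain g B where g: "g holomorphic_on UNIV" "\<And>z. g (- z) = g z" "g 0 = 1" "B > 0"
      "\<And>z. cmod (g z) * (1 + cmod z) ^ j \<le> B * exp \<bar>Im z\<bar>"
      "half_line_int p a g \<le> ennreal (\<rho> powr (- (a + 1))) * half_line_int p a f"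
      using damped_competitor[OF f even_exp_type_growth[OF f(1) p a fin] \<rho> p, of j a] by blast
    obtain D where D: "D \<ge> 0" and "\<And>n. n \<ge> 1 \<Longrightarrow> \<exists>q :: complex poly. degree q \<le> n \<and>
     (\<forall>x. \<bar>x\<bar> \<le> pi \<longrightarrow> cmod (poly q (of_real (cos x)) - g (of_nat n * of_real x)) \<le> D / real n ^ j)"
      using cosine_polynomials_approximate[OF g(1,2,5,4) j(2)] by blast
    then obtain q :: "nat \<Rightarrow> complex poly" where deg: "\<And>n. n \<ge> 1 \<Longrightarrow> degree (q n) \<le> n"
      and q: "\<And>n x. n \<ge> 1 \<Longrightarrow> \<bar>x\<bar> \<le> pi \<Longrightarrow> cmod (poly (q n) (of_real (cos x)) - g (of_nat n * of_real x)) \<le> D / real n ^ j"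
      by metis
    have lim: "(\<lambda>n. scaled_arc_int p a (Suc n) (q (Suc n))) \<longlonglongrightarrow> half_line_int p a g"
      by (rule scaled_arc_int_tendsto_half_line_int[OF p a j(1) g(1,5) D q])
    define c where "c n = poly (q (Suc n)) 1" for n
    have "(\<lambda>n. D / real (Suc n) ^ j) \<longlonglongrightarrow> 0"
      by (rule divide_Suc_power_tendsto_0) (use j in linarith)
    then have "(\<lambda>n. c n - 1) \<longlonglongrightarrow> 0"
      by (rule Lim_null_comparison[rotated]) (use q[of _ 0] g(3) in \<open>auto simp: c_def simp del: of_nat_Suc intro!: always_eventually\<close>)
    then have c: "c \<longlonglongrightarrow> 1" by (rule LIM_zero_cancel)
    then have "\<forall>\<^sub>F n in sequentially. c n \<noteq> 0" by (rule tendsto_imp_eventually_ne) simp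
    then have "\<forall>\<^sub>F n in sequentially. scaled_arc_min p a (Suc n) \<le> ennreal (cmod (inverse (c n)) powr p) * scaled_arc_int p a (Suc n) (q (Suc n))"
    proof eventually_elim
      case (elim n)
      then have "scaled_arc_min p a (Suc n) \<le> scaled_arc_int p a (Suc n) (smult (inverse (c n)) (q (Suc n)))"
        unfolding scaled_arc_min_def using deg[of "Suc n"] by (intro INF_lower) (auto simp: c_def)
      then show ?case by (simp add: scaled_arc_int_smult)
    qed
    then have "limsup (\<lambda>n. scaled_arc_min p a (Suc n)) \<le> limsup (\<lambda>n. ennreal (cmod (inverse (c n)) powr p) * scaled_arc_int p a (Suc n) (q (Suc n)))"
      by (rule Limsup_mono)
    also have "\<dots> = half_line_int p a g"
    proof (rule lim_imp_Limsup)
      have "(\<lambda>n. cmod (inverse (c n)) powr p) \<longlonglongrightarrow> cmod (inverse 1) powr p"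
        using c p by (intro tendsto_powr' tendsto_const tendsto_norm tendsto_inverse) auto
      then have "(\<lambda>n. ennreal (cmod (inverse (c n)) powr p)) \<longlonglongrightarrow> ennreal 1" by (intro tendsto_ennrealI) simp
      from tendsto_mult_ennreal[OF this lim]
      show "(\<lambda>n. ennreal (cmod (inverse (c n)) powr p) * scaled_arc_int p a (Suc n) (q (Suc n))) \<longlonglongrightarrow> half_line_int p a g" by simp
    qed simp
    finally show ?thesis using g(6) by (rule order_trans)
  qed
  have "((\<lambda>\<rho>. ennreal (\<rho> powr (- (a + 1))) * half_line_int p a f) \<longlongrightarrow> ennreal (1 powr (- (a + 1))) * half_line_int p a f) (at_left 1)"
    using fin by (intro tendsto_mult_ennreal tendsto_ennrealI tendsto_powr tendsto_const tendsto_ident_at) (auto simp: less_top)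
  moreover have "\<forall>\<^sub>F \<rho> in at_left 1. limsup (\<lambda>n. scaled_arc_min p a (Suc n)) \<le> ennreal (\<rho> powr (- (a + 1))) * half_line_int p a f"
  proof -
    have "\<forall>\<^sub>F \<rho> in at_left (1::real). \<rho> \<in> {0<..<1}" by (rule eventually_at_left_real) simp
    then show ?thesis by eventually_elim (use main in auto)
  qed
  ultimately have "limsup (\<lambda>n. scaled_arc_min p a (Suc n)) \<le> ennreal (1 powr (- (a + 1))) * half_line_int p a f"
    by (rule tendsto_lowerbound) simp
  then show ?thesis by simp
qed

text \<open>
  Near-minimal polynomials along a subsequence that realises the limit inferior converge to some \<open>f\<close>, whose
  integral is at most the limit inferior. The limit superior is at most the integral of every
  competitor. So the limit exists, and \<open>f\<close> is a minimiser.
\<close>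

lemma scaled_arc_min_limit:
  assumes p: "p \<ge> 1" and a: "a \<ge> 0"
  obtains f where "f \<in> even_exp_type" "f 0 = 1" "(\<lambda>n. scaled_arc_min p a n) \<longlonglongrightarrow> half_line_int p a f"
    "0 < half_line_int p a f" "half_line_int p a f < \<infinity>"
    "\<And>g. g \<in> even_exp_type \<Longrightarrow> g 0 = 1 \<Longrightarrow> half_line_int p a f \<le> half_line_int p a g"
proof -
  \<comment> \<open>shifted by one so that the division by the degree bound makes sense for every \<open>n\<close>\<close>
  define d where "d n = scaled_arc_min p a (Suc n)" for n
  obtain g0 where g0: "g0 \<in> even_exp_type" "g0 0 = 1" "half_line_int p a g0 < \<infinity>"
    using even_exp_type_nontrivial[OF p a] .
  have up: "limsup d \<le> half_line_int p a g" if "g \<in> even_exp_type" "g 0 = 1" for g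
    unfolding d_def using limsup_scaled_arc_min_le[OF p a that] .
  have lo: "ennreal (nikolskii_const p a) \<le> d n" for n
    unfolding d_def scaled_arc_min_def
  proof (rule INF_greatest, clarify)
    fix q :: "complex poly" assume "degree q \<le> Suc n" "poly q 1 = 1"
    then show "ennreal (nikolskii_const p a) \<le> scaled_arc_int p a (Suc n) q"
      using scaled_arc_int_nikolskii[of p a q "Suc n" 1] p a by simp
  qed
  have li: "liminf d < \<infinity>"
    using up[OF g0(1,2)] g0(3) Liminf_le_Limsup[of sequentially d] by (auto intro: le_less_trans)
  obtain r where r: "strict_mono (r :: nat \<Rightarrow> nat)" "(d \<circ> r) \<longlonglongrightarrow> liminf d"
    using liminf_subseq_lim by blast
  \<comment> \<open>a bound for the values of \<open>d\<close> along the tail of the subsequence\<close>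
  define b where "b = enn2real (liminf d) + 1"
  have "liminf d < ennreal b"
    using li by (cases "liminf d") (auto simp: b_def ennreal_less_iff)
  then have "\<forall>\<^sub>F k in sequentially. (d \<circ> r) k < ennreal b" using r(2) by (rule order_tendstoD(2)[rotated])
  then obtain k0 where k0: "\<And>k. k \<ge> k0 \<Longrightarrow> d (r k) < ennreal b" by (auto simp: eventually_sequentially)
  have "\<exists>q. degree q \<le> Suc (r (k + k0)) \<and> poly q 1 = 1 \<and> scaled_arc_int p a (Suc (r (k + k0))) q < d (r (k + k0)) + ennreal (1 / real (Suc k))" for k
  proof -
    have "d (r (k + k0)) < d (r (k + k0)) + ennreal (1 / real (Suc k))"
      using k0[of "k + k0"] by (cases "d (r (k + k0))") (auto simp: ennreal_plus[symmetric] ennreal_less_iff simp del: ennreal_plus)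
    then have "scaled_arc_min p a (Suc (r (k + k0))) < d (r (k + k0)) + ennreal (1 / real (Suc k))" by (simp add: d_def)
    then show ?thesis unfolding scaled_arc_min_def INF_less_iff by auto
  qed
  then obtain q :: "nat \<Rightarrow> complex poly" where q: "\<And>k. degree (q k) \<le> Suc (r (k + k0))" "\<And>k. poly (q k) 1 = 1"
    "\<And>k. scaled_arc_int p a (Suc (r (k + k0))) (q k) < d (r (k + k0)) + ennreal (1 / real (Suc k))" by metis
  have lim: "(\<lambda>k. scaled_arc_int p a (Suc (r (k + k0))) (q k)) \<longlonglongrightarrow> liminf d"
  proof (rule tendsto_sandwich)
    show l1: "(\<lambda>k. d (r (k + k0))) \<longlonglongrightarrow> liminf d" using LIMSEQ_ignore_initial_segment[OF r(2), of k0] by (simp add: o_def)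
    have "(\<lambda>k. ennreal (1 / real (Suc k))) \<longlonglongrightarrow> ennreal 0"
      by (intro tendsto_ennrealI lim_1_over_n[THEN LIMSEQ_Suc])
    from tendsto_add[OF l1 this]
    show "(\<lambda>k. d (r (k + k0)) + ennreal (1 / real (Suc k))) \<longlonglongrightarrow> liminf d" by simp
    show "\<forall>\<^sub>F k in sequentially. d (r (k + k0)) \<le> scaled_arc_int p a (Suc (r (k + k0))) (q k)"
      unfolding d_def scaled_arc_min_def by (intro always_eventually allI INF_lower) (use q in auto)
    show "\<forall>\<^sub>F k in sequentially. scaled_arc_int p a (Suc (r (k + k0))) (q k) \<le> d (r (k + k0)) + ennreal (1 / real (Suc k))"
      using q(3) by (intro always_eventually allI less_imp_le)
  qed
  have bd: "scaled_arc_int p a (Suc (r (k + k0))) (q k) \<le> ennreal (b + 1)" for k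
  proof -
    have "scaled_arc_int p a (Suc (r (k + k0))) (q k) \<le> d (r (k + k0)) + ennreal (1 / real (Suc k))" using q(3) by (rule less_imp_le)
    also have "\<dots> \<le> ennreal b + ennreal 1" using k0[of "k + k0"] by (intro add_mono ennreal_leI) auto
    also have "\<dots> = ennreal (b + 1)" by (rule ennreal_plus[symmetric]) (auto simp: b_def)
    finally show ?thesis .
  qed
  have fl: "filterlim (\<lambda>k. Suc (r (k + k0))) at_top sequentially"
    using filterlim_compose[OF filterlim_Suc filterlim_compose[OF filterlim_subseq[OF r(1)] filterlim_add_const_nat_at_top[of k0]]]
    by simp
  obtain f where f: "f \<in> even_exp_type" "f 0 = 1" "half_line_int p a f \<le> liminf d"
    using extremal_polynomials_converge[OF p a _ fl q(1,2) bd lim] by auto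
  have eq: "limsup d = half_line_int p a f" "liminf d = half_line_int p a f"
    using f(3) up[OF f(1,2)] Liminf_le_Limsup[of sequentially d] by (auto intro!: antisym intro: order_trans)
  then have "d \<longlonglongrightarrow> half_line_int p a f" by (intro Liminf_eq_Limsup) auto
  then have L: "(\<lambda>n. scaled_arc_min p a n) \<longlonglongrightarrow> half_line_int p a f" unfolding d_def by (rule LIMSEQ_imp_Suc)
  have "ennreal (nikolskii_const p a) \<le> half_line_int p a f"
    using \<open>d \<longlonglongrightarrow> half_line_int p a f\<close> lo by (intro tendsto_lowerbound[of d]) auto
  then have pos: "0 < half_line_int p a f" using nikolskii_const_pos[of p a] by (metis ennreal_less_zero_iff less_le_trans)
  show ?thesis
    by (rule that[OF f(1,2) L pos]) (use li eq up in auto)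
qed

section \<open>Polar coordinates and rotations\<close>

lemma nn_integral_lborel_affine:
  fixes f :: "'a::euclidean_space \<Rightarrow> ennreal"
  assumes f: "f \<in> borel_measurable borel" and c: "c \<noteq> 0"
  shows "(\<integral>\<^sup>+x. f x \<partial>lborel) = ennreal (\<bar>c\<bar> ^ DIM('a)) * (\<integral>\<^sup>+x. f (t + c *\<^sub>R x) \<partial>lborel)"
proof -
  note [measurable] = f
  have "(\<integral>\<^sup>+x. f x \<partial>lborel) = (\<integral>\<^sup>+x. f x \<partial>density (distr lborel borel (\<lambda>x. t + c *\<^sub>R x)) (\<lambda>_. ennreal (\<bar>c\<bar> ^ DIM('a))))"
    using lborel_affine[OF c, of t] by simp
  also have "\<dots> = (\<integral>\<^sup>+x. ennreal (\<bar>c\<bar> ^ DIM('a)) * f (t + c *\<^sub>R x) \<partial>lborel)"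
    by (simp add: nn_integral_density nn_integral_distr)
  also have "\<dots> = ennreal (\<bar>c\<bar> ^ DIM('a)) * (\<integral>\<^sup>+x. f (t + c *\<^sub>R x) \<partial>lborel)"
    by (intro nn_integral_cmult) measurable
  finally show ?thesis .
qed

lemma nn_integral_lborel_shift:
  fixes f :: "'a::euclidean_space \<Rightarrow> ennreal"
  assumes "f \<in> borel_measurable borel"
  shows "(\<integral>\<^sup>+x. f (x + t) \<partial>lborel) = (\<integral>\<^sup>+x. f x \<partial>lborel)"
  using nn_integral_lborel_affine[OF assms, of 1 t] by (simp add: add.commute)

lemma nn_integral_lborel_uminus:
  fixes f :: "'a::euclidean_space \<Rightarrow> ennreal"
  assumes "f \<in> borel_measurable borel"
  shows "(\<integral>\<^sup>+x. f (- x) \<partial>lborel) = (\<integral>\<^sup>+x. f x \<partial>lborel)"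
  using nn_integral_lborel_affine[OF assms, of "-1" 0] by simp

lemma nn_integral_lborel_swap:
  fixes f :: "'a::euclidean_space \<Rightarrow> 'b::euclidean_space \<Rightarrow> ennreal"
  assumes "(\<lambda>(x, y). f x y) \<in> borel_measurable (lborel \<Otimes>\<^sub>M lborel)"
  shows "(\<integral>\<^sup>+x. \<integral>\<^sup>+y. f x y \<partial>lborel \<partial>lborel) = (\<integral>\<^sup>+y. \<integral>\<^sup>+x. f x y \<partial>lborel \<partial>lborel)"
  using lborel_pair.Fubini'[OF assms] by simp

lemma nn_integral_powr_tail:
  fixes b :: real
  assumes b: "b > 0" and n: "n > 0"
  shows "(\<integral>\<^sup>+s. ennreal (1 / s ^ (n + 1)) * indicator {b<..} s \<partial>lborel) = ennreal (1 / (real n * b ^ n))"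
proof -
  have "(\<integral>\<^sup>+s. ennreal (1 / s ^ (n + 1)) * indicator {b<..} s \<partial>lborel)
      = (\<integral>\<^sup>+s. ennreal (1 / s ^ (n + 1)) * indicator {b..} s \<partial>lborel)"
    by (intro nn_integral_cong_AE AE_I[where N = "{b}"]) (auto split: split_indicator)
  also have "\<dots> = ennreal (0 - (- (1 / (real n * b ^ n))))"
  proof (rule nn_integral_FTC_atLeast)
    show "DERIV (\<lambda>s. - (1 / (real n * s ^ n))) s :> 1 / s ^ (n + 1)" if "b \<le> s" for s
    proof -
      have "s > 0" using that b by simp
      then show ?thesis using n
        by (auto intro!: derivative_eq_intros simp: field_simps power_add[symmetric] power_eq_if[of s n])
    qed
    show "((\<lambda>s. - (1 / (real n * s ^ n))) \<longlongrightarrow> 0) at_top"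
    proof -
      have "((\<lambda>s::real. 1 / (real n * s ^ n)) \<longlongrightarrow> 0) at_top"
        using n by (intro tendsto_divide_0[OF tendsto_const] filterlim_at_top_imp_at_infinity
            filterlim_tendsto_pos_mult_at_top[OF tendsto_const] filterlim_pow_at_top filterlim_ident) auto
      then show ?thesis using tendsto_minus by fastforce
    qed
  qed (use b in auto)
  finally show ?thesis by simp
qed

text \<open>
  The directions \<open>w / |w|\<close> of the points \<open>w\<close> of the ball replace the surface measure of the sphere. The
  substitutions \<open>r = s |w|\<close> and \<open>v = s w\<close> reduce the claim to the integral of \<open>1 / s^(n+1)\<close> over
  \<open>s > |v|\<close>.
\<close>

lemma nn_integral_polar:
  fixes F :: "'a::euclidean_space \<Rightarrow> ennreal"
  assumes F[measurable]: "F \<in> borel_measurable borel"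
  shows "(\<integral>\<^sup>+t. F t \<partial>lborel) = of_nat DIM('a) *
    (\<integral>\<^sup>+w. indicator {w. 0 < norm w \<and> norm w < 1} w *
       (\<integral>\<^sup>+r. F ((r / norm w) *\<^sub>R w) * ennreal (r ^ (DIM('a) - 1)) * indicator {0<..} r \<partial>lborel) \<partial>lborel)"
proof -
  define n where "n = DIM('a)"
  have n: "n > 0" "n = Suc (n - 1)" by (auto simp: n_def)
  let ?B = "\<lambda>w::'a. indicator {w. 0 < norm w \<and> norm w < 1} w :: ennreal"
  have 1: "(\<integral>\<^sup>+r. F ((r / norm w) *\<^sub>R w) * ennreal (r ^ (n - 1)) * indicator {0<..} r \<partial>lborel)
      = (\<integral>\<^sup>+s. F (s *\<^sub>R w) * ennreal (s ^ (n - 1) * norm w ^ n) * indicator {0<..} s \<partial>lborel)"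
    if w: "0 < norm w" for w :: 'a
  proof -
    have "(\<integral>\<^sup>+r. F ((r / norm w) *\<^sub>R w) * ennreal (r ^ (n - 1)) * indicator {0<..} r \<partial>lborel)
      = ennreal \<bar>norm w\<bar> * (\<integral>\<^sup>+s. F (((0 + norm w * s) / norm w) *\<^sub>R w) * ennreal ((0 + norm w * s) ^ (n - 1)) * indicator {0<..} (0 + norm w * s) \<partial>lborel)"
      by (rule nn_integral_real_affine) (use w in auto)
    also have "\<dots> = (\<integral>\<^sup>+s. ennreal (norm w) * (F (((0 + norm w * s) / norm w) *\<^sub>R w) * ennreal ((0 + norm w * s) ^ (n - 1)) * indicator {0<..} (0 + norm w * s)) \<partial>lborel)"
      by (subst nn_integral_cmult) auto
    also have "\<dots> = (\<integral>\<^sup>+s. F (s *\<^sub>R w) * ennreal (s ^ (n - 1) * norm w ^ n) * indicator {0<..} s \<partial>lborel)"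
    proof (intro nn_integral_cong)
      fix s :: real
      have "norm w ^ n = norm w * norm w ^ (n - 1)" using n by (metis power_Suc)
      then show "ennreal (norm w) * (F (((0 + norm w * s) / norm w) *\<^sub>R w) * ennreal ((0 + norm w * s) ^ (n - 1)) * indicator {0<..} (0 + norm w * s))
        = F (s *\<^sub>R w) * ennreal (s ^ (n - 1) * norm w ^ n) * indicator {0<..} s"
        using w by (cases "s > 0")
          (auto simp: zero_less_mult_iff power_mult_distrib ennreal_mult' mult_ac split: split_indicator)
    qed
    finally show ?thesis .
  qed
  have "(\<integral>\<^sup>+w. ?B w * (\<integral>\<^sup>+r. F ((r / norm w) *\<^sub>R w) * ennreal (r ^ (n - 1)) * indicator {0<..} r \<partial>lborel) \<partial>lborel)
      = (\<integral>\<^sup>+w. ?B w * (\<integral>\<^sup>+s. F (s *\<^sub>R w) * ennreal (s ^ (n - 1) * norm w ^ n) * indicator {0<..} s \<partial>lborel) \<partial>lborel)"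
  proof (intro nn_integral_cong)
    fix w :: 'a
    show "?B w * (\<integral>\<^sup>+r. F ((r / norm w) *\<^sub>R w) * ennreal (r ^ (n - 1)) * indicator {0<..} r \<partial>lborel)
      = ?B w * (\<integral>\<^sup>+s. F (s *\<^sub>R w) * ennreal (s ^ (n - 1) * norm w ^ n) * indicator {0<..} s \<partial>lborel)"
    proof (cases "0 < norm w")
      case True
      then show ?thesis by (simp only: 1)
    qed simp
  qed
  also have "\<dots> = (\<integral>\<^sup>+w. (\<integral>\<^sup>+s. ?B w * (F (s *\<^sub>R w) * ennreal (s ^ (n - 1) * norm w ^ n) * indicator {0<..} s) \<partial>lborel) \<partial>lborel)"
    by (intro nn_integral_cong nn_integral_cmult[symmetric]) measurable
  also have "\<dots> = (\<integral>\<^sup>+s. (\<integral>\<^sup>+w. ?B w * (F (s *\<^sub>R w) * ennreal (s ^ (n - 1) * norm w ^ n) * indicator {0<..} s) \<partial>lborel) \<partial>lborel)"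
    by (rule nn_integral_lborel_swap) measurable
  also have "\<dots> = (\<integral>\<^sup>+s. (\<integral>\<^sup>+v. (F v * ennreal (norm v ^ n)) * (ennreal (1 / s ^ (n + 1)) * indicator {0<..} s * indicator {v. 0 < norm v \<and> norm v < s} v) \<partial>lborel) \<partial>lborel)"
  proof (rule nn_integral_cong)
    fix s :: real
    show "(\<integral>\<^sup>+w. ?B w * (F (s *\<^sub>R w) * ennreal (s ^ (n - 1) * norm w ^ n) * indicator {0<..} s) \<partial>lborel)
      = (\<integral>\<^sup>+v. (F v * ennreal (norm v ^ n)) * (ennreal (1 / s ^ (n + 1)) * indicator {0<..} s * indicator {v. 0 < norm v \<and> norm v < s} v) \<partial>lborel)"
    proof (cases "s > 0")
      case True
      have "(\<integral>\<^sup>+v. (F v * ennreal (norm v ^ n)) * (ennreal (1 / s ^ (n + 1)) * indicator {0<..} s * indicator {v. 0 < norm v \<and> norm v < s} v) \<partial>lborel)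
        = ennreal (\<bar>s\<bar> ^ DIM('a)) * (\<integral>\<^sup>+w. (F (0 + s *\<^sub>R w) * ennreal (norm (0 + s *\<^sub>R w) ^ n)) * (ennreal (1 / s ^ (n + 1)) * indicator {0<..} s * indicator {v. 0 < norm v \<and> norm v < s} (0 + s *\<^sub>R w)) \<partial>lborel)"
        by (rule nn_integral_lborel_affine) (use True in auto)
      also have "\<dots> = (\<integral>\<^sup>+w. ennreal (s ^ n) * ((F (0 + s *\<^sub>R w) * ennreal (norm (0 + s *\<^sub>R w) ^ n)) * (ennreal (1 / s ^ (n + 1)) * indicator {0<..} s * indicator {v. 0 < norm v \<and> norm v < s} (0 + s *\<^sub>R w))) \<partial>lborel)"
        using True by (subst nn_integral_cmult) (auto simp: n_def)
      also have "\<dots> = (\<integral>\<^sup>+w. ?B w * (F (s *\<^sub>R w) * ennreal (s ^ (n - 1) * norm w ^ n) * indicator {0<..} s) \<partial>lborel)"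
      proof (intro nn_integral_cong)
        fix w :: 'a
        have e: "s ^ (n - 1) * norm w ^ n = s ^ n * ((s * norm w) ^ n * (1 / s ^ (n + 1)))"
        proof -
          have "s ^ n = s * s ^ (n - 1)" using n by (metis power_Suc)
          then show ?thesis using True by (simp add: power_mult_distrib field_simps)
        qed
        have i: "indicator {v. 0 < norm v \<and> norm v < s} (0 + s *\<^sub>R w) = ?B w"
          using True by (auto simp: zero_less_mult_iff mult_less_cancel_left2 split: split_indicator)
        show "ennreal (s ^ n) * ((F (0 + s *\<^sub>R w) * ennreal (norm (0 + s *\<^sub>R w) ^ n)) * (ennreal (1 / s ^ (n + 1)) * indicator {0<..} s * indicator {v. 0 < norm v \<and> norm v < s} (0 + s *\<^sub>R w)))
         = ?B w * (F (s *\<^sub>R w) * ennreal (s ^ (n - 1) * norm w ^ n) * indicator {0<..} s)"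
        proof -
          have tri: "ennreal (a * (b * c)) = ennreal a * (ennreal b * ennreal c)" if "a \<ge> 0" "b \<ge> 0" "c \<ge> 0" for a b c
            using that by (simp add: ennreal_mult)
          have xy: "ennreal (s ^ n * ((s * norm w) ^ n * (1 / s ^ (n + 1)))) = ennreal (s ^ n) * (ennreal ((s * norm w) ^ n) * ennreal (1 / s ^ (n + 1)))"
            by (rule tri) (use True in auto)
          have nm: "norm (0 + s *\<^sub>R w) = s * norm w" using True by simp
          have one: "indicator {0<..} s = (1::ennreal)" using True by simp
          show "ennreal (s ^ n) * ((F (0 + s *\<^sub>R w) * ennreal (norm (0 + s *\<^sub>R w) ^ n)) * (ennreal (1 / s ^ (n + 1)) * indicator {0<..} s * indicator {v. 0 < norm v \<and> norm v < s} (0 + s *\<^sub>R w)))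
            = ?B w * (F (s *\<^sub>R w) * ennreal (s ^ (n - 1) * norm w ^ n) * indicator {0<..} s)"
            unfolding i e xy nm one by (simp only: add_0_left mult_1_right mult_ac)
        qed
      qed
      finally show ?thesis by simp
    qed simp
  qed
  also have "\<dots> = (\<integral>\<^sup>+v. (\<integral>\<^sup>+s. (F v * ennreal (norm v ^ n)) * (ennreal (1 / s ^ (n + 1)) * indicator {0<..} s * indicator {v. 0 < norm v \<and> norm v < s} v) \<partial>lborel) \<partial>lborel)"
    by (rule nn_integral_lborel_swap) measurable
  also have "\<dots> = (\<integral>\<^sup>+v. ennreal (1 / real n) * F v \<partial>lborel)"
  \<comment> \<open>the origin lies in none of the dilated punctured balls\<close>
  proof (intro nn_integral_cong_AE AE_I[where N = "{0}"])
    have "(\<integral>\<^sup>+s. (F v * ennreal (norm v ^ n)) * (ennreal (1 / s ^ (n + 1)) * indicator {0<..} s * indicator {v. 0 < norm v \<and> norm v < s} v) \<partial>lborel) = ennreal (1 / real n) * F v"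
      if v: "v \<noteq> 0" for v :: 'a
    proof -
      have "(\<integral>\<^sup>+s. (F v * ennreal (norm v ^ n)) * (ennreal (1 / s ^ (n + 1)) * indicator {0<..} s * indicator {v. 0 < norm v \<and> norm v < s} v) \<partial>lborel)
        = (\<integral>\<^sup>+s. (F v * ennreal (norm v ^ n)) * (ennreal (1 / s ^ (n + 1)) * indicator {norm v<..} s) \<partial>lborel)"
        using v by (intro nn_integral_cong) (auto split: split_indicator intro: order.strict_trans[of 0 "norm v"])
      also have "\<dots> = (F v * ennreal (norm v ^ n)) * ennreal (1 / (real n * norm v ^ n))"
      proof -
        have "(\<integral>\<^sup>+s. (F v * ennreal (norm v ^ n)) * (ennreal (1 / s ^ (n + 1)) * indicator {norm v<..} s) \<partial>lborel)
          = (F v * ennreal (norm v ^ n)) * (\<integral>\<^sup>+s. ennreal (1 / s ^ (n + 1)) * indicator {norm v<..} s \<partial>lborel)"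
          by (intro nn_integral_cmult) measurable
        then show ?thesis using nn_integral_powr_tail[of "norm v" n] v n by simp
      qed
      also have "\<dots> = F v * ennreal (norm v ^ n * (1 / (real n * norm v ^ n)))"
        by (simp add: mult.assoc ennreal_mult'[symmetric])
      also have "norm v ^ n * (1 / (real n * norm v ^ n)) = 1 / real n" using v by simp
      finally show ?thesis by (simp add: mult.commute)
    qed
    then show "{v \<in> space lborel. (\<integral>\<^sup>+s. (F v * ennreal (norm v ^ n)) * (ennreal (1 / s ^ (n + 1)) * indicator {0<..} s * indicator {v. 0 < norm v \<and> norm v < s} v) \<partial>lborel) \<noteq> ennreal (1 / real n) * F v} \<subseteq> {0}"
      by blast
  qed auto
  also have "\<dots> = ennreal (1 / real n) * (\<integral>\<^sup>+v. F v \<partial>lborel)" by (intro nn_integral_cmult) measurable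
  finally have fin: "(\<integral>\<^sup>+w. ?B w * (\<integral>\<^sup>+r. F ((r / norm w) *\<^sub>R w) * ennreal (r ^ (n - 1)) * indicator {0<..} r \<partial>lborel) \<partial>lborel)
     = ennreal (1 / real n) * (\<integral>\<^sup>+v. F v \<partial>lborel)" .
  have "of_nat n * ennreal (1 / real n) = ennreal (real n * (1 / real n))"
    unfolding ennreal_of_nat_eq_real_of_nat by (rule ennreal_mult'[symmetric]) simp
  also have "\<dots> = 1" using n by simp
  finally have one: "of_nat n * ennreal (1 / real n) = 1" .
  show ?thesis unfolding n_def[symmetric] fin mult.assoc[symmetric] one by simp
qed

lemma emeasure_punctured_ball:
  "emeasure lborel {w::'a::euclidean_space. 0 < norm w \<and> norm w < 1} = ennreal (unit_ball_vol DIM('a))"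
proof -
  have "emeasure lborel {w::'a. 0 < norm w \<and> norm w < 1} = emeasure lborel (ball 0 1 - {0} :: 'a set)"
    by (rule arg_cong[where f = "emeasure lborel"]) auto
  also have "\<dots> = emeasure lborel (ball 0 1 :: 'a set)"
    by (rule emeasure_Diff_null_set) auto
  finally show ?thesis by (simp add: emeasure_ball)
qed

lemma nn_integral_radial:
  fixes F :: "real \<Rightarrow> ennreal"
  assumes F[measurable]: "F \<in> borel_measurable borel"
  shows "(\<integral>\<^sup>+t. F (norm (t::'a::euclidean_space)) \<partial>lborel) = ennreal (DIM('a) * unit_ball_vol DIM('a)) *
     (\<integral>\<^sup>+r. F r * ennreal (r ^ (DIM('a) - 1)) * indicator {0<..} r \<partial>lborel)"
proof -
  let ?I = "\<integral>\<^sup>+r. F r * ennreal (r ^ (DIM('a) - 1)) * indicator {0<..} r \<partial>lborel"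
  have "(\<integral>\<^sup>+t. F (norm (t::'a)) \<partial>lborel) = of_nat DIM('a) *
    (\<integral>\<^sup>+w. indicator {w::'a. 0 < norm w \<and> norm w < 1} w *
       (\<integral>\<^sup>+r. F (norm ((r / norm w) *\<^sub>R w)) * ennreal (r ^ (DIM('a) - 1)) * indicator {0<..} r \<partial>lborel) \<partial>lborel)"
    by (rule nn_integral_polar) measurable
  also have "(\<integral>\<^sup>+w. indicator {w::'a. 0 < norm w \<and> norm w < 1} w *
       (\<integral>\<^sup>+r. F (norm ((r / norm w) *\<^sub>R w)) * ennreal (r ^ (DIM('a) - 1)) * indicator {0<..} r \<partial>lborel) \<partial>lborel)
     = (\<integral>\<^sup>+w. ?I * indicator {w::'a. 0 < norm w \<and> norm w < 1} w \<partial>lborel)"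
  proof (intro nn_integral_cong)
    fix w :: 'a
    show "indicator {w::'a. 0 < norm w \<and> norm w < 1} w *
       (\<integral>\<^sup>+r. F (norm ((r / norm w) *\<^sub>R w)) * ennreal (r ^ (DIM('a) - 1)) * indicator {0<..} r \<partial>lborel)
      = ?I * indicator {w::'a. 0 < norm w \<and> norm w < 1} w"
    proof (cases "0 < norm w \<and> norm w < 1")
      case True
      have "(\<integral>\<^sup>+r. F (norm ((r / norm w) *\<^sub>R w)) * ennreal (r ^ (DIM('a) - 1)) * indicator {0<..} r \<partial>lborel) = ?I"
        using True by (intro nn_integral_cong) (auto split: split_indicator)
      then show ?thesis using True by simp
    qed simp
  qed
  also have "\<dots> = ?I * ennreal (unit_ball_vol DIM('a))"
  proof -
    have "{w::'a. 0 < norm w \<and> norm w < 1} \<in> sets lborel" by measurable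
    from nn_integral_cmult_indicator[OF this] show ?thesis unfolding emeasure_punctured_ball .
  qed
  finally show ?thesis
    by (simp add: ennreal_mult' ennreal_of_nat_eq_real_of_nat[symmetric] mult_ac)
qed

text \<open>
  Invariance under shears is translation invariance and Fubini's theorem. Rotations of a coordinate
  plane are products of three shears.
\<close>

lemma nn_integral_shear_fst:
  fixes H :: "real \<Rightarrow> 'a::euclidean_space \<Rightarrow> ennreal"
  assumes [measurable]: "(\<lambda>(u, v). H u v) \<in> borel_measurable (borel \<Otimes>\<^sub>M borel)"
  shows "(\<integral>\<^sup>+u. \<integral>\<^sup>+v. H (u + t * (v \<bullet> e)) v \<partial>lborel \<partial>lborel) = (\<integral>\<^sup>+u. \<integral>\<^sup>+v. H u v \<partial>lborel \<partial>lborel)"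
proof -
  have "(\<integral>\<^sup>+u. \<integral>\<^sup>+v. H (u + t * (v \<bullet> e)) v \<partial>lborel \<partial>lborel) = (\<integral>\<^sup>+v. \<integral>\<^sup>+u. H (u + t * (v \<bullet> e)) v \<partial>lborel \<partial>lborel)"
    by (rule nn_integral_lborel_swap) measurable
  also have "\<dots> = (\<integral>\<^sup>+v. \<integral>\<^sup>+u. H u v \<partial>lborel \<partial>lborel)"
    by (intro nn_integral_cong nn_integral_lborel_shift) measurable
  also have "\<dots> = (\<integral>\<^sup>+u. \<integral>\<^sup>+v. H u v \<partial>lborel \<partial>lborel)"
    by (rule nn_integral_lborel_swap) measurable
  finally show ?thesis .
qed

lemma nn_integral_shear_snd:
  fixes H :: "real \<Rightarrow> 'a::euclidean_space \<Rightarrow> ennreal"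
  assumes [measurable]: "(\<lambda>(u, v). H u v) \<in> borel_measurable (borel \<Otimes>\<^sub>M borel)"
  shows "(\<integral>\<^sup>+u. \<integral>\<^sup>+v. H u (v + (s * u) *\<^sub>R e) \<partial>lborel \<partial>lborel) = (\<integral>\<^sup>+u. \<integral>\<^sup>+v. H u v \<partial>lborel \<partial>lborel)"
  by (intro nn_integral_cong nn_integral_lborel_shift) measurable

text \<open>
  In the product of the line and \<open>'a\<close> consider the unit vector \<open>(sqrt (1 - r^2), r e)\<close> and the rotation that
  takes the first axis to it. The rotation maps the point \<open>(0, w)\<close> to a point whose second component is
  \<open>squeeze r e w\<close>.
\<close>

definition squeeze :: "real \<Rightarrow> 'a::real_inner \<Rightarrow> 'a \<Rightarrow> 'a" where
  "squeeze r e w = w + ((sqrt (1 - r\<^sup>2) - 1) * (w \<bullet> e)) *\<^sub>R e"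

text \<open>
  The rotation in the plane of the first axis and \<open>e\<close> by the angle with sine \<open>r\<close>, written with shears of
  parameters \<open>- t\<close>, \<open>r\<close>, \<open>- t\<close>, where \<open>t\<close> is the tangent of half of the angle.
\<close>

lemma nn_integral_rotation:
  fixes H :: "real \<Rightarrow> 'a::euclidean_space \<Rightarrow> ennreal"
  assumes [measurable]: "(\<lambda>(u, v). H u v) \<in> borel_measurable (borel \<Otimes>\<^sub>M borel)"
    and e: "norm e = 1" and r: "0 \<le> r" "r \<le> 1"
  shows "(\<integral>\<^sup>+u. \<integral>\<^sup>+v. H (sqrt (1 - r\<^sup>2) * u - r * (v \<bullet> e)) ((u * r) *\<^sub>R e + squeeze r e v) \<partial>lborel \<partial>lborel)
     = (\<integral>\<^sup>+u. \<integral>\<^sup>+v. H u v \<partial>lborel \<partial>lborel)"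
proof -
  define c where "c = sqrt (1 - r\<^sup>2)"
  have c: "c \<ge> 0" "c\<^sup>2 = 1 - r\<^sup>2" using r by (auto simp: c_def power_le_one)
  define t where "t = r / (1 + c)"
  \<comment> \<open>the two half-angle identities that make the product of the shears a rotation\<close>
  have tr: "1 - t * r = c"
  proof -
    have "t * r = (1 - c\<^sup>2) / (1 + c)" using c by (simp add: t_def power2_eq_square)
    also have "1 - c\<^sup>2 = (1 - c) * (1 + c)" by (simp add: power2_eq_square algebra_simps)
    finally show ?thesis using c by simp
  qed
  have tc: "t * (1 + c) = r" using c by (simp add: t_def)
  have ee: "e \<bullet> e = 1" using e by (simp add: dot_square_norm)
  define H1 where "H1 u v = H (u + - t * (v \<bullet> e)) v" for u v
  have [measurable]: "(\<lambda>(u, v). H1 u v) \<in> borel_measurable (borel \<Otimes>\<^sub>M borel)" unfolding H1_def by measurable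
  define H2 where "H2 u v = H1 u (v + (r * u) *\<^sub>R e)" for u v
  have [measurable]: "(\<lambda>(u, v). H2 u v) \<in> borel_measurable (borel \<Otimes>\<^sub>M borel)" unfolding H2_def by measurable
  have "H2 (u + - t * (v \<bullet> e)) v = H (c * u - r * (v \<bullet> e)) ((u * r) *\<^sub>R e + squeeze r e v)" for u v
  proof -
    define w where "w = v \<bullet> e"
    have a: "u - t * w - t * (w + r * (u - t * w)) = c * u - r * w"
    proof -
      have "u - t * w - t * (w + r * (u - t * w)) = (1 - t * r) * u - t * (1 + (1 - t * r)) * w" by (simp add: algebra_simps)
      then show ?thesis unfolding tr tc .
    qed
    have b: "r * (u - t * w) = u * r + (c - 1) * w"
    proof -
      have tr': "t * r = 1 - c" using tr by simp
      have "r * (u - t * w) = u * r - (t * r) * w" by (simp add: algebra_simps)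
      also have "\<dots> = u * r + (c - 1) * w" unfolding tr' by (simp add: algebra_simps)
      finally show ?thesis .
    qed
    show ?thesis
      unfolding H2_def H1_def squeeze_def c_def[symmetric] w_def[symmetric]
      using a b by (simp add: inner_add_left ee w_def[symmetric] scaleR_add_left[symmetric] add_ac)
  qed
  then have "(\<integral>\<^sup>+u. \<integral>\<^sup>+v. H (c * u - r * (v \<bullet> e)) ((u * r) *\<^sub>R e + squeeze r e v) \<partial>lborel \<partial>lborel)
     = (\<integral>\<^sup>+u. \<integral>\<^sup>+v. H2 (u + - t * (v \<bullet> e)) v \<partial>lborel \<partial>lborel)" by simp
  also have "\<dots> = (\<integral>\<^sup>+u. \<integral>\<^sup>+v. H2 u v \<partial>lborel \<partial>lborel)" by (rule nn_integral_shear_fst) measurable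
  also have "\<dots> = (\<integral>\<^sup>+u. \<integral>\<^sup>+v. H1 u v \<partial>lborel \<partial>lborel)" unfolding H2_def by (rule nn_integral_shear_snd) measurable
  also have "\<dots> = (\<integral>\<^sup>+u. \<integral>\<^sup>+v. H u v \<partial>lborel \<partial>lborel)" unfolding H1_def by (rule nn_integral_shear_fst) measurable
  finally show ?thesis unfolding c_def .
qed

lemma norm_rotation:
  fixes v e :: "'a::real_inner"
  assumes e: "norm e = 1" and r: "0 \<le> r" "r \<le> 1"
  shows "(sqrt (1 - r\<^sup>2) * u - r * (v \<bullet> e))\<^sup>2 + (norm ((u * r) *\<^sub>R e + squeeze r e v))\<^sup>2 = u\<^sup>2 + (norm v)\<^sup>2"
proof -
  define c where "c = sqrt (1 - r\<^sup>2)"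
  have c: "c\<^sup>2 = 1 - r\<^sup>2" using r by (auto simp: c_def power_le_one)
  define w where "w = v \<bullet> e"
  have ee: "e \<bullet> e = 1" using e by (simp add: dot_square_norm)
  define k where "k = u * r + (c - 1) * w"
  have 1: "(u * r) *\<^sub>R e + squeeze r e v = v + k *\<^sub>R e"
    by (simp add: squeeze_def c_def[symmetric] w_def[symmetric] k_def scaleR_add_left[symmetric] add_ac)
  have "(norm (v + k *\<^sub>R e))\<^sup>2 = (norm v)\<^sup>2 + 2 * k * w + k\<^sup>2"
    unfolding power2_norm_eq_inner unfolding w_def power2_eq_square
    by (simp only: inner_add_left inner_add_right inner_scaleR_left inner_scaleR_right ee inner_commute[of e v]) (simp add: algebra_simps)
  moreover have "(c * u - r * w)\<^sup>2 + (2 * k * w + k\<^sup>2) = (c\<^sup>2 + r\<^sup>2) * u\<^sup>2 + (c\<^sup>2 + r\<^sup>2 - 1) * w\<^sup>2"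
    by (simp add: k_def power2_eq_square algebra_simps)
  ultimately show ?thesis unfolding 1 c_def[symmetric] w_def[symmetric] using c by simp
qed

text \<open>
  The substitution \<open>t = r^2\<close> in Euler's integral.
\<close>

lemma Beta_nn_integral_square:
  assumes x: "x > 0" and l: "l > (0::real)"
  shows "(\<integral>\<^sup>+r. ennreal (r powr (2 * x - 1) * (1 - r\<^sup>2) powr (l - 1)) * indicator {0<..<1} r \<partial>lborel) = ennreal (Beta x l / 2)"
proof -
  define f where "f t = t powr (x - 1) * (1 - t) powr (l - 1)" for t :: real
  have [measurable]: "f \<in> borel_measurable borel" unfolding f_def by measurable
  have "(\<integral>\<^sup>+t. f t * indicator {0..1} t \<partial>lborel) = ennreal (Beta x l)"
  proof -
    have "(f has_integral Beta x l) {0..1}" using has_integral_Beta_real[OF x l] by (simp add: f_def[abs_def])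
    then have "(\<integral>\<^sup>+t. ennreal (f t) * indicator {0..1} t \<partial>lborel) = ennreal (Beta x l)"
      by (rule nn_integral_has_integral_lebesgue'[rotated]) (simp add: f_def)
    moreover have "(\<integral>\<^sup>+t. ennreal (f t * indicator {0..1} t) \<partial>lborel) = (\<integral>\<^sup>+t. ennreal (f t) * indicator {0..1} t \<partial>lborel)"
      by (intro nn_integral_cong) (auto split: split_indicator)
    ultimately show ?thesis by simp
  qed
  moreover have "(\<integral>\<^sup>+t. f t * indicator {0\<^sup>2..1\<^sup>2} t \<partial>lborel) = (\<integral>\<^sup>+r. f (r\<^sup>2) * (2 * r) * indicator {0..1} r \<partial>lborel)"
    by (intro nn_integral_substitution) (auto intro!: derivative_eq_intros continuous_intros simp: set_borel_measurable_def)
  ultimately have "ennreal (Beta x l) = (\<integral>\<^sup>+r. f (r\<^sup>2) * (2 * r) * indicator {0..1} r \<partial>lborel)" by simp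
  also have "\<dots> = (\<integral>\<^sup>+r. ennreal 2 * (ennreal (r powr (2 * x - 1) * (1 - r\<^sup>2) powr (l - 1)) * indicator {0<..<1} r) \<partial>lborel)"
  proof (intro nn_integral_cong_AE AE_I[where N = "{0, 1}"])
    have "ennreal (f (r\<^sup>2) * (2 * r) * indicator {0..1} r) = ennreal 2 * (ennreal (r powr (2 * x - 1) * (1 - r\<^sup>2) powr (l - 1)) * indicator {0<..<1} r)"
      if r: "r \<notin> {0, 1}" for r
    proof (cases "0 < r \<and> r < 1")
      case True
      have "(r\<^sup>2) powr (x - 1) * r = r powr (2 * x - 1)"
      proof -
        have "(r\<^sup>2) powr (x - 1) = r powr (2 * x - 2)" using True by (simp add: powr_powr[symmetric] powr_numeral[symmetric] powr_powr algebra_simps del: powr_numeral)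
        moreover have "r powr ((2 * x - 2) + 1) = r powr (2 * x - 2) * r powr 1" by (rule powr_add)
        ultimately show ?thesis using True by simp
      qed
      then have A: "f (r\<^sup>2) * (2 * r) = 2 * (r powr (2 * x - 1) * (1 - r\<^sup>2) powr (l - 1))" by (simp add: f_def mult_ac)
      have B: "ennreal (2 * (r powr (2 * x - 1) * (1 - r\<^sup>2) powr (l - 1))) = ennreal 2 * ennreal (r powr (2 * x - 1) * (1 - r\<^sup>2) powr (l - 1))"
        by (rule ennreal_mult) auto
      have i: "indicator {0..1} r = (1::real)" "indicator {0<..<1} r = (1::ennreal)" using True by auto
      show ?thesis unfolding i mult_1_right A B ..
    qed (use r in auto)
    then show "{r \<in> space lborel. ennreal (f (r\<^sup>2) * (2 * r) * indicator {0..1} r) \<noteq> ennreal 2 * (ennreal (r powr (2 * x - 1) * (1 - r\<^sup>2) powr (l - 1)) * indicator {0<..<1} r)} \<subseteq> {0, 1}" by blast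
  qed (auto intro!: emeasure_lborel_countable)
  also have "\<dots> = ennreal 2 * (\<integral>\<^sup>+r. ennreal (r powr (2 * x - 1) * (1 - r\<^sup>2) powr (l - 1)) * indicator {0<..<1} r \<partial>lborel)"
    by (intro nn_integral_cmult) measurable
  finally have eq: "ennreal 2 * (\<integral>\<^sup>+r. ennreal (r powr (2 * x - 1) * (1 - r\<^sup>2) powr (l - 1)) * indicator {0<..<1} r \<partial>lborel) = ennreal (Beta x l)" ..
  let ?I = "\<integral>\<^sup>+r. ennreal (r powr (2 * x - 1) * (1 - r\<^sup>2) powr (l - 1)) * indicator {0<..<1} r \<partial>lborel"
  have half: "ennreal (1 / 2) * ennreal 2 = 1" by (subst ennreal_mult'[symmetric]) auto
  have "?I = ennreal (1 / 2) * (ennreal 2 * ?I)" unfolding mult.assoc[symmetric] half by simp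
  also have "\<dots> = ennreal (1 / 2 * Beta x l)" unfolding eq by (rule ennreal_mult'[symmetric]) simp
  finally show ?thesis by simp
qed

section \<open>Slices of the ball\<close>

text \<open>
  The total mass of the weight \<open>(1 - |w|^2)\<close> to the power \<open>l - 1\<close> on the unit ball of dimension \<open>m\<close>, divided
  by its mass \<open>Beta (1/2) l\<close> on the unit interval of the line. The quotient extends continuously to \<open>l = 0\<close>.
\<close>

definition ball_const :: "real \<Rightarrow> real \<Rightarrow> real" where
  "ball_const m l = pi powr ((m - 1) / 2) * Gamma (l + 1/2) / Gamma (l + m / 2)"

text \<open>
  The argument \<open>s\<close> is the square of a norm.
\<close>

definition beta_weight :: "real \<Rightarrow> real \<Rightarrow> ennreal" where
  "beta_weight l s = ennreal ((1 - s) powr (l - 1)) * indicator {..<1} s"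

lemma beta_weight_measurable [measurable]: "beta_weight l \<in> borel_measurable borel"
  unfolding beta_weight_def[abs_def] by measurable

lemma beta_weight_integral_line:
  assumes l: "l > 0"
  shows "(\<integral>\<^sup>+t. beta_weight l (t\<^sup>2) \<partial>lborel) = ennreal (Beta (1/2) l)"
proof -
  have "(\<integral>\<^sup>+t. beta_weight l ((norm (t::real))\<^sup>2) \<partial>lborel) = ennreal (DIM(real) * unit_ball_vol DIM(real)) *
     (\<integral>\<^sup>+r. beta_weight l (r\<^sup>2) * ennreal (r ^ (DIM(real) - 1)) * indicator {0<..} r \<partial>lborel)"
    by (rule nn_integral_radial) measurable
  also have "(\<integral>\<^sup>+r. beta_weight l (r\<^sup>2) * ennreal (r ^ (DIM(real) - 1)) * indicator {0<..} r \<partial>lborel)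
     = (\<integral>\<^sup>+r. ennreal (r powr (2 * (1/2) - 1) * (1 - r\<^sup>2) powr (l - 1)) * indicator {0<..<1} r \<partial>lborel)"
    by (intro nn_integral_cong) (auto simp: beta_weight_def abs_square_less_1 split: split_indicator)
  also have "\<dots> = ennreal (Beta (1/2) l / 2)" by (rule Beta_nn_integral_square) (use l in auto)
  finally have "(\<integral>\<^sup>+t. beta_weight l ((norm (t::real))\<^sup>2) \<partial>lborel) = ennreal 2 * ennreal (Beta (1/2) l / 2)" by simp
  also have "\<dots> = ennreal (2 * (Beta (1/2) l / 2))" by (rule ennreal_mult'[symmetric]) simp
  finally have "(\<integral>\<^sup>+t. beta_weight l ((norm (t::real))\<^sup>2) \<partial>lborel) = ennreal (2 * (Beta (1/2) l / 2))" .
  then show ?thesis by simp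
qed

lemma beta_weight_integral_shifted:
  assumes l: "l > 0" and s: "s \<ge> 0"
  shows "(\<integral>\<^sup>+u. beta_weight l (u\<^sup>2 + s) \<partial>lborel) = ennreal (Beta (1/2) l) * (ennreal ((1 - s) powr (l - 1/2)) * indicator {..<1} s)"
proof (cases "s < 1")
  case True
  define b where "b = sqrt (1 - s)"
  have b: "b > 0" "b\<^sup>2 = 1 - s" using True by (auto simp: b_def)
  have "(\<integral>\<^sup>+u. beta_weight l (u\<^sup>2 + s) \<partial>lborel) = ennreal \<bar>b\<bar> * (\<integral>\<^sup>+t. beta_weight l ((0 + b * t)\<^sup>2 + s) \<partial>lborel)"
    by (rule nn_integral_real_affine) (use b in auto)
  also have "(\<integral>\<^sup>+t. beta_weight l ((0 + b * t)\<^sup>2 + s) \<partial>lborel) = (\<integral>\<^sup>+t. ennreal ((1 - s) powr (l - 1)) * beta_weight l (t\<^sup>2) \<partial>lborel)"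
  proof (intro nn_integral_cong)
    fix t :: real
    have e: "1 - ((0 + b * t)\<^sup>2 + s) = (1 - s) * (1 - t\<^sup>2)"
      unfolding add_0_left power_mult_distrib b(2) by (simp add: algebra_simps)
    have i: "(0 + b * t)\<^sup>2 + s < 1 \<longleftrightarrow> t\<^sup>2 < 1"
      using e True by (smt (verit) zero_less_mult_iff)
    show "beta_weight l ((0 + b * t)\<^sup>2 + s) = ennreal ((1 - s) powr (l - 1)) * beta_weight l (t\<^sup>2)"
    proof (cases "t\<^sup>2 < 1")
      case True
      have "((1 - s) * (1 - t\<^sup>2)) powr (l - 1) = (1 - s) powr (l - 1) * (1 - t\<^sup>2) powr (l - 1)"
        using True \<open>s < 1\<close> by (simp add: powr_mult)
      then show ?thesis unfolding beta_weight_def e using i True by (simp add: ennreal_mult')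
    next
      case False
      then show ?thesis unfolding beta_weight_def using i by simp
    qed
  qed
  also have "\<dots> = ennreal ((1 - s) powr (l - 1)) * ennreal (Beta (1/2) l)"
    using beta_weight_integral_line[OF l] by (subst nn_integral_cmult) auto
  also have "ennreal \<bar>b\<bar> * (ennreal ((1 - s) powr (l - 1)) * ennreal (Beta (1/2) l)) = ennreal (Beta (1/2) l) * ennreal (b * (1 - s) powr (l - 1))"
    using b by (simp add: ennreal_mult' mult_ac)
  also have "b * (1 - s) powr (l - 1) = (1 - s) powr (l - 1/2)"
  proof -
    have "b = (1 - s) powr (1/2)" using True by (simp add: b_def powr_half_sqrt)
    then have "b * (1 - s) powr (l - 1) = (1 - s) powr (1/2 + (l - 1))" by (simp only: powr_add)
    then show ?thesis by simp
  qed
  finally show ?thesis using True by simp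
next
  case False
  then have "beta_weight l (u\<^sup>2 + s) = 0" for u 
  proof -
    have "\<not> u\<^sup>2 + s < 1" using False zero_le_power2[of u] by linarith
    then show ?thesis by (simp add: beta_weight_def)
  qed
  then show ?thesis using False by simp
qed

lemma beta_weight_integral_ball:
  assumes l: "l > 0"
  shows "(\<integral>\<^sup>+w. beta_weight l ((norm (w::'a::euclidean_space))\<^sup>2) \<partial>lborel)
    = ennreal (ball_const DIM('a) l * Beta (1/2) l)"
proof -
  define n where "n = DIM('a)"
  have n: "n > 0" by (simp add: n_def)
  have "(\<integral>\<^sup>+w. beta_weight l ((norm (w::'a))\<^sup>2) \<partial>lborel) = ennreal (n * unit_ball_vol n) *
     (\<integral>\<^sup>+r. beta_weight l (r\<^sup>2) * ennreal (r ^ (n - 1)) * indicator {0<..} r \<partial>lborel)"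
    unfolding n_def by (rule nn_integral_radial) measurable
  also have "(\<integral>\<^sup>+r. beta_weight l (r\<^sup>2) * ennreal (r ^ (n - 1)) * indicator {0<..} r \<partial>lborel)
     = (\<integral>\<^sup>+r. ennreal (r powr (2 * (real n/2) - 1) * (1 - r\<^sup>2) powr (l - 1)) * indicator {0<..<1} r \<partial>lborel)"
  proof (intro nn_integral_cong)
    fix r :: real
    have "r ^ (n - 1) = r powr (2 * (real n/2) - 1)" if "r > 0"
      using that n by (simp add: powr_realpow[symmetric] of_nat_diff)
    then show "beta_weight l (r\<^sup>2) * ennreal (r ^ (n - 1)) * indicator {0<..} r = ennreal (r powr (2 * (real n/2) - 1) * (1 - r\<^sup>2) powr (l - 1)) * indicator {0<..<1} r"
      by (auto simp: beta_weight_def abs_square_less_1 ennreal_mult' mult_ac split: split_indicator)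
  qed
  also have "\<dots> = ennreal (Beta (real n/2) l / 2)" by (rule Beta_nn_integral_square) (use l n in auto)
  finally have "(\<integral>\<^sup>+w. beta_weight l ((norm (w::'a))\<^sup>2) \<partial>lborel) = ennreal (n * unit_ball_vol n * (Beta (real n/2) l / 2))"
    by (simp add: ennreal_mult'[symmetric])
  also have "n * unit_ball_vol n * (Beta (real n/2) l / 2) = ball_const n l * Beta (1/2) l"
  proof -
    have g: "Gamma (real n / 2 + 1) = real n / 2 * Gamma (real n / 2)"
      using n by (intro Gamma_plus1) (auto dest: nonpos_Ints_nonpos)
    have pos: "Gamma (real n / 2) > 0" "Gamma (l + 1/2) > 0" "Gamma (real n / 2 + l) > 0" using n l by (auto intro!: Gamma_real_pos)
    have pi: "pi powr (real n / 2) = pi powr ((real n - 1) / 2) * sqrt pi"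
    proof -
      have "pi powr (real n / 2) = pi powr ((real n - 1) / 2 + 1/2)" by (simp add: field_simps)
      then show ?thesis by (simp only: powr_add powr_half_sqrt[OF pi_ge_zero])
    qed
    show ?thesis
      unfolding unit_ball_vol_def Beta_def ball_const_def g pi Gamma_one_half_real
      using n less_imp_neq[OF pos(1), symmetric] less_imp_neq[OF pos(2), symmetric] by (simp add: field_simps add.commute)
  qed
  finally show ?thesis by (simp add: n_def)
qed

lemma nn_integral_cos_substitution:
  fixes g :: "real \<Rightarrow> real"
  assumes g[measurable]: "g \<in> borel_measurable borel"
  shows "(\<integral>\<^sup>+u. ennreal (g u) * indicator {-1..1} u \<partial>lborel) = (\<integral>\<^sup>+\<theta>. ennreal (g (cos \<theta>) * sin \<theta>) * indicator {0..pi} \<theta> \<partial>lborel)"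
proof -
  have "(\<integral>\<^sup>+u. ennreal (g u) * indicator {-1..1} u \<partial>lborel) = (\<integral>\<^sup>+u. ennreal (g (- u)) * indicator {-1..1} (- u) \<partial>lborel)"
    by (rule nn_integral_lborel_uminus[symmetric]) measurable
  also have "\<dots> = (\<integral>\<^sup>+u. ennreal (g (- u) * indicator {- cos 0..- cos pi} u) \<partial>lborel)"
    by (intro nn_integral_cong) (auto split: split_indicator)
  also have "\<dots> = (\<integral>\<^sup>+\<theta>. ennreal (g (- (- cos \<theta>)) * sin \<theta> * indicator {0..pi} \<theta>) \<partial>lborel)"
    by (intro nn_integral_substitution[where g = "\<lambda>\<theta>. - cos \<theta>"])
       (auto intro!: derivative_eq_intros continuous_intros sin_ge_zero simp: set_borel_measurable_def)
  also have "\<dots> = (\<integral>\<^sup>+\<theta>. ennreal (g (cos \<theta>) * sin \<theta>) * indicator {0..pi} \<theta> \<partial>lborel)"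
    by (intro nn_integral_cong) (auto split: split_indicator)
  finally show ?thesis .
qed

lemma squeeze_measurable [measurable]:
  "squeeze r (e::'a::euclidean_space) \<in> borel_measurable borel"
  unfolding squeeze_def[abs_def] by (intro borel_measurable_continuous_onI continuous_intros)

lemma squeeze_scaleR: "squeeze r e (a *\<^sub>R w) = a *\<^sub>R squeeze r e w"
  by (simp add: squeeze_def algebra_simps)

lemma squeeze_minus: "squeeze r e (- w) = - squeeze r e w"
  using squeeze_scaleR[of r e "-1" w] by simp

text \<open>
  Both sides are integrals of \<open>f v\<close> over the unit ball of the product of the line and \<open>'a\<close> against the
  rotation invariant weight \<open>(1 - u^2 - |v|^2)\<close> to the power \<open>l - 1\<close>. Integrating out \<open>u\<close> gives the
  right-hand side. The left-hand side appears after a rotation that moves the first axis to a unit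
  vector lying over \<open>r e\<close>, with \<open>u = cos \<theta>\<close> and \<open>v = sin \<theta> w\<close>.
\<close>

lemma ball_integral_by_slices:
  fixes f :: "'a::euclidean_space \<Rightarrow> real" and l :: real
  assumes f[measurable]: "f \<in> borel_measurable borel" and f0: "\<And>y. f y \<ge> 0"
    and e: "norm e = 1" and r: "0 \<le> r" "r \<le> 1" and l: "l > 0"
  shows "(\<integral>\<^sup>+w. beta_weight l ((norm w)\<^sup>2) *
       (\<integral>\<^sup>+\<theta>. ennreal (f ((cos \<theta> * r) *\<^sub>R e + sin \<theta> *\<^sub>R squeeze r e w) * sin \<theta> powr (DIM('a) + 2 * l - 1)) * indicator {0..pi} \<theta> \<partial>lborel) \<partial>lborel)
     = ennreal (Beta (1/2) l) * (\<integral>\<^sup>+y. ennreal (f y * (1 - (norm y)\<^sup>2) powr (l - 1/2)) * indicator (ball 0 1) y \<partial>lborel)"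
proof -
  define n where "n = DIM('a)"
  have n: "n > 0" by (simp add: n_def)
  \<comment> \<open>the integrand on the ball of the product, extended by 0; \<open>u\<close> is the additional coordinate\<close>
  define H where "H u v = ennreal (f v) * beta_weight l (u\<^sup>2 + (norm v)\<^sup>2)" for u :: real and v :: 'a
  have [measurable]: "ball (0::'a) 1 \<in> sets borel" by simp
  have [measurable]: "(\<lambda>(u, v). H u v) \<in> borel_measurable (borel \<Otimes>\<^sub>M borel)" unfolding H_def by measurable
  have "(\<integral>\<^sup>+u. \<integral>\<^sup>+v. H u v \<partial>lborel \<partial>lborel) = (\<integral>\<^sup>+v. \<integral>\<^sup>+u. H u v \<partial>lborel \<partial>lborel)"
    by (rule nn_integral_lborel_swap) measurable
  also have "\<dots> = (\<integral>\<^sup>+v. ennreal (Beta (1/2) l) * (ennreal (f v * (1 - (norm v)\<^sup>2) powr (l - 1/2)) * indicator (ball 0 1) v) \<partial>lborel)"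
  proof (rule nn_integral_cong)
    fix v :: 'a
    have "(\<integral>\<^sup>+u. H u v \<partial>lborel) = ennreal (f v) * (\<integral>\<^sup>+u. beta_weight l (u\<^sup>2 + (norm v)\<^sup>2) \<partial>lborel)"
      unfolding H_def by (intro nn_integral_cmult) measurable
    also have "\<dots> = ennreal (f v) * (ennreal (Beta (1/2) l) * (ennreal ((1 - (norm v)\<^sup>2) powr (l - 1/2)) * indicator {..<1} ((norm v)\<^sup>2)))"
      by (subst beta_weight_integral_shifted) (use l in auto)
    also have "indicator {..<1} ((norm v)\<^sup>2) = (indicator (ball 0 1) v :: ennreal)"
      by (auto simp: abs_square_less_1 split: split_indicator)
    finally show "(\<integral>\<^sup>+u. H u v \<partial>lborel) = ennreal (Beta (1/2) l) * (ennreal (f v * (1 - (norm v)\<^sup>2) powr (l - 1/2)) * indicator (ball 0 1) v)"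
      using f0 by (simp add: ennreal_mult' mult_ac)
  qed
  also have "\<dots> = ennreal (Beta (1/2) l) * (\<integral>\<^sup>+y. ennreal (f y * (1 - (norm y)\<^sup>2) powr (l - 1/2)) * indicator (ball 0 1) y \<partial>lborel)"
    by (intro nn_integral_cmult) measurable
  finally have A: "(\<integral>\<^sup>+u. \<integral>\<^sup>+v. H u v \<partial>lborel \<partial>lborel) = \<dots>" .
  have "(\<integral>\<^sup>+u. \<integral>\<^sup>+v. H u v \<partial>lborel \<partial>lborel)
      = (\<integral>\<^sup>+u. \<integral>\<^sup>+v. H (sqrt (1 - r\<^sup>2) * u - r * (v \<bullet> e)) ((u * r) *\<^sub>R e + squeeze r e v) \<partial>lborel \<partial>lborel)"
    by (rule nn_integral_rotation[OF _ e r, symmetric]) measurable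
  also have "\<dots> = (\<integral>\<^sup>+u. \<integral>\<^sup>+v. ennreal (f ((u * r) *\<^sub>R e + squeeze r e v)) * beta_weight l (u\<^sup>2 + (norm v)\<^sup>2) \<partial>lborel \<partial>lborel)"
    unfolding H_def norm_rotation[OF e r] ..
  also have "\<dots> = (\<integral>\<^sup>+u. \<integral>\<^sup>+w. beta_weight l ((norm w)\<^sup>2) *
      (ennreal (f ((u * r) *\<^sub>R e + sqrt (1 - u\<^sup>2) *\<^sub>R squeeze r e w) * (1 - u\<^sup>2) powr (real n / 2 + l - 1)) * indicator {-1..1} u) \<partial>lborel \<partial>lborel)"
  proof (rule nn_integral_cong)
    fix u :: real
    show "(\<integral>\<^sup>+v. ennreal (f ((u * r) *\<^sub>R e + squeeze r e v)) * beta_weight l (u\<^sup>2 + (norm v)\<^sup>2) \<partial>lborel)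
      = (\<integral>\<^sup>+w. beta_weight l ((norm w)\<^sup>2) *
      (ennreal (f ((u * r) *\<^sub>R e + sqrt (1 - u\<^sup>2) *\<^sub>R squeeze r e w) * (1 - u\<^sup>2) powr (real n / 2 + l - 1)) * indicator {-1..1} u) \<partial>lborel)"
    proof (cases "u\<^sup>2 < 1")
      case True
      \<comment> \<open>the section of the ball at height \<open>u\<close> has radius \<open>a\<close>; the substitution \<open>v = a w\<close> makes it the unit ball\<close>
      define a where "a = sqrt (1 - u\<^sup>2)"
      have a: "a > 0" "a\<^sup>2 = 1 - u\<^sup>2" using True by (auto simp: a_def)
      have u1: "indicator {-1..1} u = (1::ennreal)" using True by (auto simp: abs_square_less_1 split: split_indicator)
      have "(\<integral>\<^sup>+v. ennreal (f ((u * r) *\<^sub>R e + squeeze r e v)) * beta_weight l (u\<^sup>2 + (norm v)\<^sup>2) \<partial>lborel)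
        = ennreal (\<bar>a\<bar> ^ DIM('a)) * (\<integral>\<^sup>+w. ennreal (f ((u * r) *\<^sub>R e + squeeze r e (0 + a *\<^sub>R w))) * beta_weight l (u\<^sup>2 + (norm (0 + a *\<^sub>R w))\<^sup>2) \<partial>lborel)"
        by (rule nn_integral_lborel_affine) (use a in auto)
      also have "\<dots> = (\<integral>\<^sup>+w. ennreal (a ^ n) * (ennreal (f ((u * r) *\<^sub>R e + squeeze r e (0 + a *\<^sub>R w))) * beta_weight l (u\<^sup>2 + (norm (0 + a *\<^sub>R w))\<^sup>2)) \<partial>lborel)"
        unfolding n_def using a by (subst nn_integral_cmult) auto
      also have "\<dots> = (\<integral>\<^sup>+w. beta_weight l ((norm w)\<^sup>2) *
         (ennreal (f ((u * r) *\<^sub>R e + sqrt (1 - u\<^sup>2) *\<^sub>R squeeze r e w) * (1 - u\<^sup>2) powr (real n / 2 + l - 1)) * indicator {-1..1} u) \<partial>lborel)"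
      proof (rule nn_integral_cong)
        fix w :: 'a
        have e1: "1 - (u\<^sup>2 + (norm (0 + a *\<^sub>R w))\<^sup>2) = (1 - u\<^sup>2) * (1 - (norm w)\<^sup>2)"
        proof -
          have "(norm (0 + a *\<^sub>R w))\<^sup>2 = (1 - u\<^sup>2) * (norm w)\<^sup>2" using a by (simp add: power_mult_distrib)
          then show ?thesis by (simp add: algebra_simps)
        qed
        have i: "u\<^sup>2 + (norm (0 + a *\<^sub>R w))\<^sup>2 < 1 \<longleftrightarrow> (norm w)\<^sup>2 < 1"
        proof -
          have "u\<^sup>2 + (norm (0 + a *\<^sub>R w))\<^sup>2 < 1 \<longleftrightarrow> 0 < (1 - u\<^sup>2) * (1 - (norm w)\<^sup>2)" using e1 by linarith
          then show ?thesis using True by (simp add: zero_less_mult_iff)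
        qed
        have b: "beta_weight l (u\<^sup>2 + (norm (0 + a *\<^sub>R w))\<^sup>2) = ennreal ((1 - u\<^sup>2) powr (l - 1)) * beta_weight l ((norm w)\<^sup>2)"
        proof (cases "(norm w)\<^sup>2 < 1")
          case w: True
          have "((1 - u\<^sup>2) * (1 - (norm w)\<^sup>2)) powr (l - 1) = (1 - u\<^sup>2) powr (l - 1) * (1 - (norm w)\<^sup>2) powr (l - 1)"
            using True w by (simp add: powr_mult)
          then show ?thesis unfolding beta_weight_def e1 using i w by (simp add: ennreal_mult')
        next
          case False
          then show ?thesis unfolding beta_weight_def using i by simp
        qed
        have p: "(1 - u\<^sup>2) powr (real n / 2 + l - 1) = a ^ n * (1 - u\<^sup>2) powr (l - 1)"
        proof -
          have "a = (1 - u\<^sup>2) powr (1/2)" using True unfolding a_def by (intro powr_half_sqrt[symmetric]) simp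
          moreover have "a ^ n = a powr real n" using a(1) by (rule powr_realpow[symmetric])
          ultimately have "a ^ n = ((1 - u\<^sup>2) powr (1/2)) powr real n" by simp
          also have "\<dots> = (1 - u\<^sup>2) powr (1/2 * real n)" by (rule powr_powr)
          also have "1/2 * real n = real n / 2" by simp
          finally have "a ^ n * (1 - u\<^sup>2) powr (l - 1) = (1 - u\<^sup>2) powr (real n / 2 + (l - 1))" by (simp only: powr_add)
          then show ?thesis by (simp add: algebra_simps)
        qed
        have s: "squeeze r e (0 + a *\<^sub>R w) = sqrt (1 - u\<^sup>2) *\<^sub>R squeeze r e w" by (simp add: squeeze_scaleR a_def)
        show "ennreal (a ^ n) * (ennreal (f ((u * r) *\<^sub>R e + squeeze r e (0 + a *\<^sub>R w))) * beta_weight l (u\<^sup>2 + (norm (0 + a *\<^sub>R w))\<^sup>2))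
          = beta_weight l ((norm w)\<^sup>2) *
         (ennreal (f ((u * r) *\<^sub>R e + sqrt (1 - u\<^sup>2) *\<^sub>R squeeze r e w) * (1 - u\<^sup>2) powr (real n / 2 + l - 1)) * indicator {-1..1} u)"
          unfolding b s p u1 using a f0 by (simp add: ennreal_mult' mult_ac)
      qed
      finally show ?thesis .
    next
      case False
      have "beta_weight l (u\<^sup>2 + (norm v)\<^sup>2) = 0" for v :: 'a
      proof -
        have "\<not> u\<^sup>2 + (norm v)\<^sup>2 < 1" using False zero_le_power2[of "norm v"] by linarith
        then show ?thesis by (simp add: beta_weight_def)
      qed
      moreover have "(1 - u\<^sup>2) powr (real n / 2 + l - 1) * indicator {-1..1} u = 0"
      proof (cases "u\<^sup>2 = 1")
        case False
        moreover have "u\<^sup>2 \<le> 1" if "u \<in> {-1..1}" using that by (simp add: abs_square_le_1 abs_le_iff)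
        ultimately have "u \<notin> {-1..1}" using \<open>\<not> u\<^sup>2 < 1\<close> by force
        then show ?thesis by simp
      qed simp
      ultimately show ?thesis by (auto simp: indicator_def)
    qed
  qed
  also have "\<dots> = (\<integral>\<^sup>+w. \<integral>\<^sup>+u. beta_weight l ((norm w)\<^sup>2) *
      (ennreal (f ((u * r) *\<^sub>R e + sqrt (1 - u\<^sup>2) *\<^sub>R squeeze r e w) * (1 - u\<^sup>2) powr (real n / 2 + l - 1)) * indicator {-1..1} u) \<partial>lborel \<partial>lborel)"
    by (rule nn_integral_lborel_swap) measurable
  also have "\<dots> = (\<integral>\<^sup>+w. beta_weight l ((norm w)\<^sup>2) *
       (\<integral>\<^sup>+\<theta>. ennreal (f ((cos \<theta> * r) *\<^sub>R e + sin \<theta> *\<^sub>R squeeze r e w) * sin \<theta> powr (DIM('a) + 2 * l - 1)) * indicator {0..pi} \<theta> \<partial>lborel) \<partial>lborel)"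
  proof (rule nn_integral_cong)
    fix w :: 'a
    let ?g = "\<lambda>u. f ((u * r) *\<^sub>R e + sqrt (1 - u\<^sup>2) *\<^sub>R squeeze r e w) * (1 - u\<^sup>2) powr (real n / 2 + l - 1)"
    have [measurable]: "?g \<in> borel_measurable borel" by measurable
    have "(\<integral>\<^sup>+u. ennreal (?g u) * indicator {-1..1} u \<partial>lborel) = (\<integral>\<^sup>+\<theta>. ennreal (?g (cos \<theta>) * sin \<theta>) * indicator {0..pi} \<theta> \<partial>lborel)"
      by (rule nn_integral_cos_substitution) measurable
    also have "\<dots> = (\<integral>\<^sup>+\<theta>. ennreal (f ((cos \<theta> * r) *\<^sub>R e + sin \<theta> *\<^sub>R squeeze r e w) * sin \<theta> powr (DIM('a) + 2 * l - 1)) * indicator {0..pi} \<theta> \<partial>lborel)"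
    proof (rule nn_integral_cong)
      fix \<theta> :: real
      show "ennreal (?g (cos \<theta>) * sin \<theta>) * indicator {0..pi} \<theta> = ennreal (f ((cos \<theta> * r) *\<^sub>R e + sin \<theta> *\<^sub>R squeeze r e w) * sin \<theta> powr (DIM('a) + 2 * l - 1)) * indicator {0..pi} \<theta>"
      proof (cases "\<theta> \<in> {0..pi}")
        case True
        then have s0: "sin \<theta> \<ge> 0" by (auto intro: sin_ge_zero)
        have s2: "1 - (cos \<theta>)\<^sup>2 = (sin \<theta>)\<^sup>2" by (simp add: sin_squared_eq)
        have sq: "sqrt (1 - (cos \<theta>)\<^sup>2) = sin \<theta>" unfolding s2 using s0 by simp
        have "((sin \<theta>)\<^sup>2) powr (real n / 2 + l - 1) * sin \<theta> = sin \<theta> powr (DIM('a) + 2 * l - 1)"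
        proof (cases "sin \<theta> = 0")
          case False
          then have s: "sin \<theta> > 0" using s0 by simp
          have "((sin \<theta>)\<^sup>2) powr (real n / 2 + l - 1) = (sin \<theta> powr 2) powr (real n / 2 + l - 1)" using s by (simp add: powr_numeral)
          also have "\<dots> = sin \<theta> powr (2 * (real n / 2 + l - 1))" by (rule powr_powr)
          finally have "((sin \<theta>)\<^sup>2) powr (real n / 2 + l - 1) * sin \<theta> = sin \<theta> powr (2 * (real n / 2 + l - 1)) * sin \<theta> powr 1" using s by simp
          also have "\<dots> = sin \<theta> powr (2 * (real n / 2 + l - 1) + 1)" by (rule powr_add[symmetric])
          also have "2 * (real n / 2 + l - 1) + 1 = DIM('a) + 2 * l - 1" by (simp add: n_def algebra_simps)
          finally show ?thesis .
        qed simp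
        then show ?thesis unfolding sq unfolding s2 using True by (simp add: mult.assoc)
      qed simp
    qed
    finally show "(\<integral>\<^sup>+u. beta_weight l ((norm w)\<^sup>2) * (ennreal (?g u) * indicator {-1..1} u) \<partial>lborel)
       = beta_weight l ((norm w)\<^sup>2) * (\<integral>\<^sup>+\<theta>. ennreal (f ((cos \<theta> * r) *\<^sub>R e + sin \<theta> *\<^sub>R squeeze r e w) * sin \<theta> powr (DIM('a) + 2 * l - 1)) * indicator {0..pi} \<theta> \<partial>lborel)"
      by (subst nn_integral_cmult) auto
  qed
  finally show ?thesis unfolding A ..
qed

section \<open>From the ball to the half circle\<close>

lemma INF_ennreal_cmult:
  fixes f :: "'b \<Rightarrow> ennreal"
  assumes c: "c > 0"
  shows "(INF x\<in>A. ennreal c * f x) = ennreal c * (INF x\<in>A. f x)"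
proof (rule antisym)
  have one: "ennreal (1 / c) * ennreal c = 1" using c by (subst ennreal_mult'[symmetric]) auto
  have "ennreal (1 / c) * (INF x\<in>A. ennreal c * f x) \<le> (INF x\<in>A. f x)"
  proof (rule INF_greatest)
    fix x assume x: "x \<in> A"
    have "ennreal (1 / c) * (INF x\<in>A. ennreal c * f x) \<le> ennreal (1 / c) * (ennreal c * f x)"
      by (intro mult_left_mono INF_lower x) simp
    then show "ennreal (1 / c) * (INF x\<in>A. ennreal c * f x) \<le> f x"
      unfolding mult.assoc[symmetric] one by simp
  qed
  then have "ennreal c * (ennreal (1 / c) * (INF x\<in>A. ennreal c * f x)) \<le> ennreal c * (INF x\<in>A. f x)"
    by (rule mult_left_mono) simp
  then show "(INF x\<in>A. ennreal c * f x) \<le> ennreal c * (INF x\<in>A. f x)"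
    using one by (simp add: mult.assoc[symmetric] mult.commute[of "ennreal c"])
  show "ennreal c * (INF x\<in>A. f x) \<le> (INF x\<in>A. ennreal c * f x)"
    by (intro INF_greatest mult_left_mono INF_lower) auto
qed

definition arc_int :: "real \<Rightarrow> real \<Rightarrow> complex poly \<Rightarrow> ennreal" where
  "arc_int p a q = (\<integral>\<^sup>+\<theta>. ennreal (cmod (poly q (of_real (cos \<theta>))) powr p * sin \<theta> powr a) * indicator {0..pi} \<theta> \<partial>lborel)"

definition arc_min :: "real \<Rightarrow> real \<Rightarrow> nat \<Rightarrow> ennreal" where
  "arc_min p a n = (INF q\<in>{q. degree q \<le> n \<and> poly q 1 = 1}. arc_int p a q)"

lemma poly_cos_measurable [measurable]: "(\<lambda>\<theta>. poly q (complex_of_real (cos \<theta>))) \<in> borel_measurable borel"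
  by (intro borel_measurable_continuous_onI continuous_intros)

lemma sin_measurable [measurable]: "(sin :: real \<Rightarrow> real) \<in> borel_measurable borel"
  by (intro borel_measurable_continuous_onI continuous_intros)

lemma cos_measurable [measurable]: "(cos :: real \<Rightarrow> real) \<in> borel_measurable borel"
  by (intro borel_measurable_continuous_onI continuous_intros)

lemma scaled_arc_int_eq_arc_int:
  assumes n: "n \<ge> 1"
  shows "scaled_arc_int p a n q = ennreal (real n powr (a + 1)) * arc_int p a q"
proof -
  have "scaled_arc_int p a n q = ennreal \<bar>real n\<bar> * (\<integral>\<^sup>+\<theta>. ennreal (cmod (poly q (of_real (cos ((0 + real n * \<theta>) / real n)))) powr p *
      (real n * sin ((0 + real n * \<theta>) / real n)) powr a) * indicator {0..pi * real n} (0 + real n * \<theta>) \<partial>lborel)"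
    unfolding scaled_arc_int_def by (rule nn_integral_real_affine) (use n in auto)
  also have "(\<integral>\<^sup>+\<theta>. ennreal (cmod (poly q (of_real (cos ((0 + real n * \<theta>) / real n)))) powr p *
      (real n * sin ((0 + real n * \<theta>) / real n)) powr a) * indicator {0..pi * real n} (0 + real n * \<theta>) \<partial>lborel)
     = (\<integral>\<^sup>+\<theta>. ennreal (real n powr a) * (ennreal (cmod (poly q (of_real (cos \<theta>))) powr p * sin \<theta> powr a) * indicator {0..pi} \<theta>) \<partial>lborel)"
  proof (rule nn_integral_cong)
    fix \<theta> :: real
    have i: "0 + real n * \<theta> \<in> {0..pi * real n} \<longleftrightarrow> \<theta> \<in> {0..pi}" using n by (auto simp: zero_le_mult_iff mult.commute)
    have d: "(0 + real n * \<theta>) / real n = \<theta>" using n by simp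
    show "ennreal (cmod (poly q (of_real (cos ((0 + real n * \<theta>) / real n)))) powr p *
      (real n * sin ((0 + real n * \<theta>) / real n)) powr a) * indicator {0..pi * real n} (0 + real n * \<theta>)
      = ennreal (real n powr a) * (ennreal (cmod (poly q (of_real (cos \<theta>))) powr p * sin \<theta> powr a) * indicator {0..pi} \<theta>)"
      unfolding d indicator_def i by (auto simp: powr_mult ennreal_mult'[symmetric] mult_ac)
  qed
  also have "\<dots> = ennreal (real n powr a) * arc_int p a q"
    unfolding arc_int_def by (intro nn_integral_cmult) measurable
  also have "ennreal \<bar>real n\<bar> * (ennreal (real n powr a) * arc_int p a q) = ennreal (real n * real n powr a) * arc_int p a q"
    by (simp add: mult.assoc[symmetric] ennreal_mult')
  also have "real n * real n powr a = real n powr (a + 1)" using n by (simp add: powr_add mult.commute)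
  finally show ?thesis .
qed

lemma scaled_arc_min_eq_arc_min:
  assumes n: "n \<ge> 1"
  shows "scaled_arc_min p a n = ennreal (real n powr (a + 1)) * arc_min p a n"
proof -
  have ne: "{q :: complex poly. degree q \<le> n \<and> poly q 1 = 1} \<noteq> {}"
    by (auto intro: exI[of _ "1 :: complex poly"])
  have "scaled_arc_min p a n = (INF q\<in>{q. degree q \<le> n \<and> poly q 1 = 1}. ennreal (real n powr (a + 1)) * arc_int p a q)"
    unfolding scaled_arc_min_def scaled_arc_int_eq_arc_int[OF n] ..
  also have "\<dots> = ennreal (real n powr (a + 1)) * arc_min p a n"
    unfolding arc_min_def
    by (rule INF_ennreal_cmult) (use n in auto)
  finally show ?thesis .
qed

lemma ennreal_half_add_half: "ennreal (1/2) * X + ennreal (1/2) * X = X"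
proof -
  have "ennreal (1/2) + ennreal (1/2) = 1" by (subst ennreal_plus[symmetric]) auto
  then show ?thesis by (metis distrib_right mult_1)
qed

lemma convex_powr_avg:
  fixes a b :: real
  assumes p: "p \<ge> 1" and a: "a \<ge> 0" and b: "b \<ge> 0"
  shows "((a + b) / 2) powr p \<le> (a powr p + b powr p) / 2"
proof (cases "a > 0 \<and> b > 0")
  case True
  have "(((1 - 1/2) *\<^sub>R a + (1/2) *\<^sub>R b) powr p) \<le> (1 - 1/2) * (a powr p) + (1/2) * (b powr p)"
    by (rule convex_onD[OF powr_convex[OF p]]) (use True in auto)
  then show ?thesis by (simp add: field_simps)
next
  case False
  define c where "c = max a b"
  have c: "c \<ge> 0" "a + b = c" "a powr p + b powr p = c powr p" using False a b p by (auto simp: c_def max_def)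
  have "(1/2) powr p \<le> (1/2) powr (1::real)" using p by (intro powr_mono') auto
  then have "c powr p * (1/2) powr p \<le> c powr p * (1/2)" by (intro mult_left_mono) auto
  moreover have "(c / 2) powr p = c powr p * (1/2) powr p" using powr_mult[of c "1/2" p] c by simp
  ultimately show ?thesis unfolding c by simp
qed

text \<open>
  On the curve \<open>cos \<theta> x + sin \<theta> b\<close> the even part of \<open>P\<close> is a polynomial \<open>A\<close> in \<open>cos \<theta>\<close> with value \<open>P x\<close> at
  \<open>\<theta> = 0\<close>. If \<open>P x\<close> is not 0, the quotient of \<open>A\<close> by \<open>P x\<close> is a competitor; convexity of the \<open>p\<close>-th power passes
  from the even part to \<open>P\<close>.
\<close>

lemma slice_lower_bound:
  fixes P :: "'a::real_vector \<Rightarrow> complex"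
  assumes A: "degree A \<le> n" "\<And>\<theta>. poly A (of_real (cos \<theta>)) = (P (cos \<theta> *\<^sub>R x + sin \<theta> *\<^sub>R b) + P (cos \<theta> *\<^sub>R x - sin \<theta> *\<^sub>R b)) / 2"
    and p: "p \<ge> 1"
  shows "ennreal (cmod (P x) powr p) * arc_min p a n \<le>
    (\<integral>\<^sup>+\<theta>. ennreal ((cmod (P (cos \<theta> *\<^sub>R x + sin \<theta> *\<^sub>R b)) powr p + cmod (P (cos \<theta> *\<^sub>R x - sin \<theta> *\<^sub>R b)) powr p) / 2 * sin \<theta> powr a) * indicator {0..pi} \<theta> \<partial>lborel)"
proof -
  have A1: "poly A 1 = P x" using A(2)[of 0] by simp
  have "ennreal (cmod (P x) powr p) * arc_min p a n \<le> arc_int p a A"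
  proof (cases "P x = 0")
    case True
    then show ?thesis using p by simp
  next
    case False
    have "arc_min p a n \<le> arc_int p a (smult (inverse (P x)) A)"
      unfolding arc_min_def using A(1) False by (intro INF_lower) (auto simp: A1)
    then have "ennreal (cmod (P x) powr p) * arc_min p a n \<le> ennreal (cmod (P x) powr p) * arc_int p a (smult (inverse (P x)) A)"
      by (rule mult_left_mono) simp
    also have "\<dots> = (\<integral>\<^sup>+\<theta>. ennreal (cmod (P x) powr p) * (ennreal (cmod (poly (smult (inverse (P x)) A) (of_real (cos \<theta>))) powr p * sin \<theta> powr a) * indicator {0..pi} \<theta>) \<partial>lborel)"
      unfolding arc_int_def by (intro nn_integral_cmult[symmetric]) measurable
    also have "\<dots> = arc_int p a A"
      unfolding arc_int_def
    proof (rule nn_integral_cong)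
      fix \<theta> :: real
      have "cmod (P x) * cmod (poly (smult (inverse (P x)) A) (of_real (cos \<theta>))) = cmod (poly A (of_real (cos \<theta>)))"
        unfolding norm_mult[symmetric] using False by (simp add: mult.assoc[symmetric])
      then have "cmod (P x) powr p * cmod (poly (smult (inverse (P x)) A) (of_real (cos \<theta>))) powr p = cmod (poly A (of_real (cos \<theta>))) powr p"
        by (metis powr_mult)
      then show "ennreal (cmod (P x) powr p) * (ennreal (cmod (poly (smult (inverse (P x)) A) (of_real (cos \<theta>))) powr p * sin \<theta> powr a) * indicator {0..pi} \<theta>)
        = ennreal (cmod (poly A (of_real (cos \<theta>))) powr p * sin \<theta> powr a) * indicator {0..pi} \<theta>"
        by (metis (no_types, lifting) ennreal_mult' mult.assoc powr_ge_zero)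
    qed
    finally show ?thesis .
  qed
  also have "\<dots> \<le> (\<integral>\<^sup>+\<theta>. ennreal ((cmod (P (cos \<theta> *\<^sub>R x + sin \<theta> *\<^sub>R b)) powr p + cmod (P (cos \<theta> *\<^sub>R x - sin \<theta> *\<^sub>R b)) powr p) / 2 * sin \<theta> powr a) * indicator {0..pi} \<theta> \<partial>lborel)"
    unfolding arc_int_def
  proof (rule nn_integral_mono)
    fix \<theta> :: real
    let ?u = "P (cos \<theta> *\<^sub>R x + sin \<theta> *\<^sub>R b)" and ?v = "P (cos \<theta> *\<^sub>R x - sin \<theta> *\<^sub>R b)"
    have "cmod (poly A (of_real (cos \<theta>))) \<le> (cmod ?u + cmod ?v) / 2"
      unfolding A(2) norm_divide using norm_triangle_ineq[of ?u ?v] by simp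
    then have "cmod (poly A (of_real (cos \<theta>))) powr p \<le> ((cmod ?u + cmod ?v) / 2) powr p" using p by (intro powr_mono2) auto
    also have "\<dots> \<le> (cmod ?u powr p + cmod ?v powr p) / 2" by (rule convex_powr_avg[OF p]) auto
    finally show "ennreal (cmod (poly A (of_real (cos \<theta>))) powr p * sin \<theta> powr a) * indicator {0..pi} \<theta>
      \<le> ennreal ((cmod ?u powr p + cmod ?v powr p) / 2 * sin \<theta> powr a) * indicator {0..pi} \<theta>"
      by (intro mult_right_mono ennreal_leI) auto
  qed
  finally show ?thesis .
qed

text \<open>
  The cost of replacing the exponent \<open>a\<close> by a larger exponent \<open>b\<close>.
\<close>

definition sin_gap :: "real \<Rightarrow> real \<Rightarrow> ennreal" where
  "sin_gap a b = (\<integral>\<^sup>+\<theta>. ennreal (sin \<theta> powr a - sin \<theta> powr b) * indicator {0..pi} \<theta> \<partial>lborel)"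

lemma sin_gap_tendsto:
  assumes a: "a \<ge> 0" and b: "\<And>k. b k \<ge> a" "b \<longlonglongrightarrow> a"
  shows "(\<lambda>k. sin_gap a (b k)) \<longlonglongrightarrow> 0"
proof -
  have "(\<lambda>k. sin_gap a (b k)) \<longlonglongrightarrow> (\<integral>\<^sup>+\<theta>. (0::ennreal) \<partial>(lborel :: real measure))"
    unfolding sin_gap_def
  proof (rule nn_integral_dominated_convergence[where w = "indicator {0..pi}"])
    show "AE \<theta> in lborel. ennreal (sin \<theta> powr a - sin \<theta> powr b k) * indicator {0..pi} \<theta> \<le> indicator {0..pi} \<theta>" for k
    proof (rule AE_I2)
      fix \<theta> :: real
      have "ennreal (sin \<theta> powr a - sin \<theta> powr b k) \<le> ennreal 1" if "\<theta> \<in> {0..pi}"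
      proof (rule ennreal_leI)
        have "sin \<theta> powr a \<le> 1" using that a sin_ge_zero[of \<theta>] by (intro powr_le1) auto
        moreover have "0 \<le> sin \<theta> powr b k" by simp
        ultimately show "sin \<theta> powr a - sin \<theta> powr b k \<le> 1" by linarith
      qed
      then show "ennreal (sin \<theta> powr a - sin \<theta> powr b k) * indicator {0..pi} \<theta> \<le> indicator {0..pi} \<theta>"
        by (auto split: split_indicator)
    qed
    show "AE \<theta> in lborel. (\<lambda>k. ennreal (sin \<theta> powr a - sin \<theta> powr b k) * indicator {0..pi} \<theta>) \<longlonglongrightarrow> 0"
    proof (rule AE_I2)
      fix \<theta> :: real
      show "(\<lambda>k. ennreal (sin \<theta> powr a - sin \<theta> powr b k) * indicator {0..pi} \<theta>) \<longlonglongrightarrow> 0"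
      proof (cases "\<theta> \<in> {0..pi} \<and> sin \<theta> \<noteq> 0")
        case True
        have "(\<lambda>k. sin \<theta> powr a - sin \<theta> powr b k) \<longlonglongrightarrow> sin \<theta> powr a - sin \<theta> powr a"
          using True b(2) by (intro tendsto_intros) auto
        then have "(\<lambda>k. ennreal (sin \<theta> powr a - sin \<theta> powr b k)) \<longlonglongrightarrow> ennreal (sin \<theta> powr a - sin \<theta> powr a)"
          by (rule tendsto_ennrealI)
        then show ?thesis using True by simp
      next
        case False
        then have "\<theta> \<notin> {0..pi} \<or> sin \<theta> = 0" by simp
        then show ?thesis by (elim disjE) simp_all
      qed
    qed
  qed simp_all
  then show ?thesis by simp
qed

lemma ball_const_pos: "m > 0 \<Longrightarrow> l \<ge> 0 \<Longrightarrow> ball_const m l > 0"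
  unfolding ball_const_def by (intro divide_pos_pos mult_pos_pos Gamma_real_pos) auto

lemma ball_const_tendsto:
  assumes m: "m > 0" and l: "l \<ge> 0" and b: "b \<longlonglongrightarrow> l"
  shows "(\<lambda>k. ball_const m (b k)) \<longlonglongrightarrow> ball_const m l"
proof -
  have "l + 1/2 \<notin> \<int>\<^sub>\<le>\<^sub>0" "l + m / 2 \<notin> \<int>\<^sub>\<le>\<^sub>0" using m l by (auto dest: nonpos_Ints_nonpos)
  moreover have "Gamma (l + m / 2) > 0" using m l by (intro Gamma_real_pos) simp
  then have "Gamma (l + m / 2) \<noteq> 0" by linarith
  ultimately show ?thesis unfolding ball_const_def
    using b by (intro tendsto_intros) auto
qed

definition ball_integral :: "real \<Rightarrow> real \<Rightarrow> ('a::euclidean_space \<Rightarrow> complex) \<Rightarrow> ennreal" where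
  "ball_integral p l P = (\<integral>\<^sup>+y. ennreal (cmod (P y) powr p * (1 - (norm y)\<^sup>2) powr (l - 1/2)) * indicator (ball 0 1) y \<partial>lborel)"

lemma ball_integral_mono:
  assumes "l \<le> l'"
  shows "ball_integral p l' P \<le> ball_integral p l P"
  unfolding ball_integral_def
proof (rule nn_integral_mono)
  fix y :: 'a
  have "cmod (P y) powr p * (1 - (norm y)\<^sup>2) powr (l' - 1/2) \<le> cmod (P y) powr p * (1 - (norm y)\<^sup>2) powr (l - 1/2)" if "norm y < 1"
    using that assms by (intro mult_left_mono powr_mono') (auto simp: abs_square_le_1)
  then show "ennreal (cmod (P y) powr p * (1 - (norm y)\<^sup>2) powr (l' - 1/2)) * indicator (ball 0 1) y
    \<le> ennreal (cmod (P y) powr p * (1 - (norm y)\<^sup>2) powr (l - 1/2)) * indicator (ball 0 1) y"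
    by (auto intro: ennreal_leI split: split_indicator)
qed

text \<open>
  The slices through \<open>x\<close> are indexed by \<open>w\<close> in the ball, and the lower bounds for them are averaged with
  the weight \<open>(1 - |w|^2)\<close> to the power \<open>l - 1\<close>. This weight is integrable only for \<open>l > 0\<close>. To reach \<open>l = 0\<close>
  later, the extremal problem on the circle keeps an exponent \<open>a\<close> that may be smaller than the exponent \<open>a'\<close>
  that belongs to \<open>l\<close>.
\<close>

lemma ball_upper_bound_approx:
  fixes P :: "'a::euclidean_space \<Rightarrow> complex" and l :: real
  assumes P: "continuous_on UNIV P" and M: "\<And>y. norm y \<le> 1 \<Longrightarrow> cmod (P y) \<le> M"
    and slices: "\<And>b. \<exists>A. degree A \<le> n \<and> (\<forall>\<theta>. poly A (of_real (cos \<theta>)) = (P (cos \<theta> *\<^sub>R x + sin \<theta> *\<^sub>R b) + P (cos \<theta> *\<^sub>R x - sin \<theta> *\<^sub>R b)) / 2)"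
    and p: "p \<ge> 1" and x: "norm x \<le> 1" and l: "l > 0"
    and a': "a' = DIM('a) + 2 * l - 1" and a: "a \<le> a'"
  shows "ennreal (ball_const DIM('a) l) * (ennreal (cmod (P x) powr p) * arc_min p a n)
    \<le> ball_integral p l P + ennreal (ball_const DIM('a) l) * (ennreal (M powr p) * sin_gap a a')"
proof -
  define r where "r = norm x"
  obtain e where e: "norm e = 1" "x = r *\<^sub>R e"
  proof (cases "x = 0")
    case True
    obtain b :: 'a where "b \<in> Basis" using nonempty_Basis by blast
    then show ?thesis using that[of b] True by (simp add: r_def)
  next
    case False
    then show ?thesis using that[of "x /\<^sub>R norm x"] by (simp add: r_def)
  qed
  have r: "0 \<le> r" "r \<le> 1" using x by (auto simp: r_def)
  have [measurable]: "P \<in> borel_measurable borel" using P by (rule borel_measurable_continuous_onI)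
  define D where "D = ennreal (cmod (P x) powr p) * arc_min p a n"
  define K where "K = ennreal (ball_const DIM('a) l)"
  define \<beta> where "\<beta> = ennreal (Beta (1/2) l)"
  have beta_pos: "Beta (1/2) l > 0" unfolding Beta_def using l by (intro divide_pos_pos mult_pos_pos Gamma_real_pos) auto
  define S where "S w = (\<integral>\<^sup>+\<theta>. ennreal (cmod (P ((cos \<theta> * r) *\<^sub>R e + sin \<theta> *\<^sub>R squeeze r e w)) powr p * sin \<theta> powr (DIM('a) + 2 * l - 1)) * indicator {0..pi} \<theta> \<partial>lborel)" for w
  have Sm[measurable]: "S \<in> borel_measurable borel" unfolding S_def by measurable
  define E where "E = ennreal (M powr p) * sin_gap a a'"
  \<comment> \<open>the slice of \<open>w\<close> and its reversal, the slice of \<open>- w\<close>, share the even part; \<open>E\<close> pays for replacing \<open>a\<close> by \<open>a'\<close>\<close>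
  have pt: "beta_weight l ((norm w)\<^sup>2) * D \<le> beta_weight l ((norm w)\<^sup>2) * (ennreal (1/2) * S w + ennreal (1/2) * S (- w) + E)" for w :: 'a
  proof (cases "norm w < 1")
    case w: True
    define b where "b = squeeze r e w"
    have xe: "cos \<theta> *\<^sub>R x = (cos \<theta> * r) *\<^sub>R e" for \<theta> by (simp add: e(2))
    \<comment> \<open>the curve stays in the unit ball, where \<open>M\<close> bounds \<open>P\<close>\<close>
    have inball: "norm ((cos \<theta> * r) *\<^sub>R e + s *\<^sub>R b) \<le> 1" if "s\<^sup>2 = (sin \<theta>)\<^sup>2" for s \<theta>
    proof -
      have "(norm ((cos \<theta> * r) *\<^sub>R e + squeeze r e (s *\<^sub>R w)))\<^sup>2 \<le> (cos \<theta>)\<^sup>2 + (norm (s *\<^sub>R w))\<^sup>2"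
        using norm_rotation[OF e(1) r, of "cos \<theta>" "s *\<^sub>R w"] zero_le_power2 by (metis le_add_same_cancel2)
      also have "\<dots> = (cos \<theta>)\<^sup>2 + s\<^sup>2 * (norm w)\<^sup>2" by (simp add: power_mult_distrib)
      also have "\<dots> \<le> (cos \<theta>)\<^sup>2 + s\<^sup>2 * 1" using w by (intro add_left_mono mult_left_mono) (auto simp: abs_square_le_1)
      also have "\<dots> = 1" using that by simp
      finally show ?thesis unfolding squeeze_scaleR b_def by (simp add: abs_square_le_1)
    qed
    obtain A where A: "degree A \<le> n" "\<And>\<theta>. poly A (of_real (cos \<theta>)) = (P (cos \<theta> *\<^sub>R x + sin \<theta> *\<^sub>R b) + P (cos \<theta> *\<^sub>R x - sin \<theta> *\<^sub>R b)) / 2"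
      using slices by blast
    define F where "F \<theta> = cmod (P ((cos \<theta> * r) *\<^sub>R e + sin \<theta> *\<^sub>R b)) powr p" for \<theta>
    define G where "G \<theta> = cmod (P ((cos \<theta> * r) *\<^sub>R e - sin \<theta> *\<^sub>R b)) powr p" for \<theta>
    have [measurable]: "F \<in> borel_measurable borel" "G \<in> borel_measurable borel" unfolding F_def G_def by measurable
    have FM: "F \<theta> \<le> M powr p" "G \<theta> \<le> M powr p" for \<theta>
      using inball[of "sin \<theta>" \<theta>] inball[of "- sin \<theta>" \<theta>] p unfolding F_def G_def by (auto intro!: powr_mono2 M)
    have FG0: "F \<theta> \<ge> 0" "G \<theta> \<ge> 0" for \<theta> by (auto simp: F_def G_def)
    have "D \<le> (\<integral>\<^sup>+\<theta>. ennreal ((F \<theta> + G \<theta>) / 2 * sin \<theta> powr a) * indicator {0..pi} \<theta> \<partial>lborel)"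
      using slice_lower_bound[OF A p, of a] unfolding D_def F_def G_def xe .
    also have "\<dots> \<le> (\<integral>\<^sup>+\<theta>. (ennreal (1/2) * (ennreal (F \<theta> * sin \<theta> powr a') * indicator {0..pi} \<theta>)
        + ennreal (1/2) * (ennreal (G \<theta> * sin \<theta> powr a') * indicator {0..pi} \<theta>))
        + ennreal (M powr p) * (ennreal (sin \<theta> powr a - sin \<theta> powr a') * indicator {0..pi} \<theta>) \<partial>lborel)"
    proof (rule nn_integral_mono)
      fix \<theta> :: real
      show "ennreal ((F \<theta> + G \<theta>) / 2 * sin \<theta> powr a) * indicator {0..pi} \<theta> \<le> (ennreal (1/2) * (ennreal (F \<theta> * sin \<theta> powr a') * indicator {0..pi} \<theta>)
        + ennreal (1/2) * (ennreal (G \<theta> * sin \<theta> powr a') * indicator {0..pi} \<theta>))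
        + ennreal (M powr p) * (ennreal (sin \<theta> powr a - sin \<theta> powr a') * indicator {0..pi} \<theta>)"
      proof (cases "\<theta> \<in> {0..pi}")
        case True
        then have s: "0 \<le> sin \<theta>" "sin \<theta> \<le> 1" by (auto intro: sin_ge_zero)
        have d: "0 \<le> sin \<theta> powr a - sin \<theta> powr a'" 
        proof -
          have "sin \<theta> powr a' \<le> sin \<theta> powr a" by (rule powr_mono') (use a s in auto)
          then show ?thesis by simp
        qed
        have "(F \<theta> + G \<theta>) / 2 * sin \<theta> powr a = (1/2 * (F \<theta> * sin \<theta> powr a') + 1/2 * (G \<theta> * sin \<theta> powr a')) + (F \<theta> + G \<theta>) / 2 * (sin \<theta> powr a - sin \<theta> powr a')"
          by (simp add: field_simps)
        also have "(F \<theta> + G \<theta>) / 2 * (sin \<theta> powr a - sin \<theta> powr a') \<le> M powr p * (sin \<theta> powr a - sin \<theta> powr a')"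
          using FM[of \<theta>] d by (intro mult_right_mono) auto
        finally have "ennreal ((F \<theta> + G \<theta>) / 2 * sin \<theta> powr a) \<le> ennreal ((1/2 * (F \<theta> * sin \<theta> powr a') + 1/2 * (G \<theta> * sin \<theta> powr a')) + M powr p * (sin \<theta> powr a - sin \<theta> powr a'))"
          by (intro ennreal_leI) simp
        also have "\<dots> = (ennreal (1/2) * ennreal (F \<theta> * sin \<theta> powr a') + ennreal (1/2) * ennreal (G \<theta> * sin \<theta> powr a')) + ennreal (M powr p) * ennreal (sin \<theta> powr a - sin \<theta> powr a')"
          using FG0[of \<theta>] d by (simp only: ennreal_plus ennreal_mult mult_nonneg_nonneg add_nonneg_nonneg powr_ge_zero zero_le_divide_1_iff zero_le_numeral)
        finally show ?thesis using True by simp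
      qed simp
    qed
    also have "\<dots> = (ennreal (1/2) * (\<integral>\<^sup>+\<theta>. ennreal (F \<theta> * sin \<theta> powr a') * indicator {0..pi} \<theta> \<partial>lborel)
        + ennreal (1/2) * (\<integral>\<^sup>+\<theta>. ennreal (G \<theta> * sin \<theta> powr a') * indicator {0..pi} \<theta> \<partial>lborel))
        + ennreal (M powr p) * (\<integral>\<^sup>+\<theta>. ennreal (sin \<theta> powr a - sin \<theta> powr a') * indicator {0..pi} \<theta> \<partial>lborel)"
      by (simp add: nn_integral_add nn_integral_cmult)
    also have "\<dots> = ennreal (1/2) * S w + ennreal (1/2) * S (- w) + E"
      unfolding S_def E_def sin_gap_def F_def G_def b_def squeeze_minus a' by simp
    finally show ?thesis by (rule mult_left_mono) simp
  next
    case False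
    then have "beta_weight l ((norm w)\<^sup>2) = 0" by (simp add: beta_weight_def abs_square_less_1)
    then show ?thesis by simp
  qed
  have w1: "(\<integral>\<^sup>+w. beta_weight l ((norm (w::'a))\<^sup>2) \<partial>lborel) = K * \<beta>"
    unfolding beta_weight_integral_ball[OF l] K_def \<beta>_def using beta_pos by (intro ennreal_mult'') simp
  have wS: "(\<integral>\<^sup>+w. beta_weight l ((norm (w::'a))\<^sup>2) * S w \<partial>lborel) = \<beta> * ball_integral p l P"
    unfolding S_def \<beta>_def ball_integral_def by (rule ball_integral_by_slices[OF _ _ e(1) r l]) auto
  have wS': "(\<integral>\<^sup>+w. beta_weight l ((norm (w::'a))\<^sup>2) * S (- w) \<partial>lborel) = \<beta> * ball_integral p l P"
    using nn_integral_lborel_uminus[of "\<lambda>w. beta_weight l ((norm (w::'a))\<^sup>2) * S w"] wS by simp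
  have "(K * \<beta>) * D = (\<integral>\<^sup>+w. beta_weight l ((norm (w::'a))\<^sup>2) * D \<partial>lborel)"
    unfolding w1[symmetric] by (intro nn_integral_multc[symmetric]) measurable
  also have "\<dots> \<le> (\<integral>\<^sup>+w. beta_weight l ((norm (w::'a))\<^sup>2) * (ennreal (1/2) * S w + ennreal (1/2) * S (- w) + E) \<partial>lborel)"
    by (intro nn_integral_mono pt)
  also have "\<dots> = (\<integral>\<^sup>+w. ennreal (1/2) * (beta_weight l ((norm (w::'a))\<^sup>2) * S w) + ennreal (1/2) * (beta_weight l ((norm (w::'a))\<^sup>2) * S (- w)) + beta_weight l ((norm (w::'a))\<^sup>2) * E \<partial>lborel)"
    by (intro nn_integral_cong) (simp add: distrib_left mult_ac)
  also have "\<dots> = ennreal (1/2) * (\<beta> * ball_integral p l P) + ennreal (1/2) * (\<beta> * ball_integral p l P) + (K * \<beta>) * E"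
    by (simp add: nn_integral_add nn_integral_cmult nn_integral_multc wS wS' w1)
  also have "\<dots> = \<beta> * (ball_integral p l P + K * E)"
    unfolding ennreal_half_add_half by (simp add: distrib_left mult_ac)
  finally have "\<beta> * (K * D) \<le> \<beta> * (ball_integral p l P + K * E)" by (simp add: mult_ac)
  then show ?thesis unfolding D_def K_def E_def \<beta>_def
    using beta_pos by (subst (asm) ennreal_mult_le_mult_iff) auto
qed

lemma shrinking_shift_tendsto: "(\<lambda>k. l + 1 / real (Suc k)) \<longlonglongrightarrow> l"
  using tendsto_add[OF tendsto_const LIMSEQ_Suc[OF lim_1_over_n]] by (metis add.right_neutral)

text \<open>
  The approximate bound is used with exponents that decrease to \<open>l\<close>. For \<open>l = 0\<close> the averaging
  weights concentrate on the unit sphere in the limit.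
\<close>

lemma ball_upper_bound:
  fixes P :: "'a::euclidean_space \<Rightarrow> complex" and l :: real
  assumes P: "continuous_on UNIV P" 
    and slices: "\<And>b. \<exists>A. degree A \<le> n \<and> (\<forall>\<theta>. poly A (of_real (cos \<theta>)) = (P (cos \<theta> *\<^sub>R x + sin \<theta> *\<^sub>R b) + P (cos \<theta> *\<^sub>R x - sin \<theta> *\<^sub>R b)) / 2)"
    and p: "p \<ge> 1" and x: "norm x \<le> 1" and l: "l \<ge> 0"
  shows "ennreal (ball_const DIM('a) l) * (ennreal (cmod (P x) powr p) * arc_min p (DIM('a) + 2 * l - 1) n) \<le> ball_integral p l P"
proof -
  define a where "a = DIM('a) + 2 * l - 1"
  have D1: "real DIM('a) \<ge> 1" by (simp add: Suc_leI)
  have a0: "a \<ge> 0" using l D1 unfolding a_def by linarith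
  obtain M where M: "\<And>y. y \<in> cball 0 1 \<Longrightarrow> cmod (P y) \<le> M"
    using continuous_on_compact_bound[OF continuous_on_subset[OF P], of "cball 0 1"] by auto
  define b where "b k = l + 1 / real (Suc k)" for k
  define c where "c k = ball_const DIM('a) (b k)" for k
  have bl: "b k > 0" "l \<le> b k" for k using l by (auto simp: b_def add_nonneg_pos)
  have b: "b \<longlonglongrightarrow> l" unfolding b_def by (rule shrinking_shift_tendsto)
  have c: "(\<lambda>k. ennreal (c k)) \<longlonglongrightarrow> ennreal (ball_const DIM('a) l)"
    unfolding c_def by (intro tendsto_ennrealI ball_const_tendsto b l) simp
  have cpos: "ball_const DIM('a) l > 0" by (rule ball_const_pos) (use l in auto)
  let ?a = "\<lambda>k. DIM('a) + 2 * b k - 1"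
  have bd: "ennreal (c k) * (ennreal (cmod (P x) powr p) * arc_min p a n)
    \<le> ball_integral p l P + ennreal (c k) * (ennreal (M powr p) * sin_gap a (?a k))" for k
  proof -
    have "ennreal (c k) * (ennreal (cmod (P x) powr p) * arc_min p a n)
      \<le> ball_integral p (b k) P + ennreal (c k) * (ennreal (M powr p) * sin_gap a (?a k))"
      unfolding c_def
      by (rule ball_upper_bound_approx[OF P _ slices p x bl(1) refl]) (use M bl[of k] in \<open>auto simp: a_def\<close>)
    also have "\<dots> \<le> ball_integral p l P + ennreal (c k) * (ennreal (M powr p) * sin_gap a (?a k))"
      by (intro add_right_mono ball_integral_mono bl)
    finally show ?thesis .
  qed
  have gap: "(\<lambda>k. sin_gap a (?a k)) \<longlonglongrightarrow> 0"
  proof (rule sin_gap_tendsto[OF a0])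
    show "?a k \<ge> a" for k using bl[of k] by (simp add: a_def)
    show "?a \<longlonglongrightarrow> a" unfolding a_def using b by (intro tendsto_intros)
  qed
  have "(\<lambda>k. ball_integral p l P + ennreal (c k) * (ennreal (M powr p) * sin_gap a (?a k))) \<longlonglongrightarrow> ball_integral p l P + ennreal (ball_const DIM('a) l) * (ennreal (M powr p) * 0)"
    by (intro tendsto_add tendsto_const tendsto_mult_ennreal c gap) auto
  moreover have "(\<lambda>k. ennreal (c k) * (ennreal (cmod (P x) powr p) * arc_min p a n)) \<longlonglongrightarrow> ennreal (ball_const DIM('a) l) * (ennreal (cmod (P x) powr p) * arc_min p a n)"
    using cpos by (intro tendsto_mult_ennreal c tendsto_const) auto
  ultimately have "ennreal (ball_const DIM('a) l) * (ennreal (cmod (P x) powr p) * arc_min p a n) \<le> ball_integral p l P + ennreal (ball_const DIM('a) l) * (ennreal (M powr p) * 0)"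
    using bd by (intro tendsto_le[OF sequentially_bot]) (auto intro: always_eventually)
  then show ?thesis by (simp add: a_def)
qed

text \<open>
  For \<open>x = e\<close> of norm 1 every slice of a zonal polynomial is \<open>q (cos \<theta>)\<close>, so the slicing identity expresses
  the integral over the ball by the integral over the half circle. As above the exponents decrease to
  \<open>l\<close>, now with Fatou's lemma.
\<close>

lemma ball_zonal_bound:
  fixes q :: "complex poly" and e :: "'a::euclidean_space" and l :: real
  assumes p: "p \<ge> 1" and e: "norm e = 1" and l: "l \<ge> 0"
  shows "ball_integral p l (\<lambda>y. poly q (of_real (y \<bullet> e))) \<le> ennreal (ball_const DIM('a) l) * arc_int p (DIM('a) + 2 * l - 1) q"
proof -
  define f where "f y = cmod (poly q (of_real (y \<bullet> e))) powr p" for y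
  have "(\<lambda>y. poly q (of_real (y \<bullet> e))) \<in> borel_measurable borel" by (intro borel_measurable_continuous_onI continuous_intros)
  have [measurable]: "ball (0::'a) 1 \<in> sets borel" by simp
  from \<open>(\<lambda>y. poly q (of_real (y \<bullet> e))) \<in> borel_measurable borel\<close> have fm[measurable]: "f \<in> borel_measurable borel" unfolding f_def by measurable
  define b where "b k = l + 1 / real (Suc k)" for k
  define c where "c k = ball_const DIM('a) (b k)" for k
  have bl: "b k > 0" "l \<le> b k" for k using l by (auto simp: b_def add_nonneg_pos)
  have b: "b \<longlonglongrightarrow> l" unfolding b_def by (rule shrinking_shift_tendsto)
  have c: "(\<lambda>k. ennreal (c k)) \<longlonglongrightarrow> ennreal (ball_const DIM('a) l)"
    unfolding c_def by (intro tendsto_ennrealI ball_const_tendsto b l) simp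
  have cpos: "ball_const DIM('a) l > 0" by (rule ball_const_pos) (use l in auto)
  let ?W = "\<lambda>l y. ennreal (f y * (1 - (norm y)\<^sup>2) powr (l - 1/2)) * indicator (ball 0 1) y"
  have ee: "e \<bullet> e = 1" using e by (simp add: dot_square_norm)
  have le: "(\<integral>\<^sup>+y. ?W (b k) y \<partial>lborel) \<le> ennreal (c k) * arc_int p (DIM('a) + 2 * l - 1) q" for k
  proof -
    have beta_pos: "Beta (1/2) (b k) > 0" unfolding Beta_def using bl(1)[of k] by (intro divide_pos_pos mult_pos_pos Gamma_real_pos) auto
    have "ennreal (Beta (1/2) (b k)) * (\<integral>\<^sup>+y. ?W (b k) y \<partial>lborel)
      = (\<integral>\<^sup>+w. beta_weight (b k) ((norm w)\<^sup>2) *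
       (\<integral>\<^sup>+\<theta>. ennreal (f ((cos \<theta> * 1) *\<^sub>R e + sin \<theta> *\<^sub>R squeeze 1 e w) * sin \<theta> powr (DIM('a) + 2 * b k - 1)) * indicator {0..pi} \<theta> \<partial>lborel) \<partial>lborel)"
      by (rule ball_integral_by_slices[symmetric, OF fm _ e]) (use bl in \<open>auto simp: f_def\<close>)
    also have "\<dots> = (\<integral>\<^sup>+w. beta_weight (b k) ((norm (w::'a))\<^sup>2) * arc_int p (DIM('a) + 2 * b k - 1) q \<partial>lborel)"
    proof (intro nn_integral_cong arg_cong2[where f = times] refl)
      fix w :: 'a
      have "squeeze 1 e w \<bullet> e = 0" by (simp add: squeeze_def inner_add_left inner_diff_left ee)
      then have "((cos \<theta> * 1) *\<^sub>R e + sin \<theta> *\<^sub>R squeeze 1 e w) \<bullet> e = cos \<theta>" for \<theta> by (simp add: inner_add_left ee)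
      then show "(\<integral>\<^sup>+\<theta>. ennreal (f ((cos \<theta> * 1) *\<^sub>R e + sin \<theta> *\<^sub>R squeeze 1 e w) * sin \<theta> powr (DIM('a) + 2 * b k - 1)) * indicator {0..pi} \<theta> \<partial>lborel)
         = arc_int p (DIM('a) + 2 * b k - 1) q"
        unfolding arc_int_def f_def by simp
    qed
    also have "\<dots> = ennreal (c k * Beta (1/2) (b k)) * arc_int p (DIM('a) + 2 * b k - 1) q"
      unfolding c_def beta_weight_integral_ball[OF bl(1), symmetric] by (intro nn_integral_multc) measurable
    also have "\<dots> \<le> ennreal (c k * Beta (1/2) (b k)) * arc_int p (DIM('a) + 2 * l - 1) q"
    proof (rule mult_left_mono)
      show "arc_int p (DIM('a) + 2 * b k - 1) q \<le> arc_int p (DIM('a) + 2 * l - 1) q"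
        unfolding arc_int_def
      proof (rule nn_integral_mono)
        fix \<theta> :: real
        have "sin \<theta> powr (DIM('a) + 2 * b k - 1) \<le> sin \<theta> powr (DIM('a) + 2 * l - 1)" if "\<theta> \<in> {0..pi}"
          using that bl(2)[of k] by (intro powr_mono') (auto intro: sin_ge_zero)
        then show "ennreal (cmod (poly q (of_real (cos \<theta>))) powr p * sin \<theta> powr (DIM('a) + 2 * b k - 1)) * indicator {0..pi} \<theta>
          \<le> ennreal (cmod (poly q (of_real (cos \<theta>))) powr p * sin \<theta> powr (DIM('a) + 2 * l - 1)) * indicator {0..pi} \<theta>"
          by (auto intro!: ennreal_leI mult_left_mono split: split_indicator)
      qed
    qed simp
    also have "\<dots> = ennreal (Beta (1/2) (b k)) * (ennreal (c k) * arc_int p (DIM('a) + 2 * l - 1) q)"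
      using beta_pos by (simp add: ennreal_mult'' mult_ac)
    finally show ?thesis using beta_pos by (subst (asm) ennreal_mult_le_mult_iff) auto
  qed
  have "(\<integral>\<^sup>+y. ?W l y \<partial>lborel) = (\<integral>\<^sup>+y. liminf (\<lambda>k. ?W (b k) y) \<partial>lborel)"
  proof (rule nn_integral_cong)
    fix y :: 'a
    have "(\<lambda>k. ?W (b k) y) \<longlonglongrightarrow> ?W l y"
    proof (cases "norm y < 1")
      case True
      then have "1 - (norm y)\<^sup>2 \<noteq> 0" by (simp add: abs_square_eq_1)
      then have "(\<lambda>k. f y * (1 - (norm y)\<^sup>2) powr (b k - 1/2)) \<longlonglongrightarrow> f y * (1 - (norm y)\<^sup>2) powr (l - 1/2)"
        using b by (intro tendsto_intros) auto
      from tendsto_ennrealI[OF this] show ?thesis using True by simp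
    qed simp
    then show "?W l y = liminf (\<lambda>k. ?W (b k) y)" by (simp add: lim_imp_Liminf)
  qed
  also have "\<dots> \<le> liminf (\<lambda>k. \<integral>\<^sup>+y. ?W (b k) y \<partial>lborel)"
    by (intro nn_integral_liminf) measurable
  also have "\<dots> \<le> liminf (\<lambda>k. ennreal (c k) * arc_int p (DIM('a) + 2 * l - 1) q)"
    by (intro Liminf_mono always_eventually allI le)
  also have "\<dots> = ennreal (ball_const DIM('a) l) * arc_int p (DIM('a) + 2 * l - 1) q"
    using cpos by (intro lim_imp_Liminf tendsto_mult_ennreal c tendsto_const) auto
  finally show ?thesis unfolding ball_integral_def f_def .
qed

section \<open>Polynomials and entire functions of several variables\<close>

text \<open>
  Trigonometric polynomials of degree at most \<open>n\<close>, in the normal form in which the even part is the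
  polynomial \<open>A\<close> in the cosine.
\<close>

definition trig_pair :: "nat \<Rightarrow> (real \<Rightarrow> complex) \<Rightarrow> bool" where
  "trig_pair n F \<longleftrightarrow> (\<exists>A B. degree A \<le> n \<and> (B = 0 \<or> degree B < n) \<and>
     (\<forall>\<theta>. F \<theta> = poly A (of_real (cos \<theta>)) + of_real (sin \<theta>) * poly B (of_real (cos \<theta>))))"

lemma trig_pair_mono: "trig_pair m F \<Longrightarrow> m \<le> n \<Longrightarrow> trig_pair n F"
  unfolding trig_pair_def by (metis (no_types, opaque_lifting) le_trans less_le_trans)

lemma trig_pair_const: "trig_pair n (\<lambda>_. c)"
  unfolding trig_pair_def by (intro exI[of _ "[:c:]"] exI[of _ 0]) simp

lemma trig_pair_linear: "trig_pair 1 (\<lambda>\<theta>. of_real (cos \<theta> * x + sin \<theta> * y))"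
  unfolding trig_pair_def
  by (intro exI[of _ "[:0, of_real x:]"] exI[of _ "[:of_real y:]"]) (simp add: algebra_simps)

lemma trig_pair_add:
  assumes "trig_pair n F" "trig_pair n G"
  shows "trig_pair n (\<lambda>\<theta>. F \<theta> + G \<theta>)"
proof -
  obtain A B where A: "degree A \<le> n" "B = 0 \<or> degree B < n"
    "\<And>\<theta>. F \<theta> = poly A (of_real (cos \<theta>)) + of_real (sin \<theta>) * poly B (of_real (cos \<theta>))"
    using assms(1) unfolding trig_pair_def by blast
  obtain A' B' where A': "degree A' \<le> n" "B' = 0 \<or> degree B' < n"
    "\<And>\<theta>. G \<theta> = poly A' (of_real (cos \<theta>)) + of_real (sin \<theta>) * poly B' (of_real (cos \<theta>))"
    using assms(2) unfolding trig_pair_def by blast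
  have "B + B' = 0 \<or> degree (B + B') < n" using A(2) A'(2) by (auto intro: degree_add_less)
  moreover have "degree (A + A') \<le> n" using A(1) A'(1) by (rule degree_add_le)
  ultimately show ?thesis unfolding trig_pair_def
    by (intro exI[of _ "A + A'"] exI[of _ "B + B'"]) (simp add: A A' algebra_simps)
qed

lemma trig_pair_mult:
  assumes "trig_pair m F" "trig_pair n G"
  shows "trig_pair (m + n) (\<lambda>\<theta>. F \<theta> * G \<theta>)"
proof -
  obtain A B where A: "degree A \<le> m" "B = 0 \<or> degree B < m"
    "\<And>\<theta>. F \<theta> = poly A (of_real (cos \<theta>)) + of_real (sin \<theta>) * poly B (of_real (cos \<theta>))"
    using assms(1) unfolding trig_pair_def by blast
  obtain A' B' where A': "degree A' \<le> n" "B' = 0 \<or> degree B' < n"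
    "\<And>\<theta>. G \<theta> = poly A' (of_real (cos \<theta>)) + of_real (sin \<theta>) * poly B' (of_real (cos \<theta>))"
    using assms(2) unfolding trig_pair_def by blast
  define Q where "Q = [:1, 0, -1::complex:]"
  have Q: "degree Q = 2" "poly Q x = 1 - x\<^sup>2" for x by (simp_all add: Q_def power2_eq_square)
  have "degree (Q * (B * B')) \<le> m + n"
  proof (cases "B = 0 \<or> B' = 0")
    case False
    then have "degree B < m" "degree B' < n" using A A' by auto
    then show ?thesis using degree_mult_le[of Q "B * B'"] degree_mult_le[of B B'] Q(1) by linarith
  qed auto
  moreover have "degree (A * A') \<le> m + n" using degree_mult_le[of A A'] A(1) A'(1) by linarith
  ultimately have 1: "degree (A * A' + Q * (B * B')) \<le> m + n" by (intro degree_add_le)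
  have "A * B' = 0 \<or> degree (A * B') < m + n"
    using A'(2) degree_mult_le[of A B'] A(1) by auto
  moreover have "B * A' = 0 \<or> degree (B * A') < m + n"
    using A(2) degree_mult_le[of B A'] A'(1) by auto
  ultimately have 2: "A * B' + B * A' = 0 \<or> degree (A * B' + B * A') < m + n" by (auto intro: degree_add_less)
  have "F \<theta> * G \<theta> = poly (A * A' + Q * (B * B')) (of_real (cos \<theta>)) + of_real (sin \<theta>) * poly (A * B' + B * A') (of_real (cos \<theta>))" for \<theta>
  proof -
    have "complex_of_real (sin \<theta>) * of_real (sin \<theta>) = 1 - (of_real (cos \<theta>))\<^sup>2"
      by (metis of_real_1 of_real_diff of_real_power power2_eq_square sin_squared_eq of_real_mult)
    then have s: "complex_of_real (sin \<theta>) * (complex_of_real (sin \<theta>) * x) = (1 - (of_real (cos \<theta>))\<^sup>2) * x" for x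
      by (simp add: mult.assoc[symmetric])
    show ?thesis unfolding A(3) A'(3) by (simp add: Q(2) distrib_left distrib_right s mult_ac)
  qed
  with 1 2 show ?thesis unfolding trig_pair_def by blast
qed

lemma trig_pair_power: "trig_pair m F \<Longrightarrow> trig_pair (k * m) (\<lambda>\<theta>. F \<theta> ^ k)"
  by (induction k) (auto intro: trig_pair_const dest: trig_pair_mult)

lemma trig_pair_prod:
  assumes "finite I" "\<And>i. i \<in> I \<Longrightarrow> trig_pair (d i) (F i)"
  shows "trig_pair (\<Sum>i\<in>I. d i) (\<lambda>\<theta>. \<Prod>i\<in>I. F i \<theta>)"
  using assms by (induction I rule: finite_induct) (auto intro: trig_pair_const trig_pair_mult)

lemma trig_pair_sum:
  assumes "\<And>i. i \<in> I \<Longrightarrow> trig_pair n (F i)"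
  shows "trig_pair n (\<lambda>\<theta>. \<Sum>i\<in>I. F i \<theta>)"
  using assms by (induction I rule: infinite_finite_induct) (auto intro: trig_pair_const trig_pair_add)

lemma poly_space_trig_pair:
  fixes P :: "real ^ 'm \<Rightarrow> complex"
  assumes "P \<in> poly_space n"
  shows "trig_pair n (\<lambda>\<theta>. P (cos \<theta> *\<^sub>R x + sin \<theta> *\<^sub>R b))"
proof -
  obtain c where c: "\<And>x. P x = (\<Sum>\<alpha> | (\<Sum>j\<in>UNIV. \<alpha> j) \<le> n. c \<alpha> * (\<Prod>j\<in>UNIV. complex_of_real (x $ j) ^ \<alpha> j))"
    using assms unfolding poly_space_def by blast
  show ?thesis unfolding c
  proof (rule trig_pair_sum)
    fix \<alpha> :: "'m \<Rightarrow> nat" assume "\<alpha> \<in> {\<alpha>. (\<Sum>j\<in>UNIV. \<alpha> j) \<le> n}"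
    then have le: "(\<Sum>j\<in>UNIV. \<alpha> j * 1) \<le> n" by simp
    have "trig_pair (\<Sum>j\<in>UNIV. \<alpha> j * 1) (\<lambda>\<theta>. \<Prod>j\<in>UNIV. complex_of_real ((cos \<theta> *\<^sub>R x + sin \<theta> *\<^sub>R b) $ j) ^ \<alpha> j)"
      by (intro trig_pair_prod trig_pair_power) (use trig_pair_linear in auto)
    then have "trig_pair (0 + (\<Sum>j\<in>UNIV. \<alpha> j * 1)) (\<lambda>\<theta>. c \<alpha> * (\<Prod>j\<in>UNIV. complex_of_real ((cos \<theta> *\<^sub>R x + sin \<theta> *\<^sub>R b) $ j) ^ \<alpha> j))"
      by (intro trig_pair_mult trig_pair_const)
    then show "trig_pair n (\<lambda>\<theta>. c \<alpha> * (\<Prod>j\<in>UNIV. complex_of_real ((cos \<theta> *\<^sub>R x + sin \<theta> *\<^sub>R b) $ j) ^ \<alpha> j))"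
      by (rule trig_pair_mono) (use le in simp)
  qed
qed

text \<open>
  Changing the sign of \<open>\<theta>\<close> isolates the even part of a trigonometric polynomial.
\<close>

lemma poly_space_slice:
  fixes P :: "real ^ 'm \<Rightarrow> complex"
  assumes "P \<in> poly_space n"
  shows "\<exists>A. degree A \<le> n \<and> (\<forall>\<theta>. poly A (of_real (cos \<theta>)) = (P (cos \<theta> *\<^sub>R x + sin \<theta> *\<^sub>R b) + P (cos \<theta> *\<^sub>R x - sin \<theta> *\<^sub>R b)) / 2)"
proof -
  obtain A B where A: "degree A \<le> n"
    "\<And>\<theta>. P (cos \<theta> *\<^sub>R x + sin \<theta> *\<^sub>R b) = poly A (of_real (cos \<theta>)) + of_real (sin \<theta>) * poly B (of_real (cos \<theta>))"
    using poly_space_trig_pair[OF assms, of x b] unfolding trig_pair_def by blast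
  have "poly A (of_real (cos \<theta>)) = (P (cos \<theta> *\<^sub>R x + sin \<theta> *\<^sub>R b) + P (cos \<theta> *\<^sub>R x - sin \<theta> *\<^sub>R b)) / 2" for \<theta>
    using A(2)[of \<theta>] A(2)[of "- \<theta>"] by simp
  with A(1) show ?thesis by blast
qed

lemma poly_space_continuous:
  fixes P :: "real ^ 'm \<Rightarrow> complex"
  assumes "P \<in> poly_space n"
  shows "continuous_on A P"
proof -
  obtain c where c: "\<And>x. P x = (\<Sum>\<alpha> | (\<Sum>j\<in>UNIV. \<alpha> j) \<le> n. c \<alpha> * (\<Prod>j\<in>UNIV. complex_of_real (x $ j) ^ \<alpha> j))"
    using assms unfolding poly_space_def by blast
  have "P = (\<lambda>x. \<Sum>\<alpha> | (\<Sum>j\<in>UNIV. \<alpha> j) \<le> n. c \<alpha> * (\<Prod>j\<in>UNIV. complex_of_real (x $ j) ^ \<alpha> j))" using c by auto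
  then show ?thesis by (auto intro!: continuous_intros)
qed

lemma zonal_in_poly_space:
  assumes q: "degree q \<le> n"
  shows "(\<lambda>x. poly q (of_real (x $ k))) \<in> (poly_space n :: (real ^ 'm \<Rightarrow> complex) set)"
proof -
  define S where "S = {\<alpha> :: 'm \<Rightarrow> nat. (\<Sum>j\<in>UNIV. \<alpha> j) \<le> n}"
  define E where "E i = (\<lambda>j::'m. if j = k then i else 0 :: nat)" for i
  \<comment> \<open>the exponents supported at \<open>k\<close> carry the coefficients of \<open>q\<close>\<close>
  define c where "c \<alpha> = (if \<alpha> \<in> E ` {..n} then coeff q (\<alpha> k) else 0)" for \<alpha>
  have "\<alpha> j \<le> n" if "\<alpha> \<in> S" for \<alpha> j
    using that member_le_sum[of j UNIV \<alpha>] unfolding S_def by (auto intro: order_trans)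
  then have "S \<subseteq> (UNIV :: 'm set) \<rightarrow>\<^sub>E {..n}" by auto
  then have finS: "finite S" by (rule finite_subset) (intro finite_PiE; simp)
  have ES: "E ` {..n} \<subseteq> S" unfolding S_def E_def by (auto simp: sum.delta)
  have inj: "inj_on E {..n}" by (rule inj_onI) (metis E_def)
  have Ek: "E i k = i" for i by (simp add: E_def)
  have "poly q (of_real (x $ k)) = (\<Sum>\<alpha>\<in>S. c \<alpha> * (\<Prod>j\<in>UNIV. complex_of_real (x $ j) ^ \<alpha> j))" for x :: "real ^ 'm"
  proof -
    have "(\<Sum>\<alpha>\<in>S. c \<alpha> * (\<Prod>j\<in>UNIV. complex_of_real (x $ j) ^ \<alpha> j)) = (\<Sum>\<alpha>\<in>E ` {..n}. c \<alpha> * (\<Prod>j\<in>UNIV. complex_of_real (x $ j) ^ \<alpha> j))"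
      by (rule sum.mono_neutral_right[OF finS ES]) (auto simp: c_def)
    also have "\<dots> = (\<Sum>i\<le>n. c (E i) * (\<Prod>j\<in>UNIV. complex_of_real (x $ j) ^ E i j))"
      by (subst sum.reindex[OF inj]) simp
    also have "\<dots> = (\<Sum>i\<le>n. coeff q i * of_real (x $ k) ^ i)"
    proof (rule sum.cong[OF refl])
      fix i assume "i \<in> {..n}"
      have "(\<Prod>j\<in>UNIV. complex_of_real (x $ j) ^ E i j) = (\<Prod>j\<in>UNIV. if j = k then of_real (x $ k) ^ i else 1)"
        by (intro prod.cong) (auto simp: E_def)
      also have "\<dots> = of_real (x $ k) ^ i" by simp
      finally show "c (E i) * (\<Prod>j\<in>UNIV. complex_of_real (x $ j) ^ E i j) = coeff q i * of_real (x $ k) ^ i"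
        using \<open>i \<in> {..n}\<close> by (auto simp: c_def Ek)
    qed
    also have "\<dots> = poly q (of_real (x $ k))"
      unfolding poly_altdef using q by (intro sum.mono_neutral_right) (auto simp: coeff_eq_0)
    finally show ?thesis ..
  qed
  then show ?thesis unfolding poly_space_def S_def by blast
qed

lemma entire_slice_holomorphic:
  fixes F :: "complex ^ 'm \<Rightarrow> complex"
  assumes "entire F"
  shows "(\<lambda>\<zeta>. F (\<chi> j. \<zeta> * w $ j)) holomorphic_on UNIV"
proof -
  define L where "L \<zeta> = (\<chi> j. \<zeta> * w $ j)" for \<zeta>
  have L: "L \<zeta> = \<zeta> *s w" for \<zeta> by (simp add: L_def vec_eq_iff)
  have bl: "bounded_linear L"
    unfolding linear_conv_bounded_linear[symmetric]
    by (rule linearI) (simp_all add: L_def vec_eq_iff algebra_simps)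
  have "\<exists>d. ((\<lambda>\<zeta>. F (L \<zeta>)) has_field_derivative d) (at \<zeta>)" for \<zeta>
  proof -
    obtain D where D: "(F has_derivative D) (at (L \<zeta>))" "\<And>c v. D (c *s v) = c * D v"
      using assms unfolding entire_def by blast
    have "(L has_derivative L) (at \<zeta>)" by (rule bounded_linear_imp_has_derivative[OF bl])
    from has_derivative_compose[OF this D(1)]
    have "((\<lambda>\<zeta>. F (L \<zeta>)) has_derivative (\<lambda>h. D (L h))) (at \<zeta>)" .
    moreover have "(\<lambda>h. D (L h)) = (*) (D w)" by (simp add: L D(2) mult.commute fun_eq_iff)
    ultimately show ?thesis unfolding has_field_derivative_def by metis
  qed
  then show ?thesis unfolding holomorphic_on_def field_differentiable_def L_def by auto
qed

lemma entire_compose_quadratic: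
  fixes Q :: "complex ^ 'm \<Rightarrow> complex"
  assumes \<Phi>: "\<Phi> holomorphic_on UNIV"
  shows "entire (\<lambda>z :: complex ^ 'm. \<Phi> (\<Sum>j\<in>UNIV. (z $ j)\<^sup>2))"
  unfolding entire_def
proof
  fix z :: "complex ^ 'm"
  have d: "((\<lambda>z :: complex ^ 'm. \<Sum>j\<in>UNIV. (z $ j)\<^sup>2) has_derivative (\<lambda>v. \<Sum>j\<in>UNIV. 2 * (v $ j) * (z $ j))) (at z)"
    by (auto intro!: derivative_eq_intros bounded_linear_imp_has_derivative[OF bounded_linear_vec_nth] simp: mult_ac)
  have "(\<Phi> has_field_derivative deriv \<Phi> (\<Sum>j\<in>UNIV. (z $ j)\<^sup>2)) (at (\<Sum>j\<in>UNIV. (z $ j)\<^sup>2))"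
    using \<Phi> by (intro holomorphic_derivI[OF _ open_UNIV]) auto
  then have "(\<Phi> has_derivative (*) (deriv \<Phi> (\<Sum>j\<in>UNIV. (z $ j)\<^sup>2))) (at (\<Sum>j\<in>UNIV. (z $ j)\<^sup>2))"
    by (simp add: has_field_derivative_def)
  from has_derivative_compose[OF d this]
  have "((\<lambda>z :: complex ^ 'm. \<Phi> (\<Sum>j\<in>UNIV. (z $ j)\<^sup>2)) has_derivative (\<lambda>v. deriv \<Phi> (\<Sum>j\<in>UNIV. (z $ j)\<^sup>2) * (\<Sum>j\<in>UNIV. 2 * (v $ j) * (z $ j)))) (at z)" .
  moreover have "deriv \<Phi> (\<Sum>j\<in>UNIV. (z $ j)\<^sup>2) * (\<Sum>j\<in>UNIV. 2 * ((c *s v) $ j) * (z $ j))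
     = c * (deriv \<Phi> (\<Sum>j\<in>UNIV. (z $ j)\<^sup>2) * (\<Sum>j\<in>UNIV. 2 * (v $ j) * (z $ j)))" for c v
    by (simp add: sum_distrib_left mult_ac)
  ultimately show "\<exists>D. ((\<lambda>z :: complex ^ 'm. \<Phi> (\<Sum>j\<in>UNIV. (z $ j)\<^sup>2)) has_derivative D) (at z) \<and> (\<forall>c v. D (c *s v) = c * D v)"
    by blast
qed

lemma dual_norm_bdd:
  fixes V :: "(real ^ 'm) set"
  assumes "\<And>t. t \<in> V \<Longrightarrow> norm t \<le> 1"
  shows "bdd_above ((\<lambda>t. cmod (\<Sum>j\<in>UNIV. complex_of_real (t $ j) * z $ j)) ` V)"
proof (rule bdd_aboveI2)
  fix t assume t: "t \<in> V"
  have "cmod (\<Sum>j\<in>UNIV. complex_of_real (t $ j) * z $ j) \<le> (\<Sum>j\<in>UNIV. cmod (complex_of_real (t $ j) * z $ j))"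
    by (rule norm_sum)
  also have "\<dots> \<le> (\<Sum>j\<in>UNIV. cmod (z $ j))"
  proof (rule sum_mono)
    fix j
    have "\<bar>t $ j\<bar> \<le> 1" using assms[OF t] component_le_norm_cart[of t j] by linarith
    then show "cmod (complex_of_real (t $ j) * z $ j) \<le> cmod (z $ j)" by (simp add: norm_mult mult_left_le_one_le)
  qed
  finally show "cmod (\<Sum>j\<in>UNIV. complex_of_real (t $ j) * z $ j) \<le> (\<Sum>j\<in>UNIV. cmod (z $ j))" .
qed

text \<open>
  The restriction of a function of the class of the ball to a complex line through 0 in a real unit
  direction has type 1.
\<close>

lemma dual_norm_ball_slice_le:
  fixes w :: "real ^ 'm"
  assumes w: "norm w = 1"
  shows "dual_norm (cball 0 1) (\<chi> j. \<zeta> * complex_of_real (w $ j)) \<le> cmod \<zeta>"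
  unfolding dual_norm_def
proof (rule cSUP_least)
  fix t :: "real ^ 'm" assume t: "t \<in> cball 0 1"
  have "(\<Sum>j\<in>UNIV. complex_of_real (t $ j) * (\<chi> j. \<zeta> * complex_of_real (w $ j)) $ j) = \<zeta> * of_real (t \<bullet> w)"
    by (simp add: inner_vec_def sum_distrib_left mult_ac)
  then have "cmod (\<Sum>j\<in>UNIV. complex_of_real (t $ j) * (\<chi> j. \<zeta> * complex_of_real (w $ j)) $ j) = cmod \<zeta> * \<bar>t \<bullet> w\<bar>"
    by (simp add: norm_mult)
  also have "\<dots> \<le> cmod \<zeta> * 1"
    using Cauchy_Schwarz_ineq2[of t w] t w by (intro mult_left_mono) auto
  finally show "cmod (\<Sum>j\<in>UNIV. complex_of_real (t $ j) * (\<chi> j. \<zeta> * complex_of_real (w $ j)) $ j) \<le> cmod \<zeta>"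
    by simp
qed simp

text \<open>
  Multiplying \<open>z\<close> by a unimodular number makes the sum of the squares real and nonnegative. Then the
  real part of \<open>z\<close> dominates the imaginary part, and it is tested against its own direction.
\<close>

lemma dual_norm_ball_ge:
  fixes z :: "complex ^ 'm"
  assumes s: "s\<^sup>2 = (\<Sum>j\<in>UNIV. (z $ j)\<^sup>2)"
  shows "cmod s \<le> dual_norm (cball 0 1) z"
proof (cases "s = 0")
  case True
  have "cmod (\<Sum>j\<in>UNIV. complex_of_real ((0 :: real ^ 'm) $ j) * z $ j) \<le> dual_norm (cball 0 1) z"
    unfolding dual_norm_def by (rule cSUP_upper) (auto intro: dual_norm_bdd)
  then show ?thesis using True by simp
next
  case False
  define u where "u = of_real (cmod s) / s"
  have u1: "cmod u = 1" using False by (simp add: u_def norm_divide)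
  have us: "u\<^sup>2 * s\<^sup>2 = of_real ((cmod s)\<^sup>2)" using False by (simp add: u_def power_divide)
  define a where "a = (\<chi> j. Re (u * z $ j))"
  define b where "b = (\<chi> j. Im (u * z $ j))"
  have "of_real ((cmod s)\<^sup>2) = (\<Sum>j\<in>UNIV. (u * z $ j)\<^sup>2)"
    unfolding us[symmetric] s by (simp add: sum_distrib_left power_mult_distrib)
  then have "(cmod s)\<^sup>2 = Re (\<Sum>j\<in>UNIV. (u * z $ j)\<^sup>2)" by (metis Re_complex_of_real)
  also have "\<dots> = (\<Sum>j\<in>UNIV. (a $ j)\<^sup>2 - (b $ j)\<^sup>2)"
    by (simp add: a_def b_def power2_eq_square)
  also have "\<dots> = (norm a)\<^sup>2 - (norm b)\<^sup>2"
    by (simp add: sum_subtractf norm_vec_def L2_set_def sum_nonneg)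
  finally have "(cmod s)\<^sup>2 \<le> (norm a)\<^sup>2" by simp
  then have sa: "cmod s \<le> norm a" by (rule power2_le_imp_le) simp
  with False have a0: "norm a > 0" by (metis less_le_trans zero_less_norm_iff)
  define t where "t = a /\<^sub>R norm a"
  have "norm t \<le> 1" using a0 by (simp add: t_def)
  then have le: "cmod (\<Sum>j\<in>UNIV. complex_of_real (t $ j) * z $ j) \<le> dual_norm (cball 0 1) z"
    unfolding dual_norm_def by (intro cSUP_upper dual_norm_bdd) auto
  have "norm a = Re (\<Sum>j\<in>UNIV. complex_of_real (t $ j) * (u * z $ j))"
  proof -
    have "Re (\<Sum>j\<in>UNIV. complex_of_real (t $ j) * (u * z $ j)) = (\<Sum>j\<in>UNIV. t $ j * a $ j)" by (simp add: a_def)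
    also have "\<dots> = t \<bullet> a" by (simp add: inner_vec_def)
    also have "\<dots> = norm a" using a0 by (simp add: t_def power2_norm_eq_inner[symmetric] power2_eq_square)
    finally show ?thesis ..
  qed
  also have "\<dots> \<le> cmod (\<Sum>j\<in>UNIV. complex_of_real (t $ j) * (u * z $ j))" by (rule complex_Re_le_cmod)
  also have "(\<Sum>j\<in>UNIV. complex_of_real (t $ j) * (u * z $ j)) = u * (\<Sum>j\<in>UNIV. complex_of_real (t $ j) * z $ j)"
    by (simp add: sum_distrib_left mult_ac)
  also have "cmod \<dots> = cmod (\<Sum>j\<in>UNIV. complex_of_real (t $ j) * z $ j)" by (simp add: norm_mult u1)
  finally show ?thesis using sa le by linarith
qed

lemma even_part_in_even_exp_type:
  assumes h: "g holomorphic_on UNIV" and b: "\<And>\<epsilon>. \<epsilon> > 0 \<Longrightarrow> \<exists>C>0. \<forall>z. cmod (g z) \<le> C * exp ((1 + \<epsilon>) * cmod z)"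
  shows "(\<lambda>z. (g z + g (- z)) / 2) \<in> even_exp_type"
proof -
  have "(\<lambda>z. g (- z)) holomorphic_on UNIV"
    using holomorphic_on_compose_gen[of uminus UNIV g UNIV] h by (simp add: o_def holomorphic_on_minus)
  then have "(\<lambda>z. (g z + g (- z)) / 2) holomorphic_on UNIV" using h by (intro holomorphic_intros) auto
  moreover have "\<exists>C>0. \<forall>z. cmod ((g z + g (- z)) / 2) \<le> C * exp ((1 + \<epsilon>) * cmod z)" if e: "\<epsilon> > 0" for \<epsilon>
  proof -
    obtain C where C: "C > 0" "\<And>z. cmod (g z) \<le> C * exp ((1 + \<epsilon>) * cmod z)" using b[OF e] by blast
    have "cmod ((g z + g (- z)) / 2) \<le> C * exp ((1 + \<epsilon>) * cmod z)" for z
      using C(2)[of z] C(2)[of "- z"] norm_triangle_ineq[of "g z" "g (- z)"] by (simp add: norm_divide)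
    then show ?thesis using C(1) by blast
  qed
  ultimately show ?thesis unfolding even_exp_type_def by (auto simp: add.commute)
qed

text \<open>
  The even part of the restriction to a line is a competitor on the half line.
\<close>

lemma B_ball_slice:
  fixes h :: "real ^ 'm \<Rightarrow> complex"
  assumes "h \<in> B_ball" and w: "norm w = 1"
  obtains \<phi> where "\<phi> \<in> even_exp_type" "\<And>u. \<phi> (of_real u) = (h (u *\<^sub>R w) + h (- (u *\<^sub>R w))) / 2"
proof -
  obtain F where F: "h = real_trace F" "entire F" "\<And>\<epsilon>. \<epsilon> > 0 \<Longrightarrow> \<exists>C>0. \<forall>z. cmod (F z) \<le> C * exp ((1 + \<epsilon>) * dual_norm (cball 0 1) z)"
    using assms(1) unfolding B_ball_def exp_type_class_def by auto
  define g where "g \<zeta> = F (\<chi> j. \<zeta> * (\<chi> j. complex_of_real (w $ j)) $ j)" for \<zeta>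
  have gh: "g holomorphic_on UNIV" unfolding g_def by (rule entire_slice_holomorphic[OF F(2)])
  have gu: "g (of_real u) = h (u *\<^sub>R w)" for u unfolding g_def F(1) real_trace_def by simp
  have "\<exists>C>0. \<forall>z. cmod (g z) \<le> C * exp ((1 + \<epsilon>) * cmod z)" if e: "\<epsilon> > 0" for \<epsilon>
  proof -
    obtain C where C: "C > 0" "\<And>z. cmod (F z) \<le> C * exp ((1 + \<epsilon>) * dual_norm (cball 0 1) z)" using F(3)[OF e] by blast
    have "cmod (g z) \<le> C * exp ((1 + \<epsilon>) * cmod z)" for z
    proof -
      have "cmod (g z) \<le> C * exp ((1 + \<epsilon>) * dual_norm (cball 0 1) (\<chi> j. z * complex_of_real (w $ j)))"
        using C(2)[of "\<chi> j. z * complex_of_real (w $ j)"] by (simp add: g_def)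
      also have "\<dots> \<le> C * exp ((1 + \<epsilon>) * cmod z)"
        using C(1) e dual_norm_ball_slice_le[OF w, of z] by (intro mult_left_mono) auto
      finally show ?thesis .
    qed
    then show ?thesis using C(1) by blast
  qed
  from even_part_in_even_exp_type[OF gh this] have "(\<lambda>z. (g z + g (- z)) / 2) \<in> even_exp_type" .
  moreover have "(g (of_real u) + g (- of_real u)) / 2 = (h (u *\<^sub>R w) + h (- (u *\<^sub>R w))) / 2" for u
    using gu[of u] gu[of "- u"] by simp
  ultimately show ?thesis using that by blast
qed

text \<open>
  An even entire function is an entire function of the square, and the squared norm on the real space
  extends to the sum of squares on the complex space.
\<close>

lemma radial_in_B_ball:
  assumes \<phi>: "\<phi> \<in> even_exp_type"
  shows "(\<lambda>t :: real ^ 'm. \<phi> (of_real (norm t))) \<in> B_ball"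
proof -
  obtain \<Phi> where \<Phi>: "\<Phi> holomorphic_on UNIV" "\<And>z. \<phi> z = \<Phi> (z\<^sup>2)"
    using entire_even_square[of \<phi>] \<phi> unfolding even_exp_type_def by blast
  define F where "F z = \<Phi> (\<Sum>j\<in>UNIV. (z $ j)\<^sup>2)" for z :: "complex ^ 'm"
  have "entire F" unfolding F_def by (rule entire_compose_quadratic[OF \<Phi>(1)])
  moreover have "\<exists>C>0. \<forall>z. cmod (F z) \<le> C * exp ((1 + \<epsilon>) * dual_norm (cball 0 1) z)" if e: "\<epsilon> > 0" for \<epsilon>
  proof -
    obtain C where C: "C > 0" "\<And>z. cmod (\<phi> z) \<le> C * exp ((1 + \<epsilon>) * cmod z)" using \<phi> e unfolding even_exp_type_def by blast
    have "cmod (F z) \<le> C * exp ((1 + \<epsilon>) * dual_norm (cball 0 1) z)" for z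
    proof -
      define s where "s = csqrt (\<Sum>j\<in>UNIV. (z $ j)\<^sup>2)"
      have s: "s\<^sup>2 = (\<Sum>j\<in>UNIV. (z $ j)\<^sup>2)" by (simp add: s_def)
      have "cmod (F z) \<le> C * exp ((1 + \<epsilon>) * cmod s)" using C(2)[of s] by (simp add: F_def \<Phi>(2) s)
      also have "\<dots> \<le> C * exp ((1 + \<epsilon>) * dual_norm (cball 0 1) z)"
        using C(1) e dual_norm_ball_ge[OF s] by (intro mult_left_mono) auto
      finally show ?thesis .
    qed
    then show ?thesis using C(1) by blast
  qed
  moreover have "(\<lambda>t :: real ^ 'm. \<phi> (of_real (norm t))) = real_trace F"
  proof
    fix t :: "real ^ 'm"
    have "(of_real (norm t))\<^sup>2 = (\<Sum>j\<in>UNIV. (complex_of_real (t $ j))\<^sup>2)"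
    proof -
      have "(norm t)\<^sup>2 = (\<Sum>j\<in>UNIV. (t $ j)\<^sup>2)" by (simp add: norm_vec_def L2_set_def sum_nonneg)
      then have "complex_of_real ((norm t)\<^sup>2) = (\<Sum>j\<in>UNIV. (complex_of_real (t $ j))\<^sup>2)" by simp
      then show ?thesis by simp
    qed
    then show "\<phi> (of_real (norm t)) = real_trace F t" by (simp add: real_trace_def F_def \<Phi>(2))
  qed
  ultimately show ?thesis unfolding B_ball_def exp_type_class_def by blast
qed

lemma B_1e_profile:
  assumes "h \<in> B_1e"
  obtains \<phi> where "\<phi> \<in> even_exp_type" "\<And>t. h t = \<phi> (of_real (norm t))"
proof -
  let ?V = "{t :: real ^ 1. t $ 1 \<in> {-1..1}}"
  obtain F where F: "h = real_trace F" "entire F" "\<And>z. F (- z) = F z"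
      "\<And>\<epsilon>. \<epsilon> > 0 \<Longrightarrow> \<exists>C>0. \<forall>z. cmod (F z) \<le> C * exp ((1 + \<epsilon>) * dual_norm ?V z)"
    using assms unfolding B_1e_def exp_type_class_def by auto
  define g where "g \<zeta> = F (\<chi> j. \<zeta> * (\<chi> j. 1) $ j)" for \<zeta>
  have gh: "g holomorphic_on UNIV" unfolding g_def by (rule entire_slice_holomorphic[OF F(2)])
  have ev: "g (- z) = g z" for z
  proof -
    have "(\<chi> j. (- z) * (\<chi> j. 1) $ j) = - (\<chi> j. z * (\<chi> j. 1) $ j)" by (simp add: vec_eq_iff)
    then show ?thesis unfolding g_def using F(3) by metis
  qed
  have dn: "dual_norm ?V (\<chi> j. z) \<le> cmod z" for z
    unfolding dual_norm_def
  proof (rule cSUP_least)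
    show "?V \<noteq> {}" by (auto intro!: exI[of _ 0])
  qed (auto simp: norm_mult abs_le_iff intro!: mult_left_le_one_le)
  have "\<exists>C>0. \<forall>z. cmod (g z) \<le> C * exp ((1 + \<epsilon>) * cmod z)" if e: "\<epsilon> > 0" for \<epsilon>
  proof -
    obtain C where C: "C > 0" "\<And>z. cmod (F z) \<le> C * exp ((1 + \<epsilon>) * dual_norm ?V z)" using F(4)[OF e] by blast
    have "cmod (g z) \<le> C * exp ((1 + \<epsilon>) * cmod z)" for z
    proof -
      have "cmod (g z) \<le> C * exp ((1 + \<epsilon>) * dual_norm ?V (\<chi> j. z))"
        using C(2)[of "\<chi> j. z"] by (simp add: g_def)
      also have "\<dots> \<le> C * exp ((1 + \<epsilon>) * cmod z)"
        using C(1) e dn[of z] by (intro mult_left_mono) auto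
      finally show ?thesis .
    qed
    then show ?thesis using C(1) by blast
  qed
  then have "g \<in> even_exp_type" using gh ev unfolding even_exp_type_def by blast
  moreover have "h t = g (of_real (norm t))" for t
  proof -
    have 1: "h t = g (of_real (t $ 1))"
    proof -
      have "(\<chi> j. complex_of_real (t $ j)) = (\<chi> j. complex_of_real (t $ 1))" by (simp add: vec_eq_iff forall_1)
      then show ?thesis unfolding F(1) real_trace_def g_def by simp
    qed
    have "norm t = \<bar>t $ 1\<bar>" by (simp add: norm_vec_def L2_set_def)
    then show ?thesis using ev[of "of_real (t $ 1)"] unfolding 1 by (cases "t $ 1 \<ge> 0") auto
  qed
  ultimately show ?thesis using that by blast
qed

lemma profile_in_B_1e:
  assumes \<phi>: "\<phi> \<in> even_exp_type"
  shows "(\<lambda>t :: real ^ 1. \<phi> (of_real (norm t))) \<in> B_1e"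
proof -
  let ?V = "{t :: real ^ 1. t $ 1 \<in> {-1..1}}"
  have ph: "\<phi> holomorphic_on UNIV" and ev: "\<And>z. \<phi> (- z) = \<phi> z" using \<phi> unfolding even_exp_type_def by auto
  define F where "F z = \<phi> (z $ 1)" for z :: "complex ^ 1"
  have "entire F" unfolding entire_def
  proof
    fix z :: "complex ^ 1"
    have "(\<phi> has_derivative (*) (deriv \<phi> (z $ 1))) (at (z $ 1))"
      using holomorphic_derivI[OF ph open_UNIV, of "z $ 1"] by (simp add: has_field_derivative_def)
    from has_derivative_compose[OF bounded_linear_imp_has_derivative[OF bounded_linear_vec_nth] this]
    show "\<exists>D. (F has_derivative D) (at z) \<and> (\<forall>c v. D (c *s v) = c * D v)"
      unfolding F_def by (intro exI[of _ "\<lambda>v :: complex ^ 1. deriv \<phi> (z $ 1) * v $ 1"]) (simp add: mult_ac)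
  qed
  moreover have "F (- z) = F z" for z by (simp add: F_def ev)
  moreover have "\<exists>C>0. \<forall>z. cmod (F z) \<le> C * exp ((1 + \<epsilon>) * dual_norm ?V z)" if e: "\<epsilon> > 0" for \<epsilon>
  proof -
    obtain C where C: "C > 0" "\<And>z. cmod (\<phi> z) \<le> C * exp ((1 + \<epsilon>) * cmod z)" using \<phi> e unfolding even_exp_type_def by blast
    have "cmod (F z) \<le> C * exp ((1 + \<epsilon>) * dual_norm ?V z)" for z
    proof -
      have nv: "norm t \<le> 1" if "t \<in> ?V" for t :: "real ^ 1"
        using that by (auto simp: norm_vec_def L2_set_def abs_le_iff)
      have "cmod (\<Sum>j\<in>UNIV. complex_of_real ((\<chi> j. 1 :: real ^ 1) $ j) * z $ j) \<le> dual_norm ?V z"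
        unfolding dual_norm_def by (rule cSUP_upper[OF _ dual_norm_bdd]) (use nv in auto)
      then have "cmod (z $ 1) \<le> dual_norm ?V z" by simp
      then have "C * exp ((1 + \<epsilon>) * cmod (z $ 1)) \<le> C * exp ((1 + \<epsilon>) * dual_norm ?V z)"
        using C(1) e by (intro mult_left_mono) auto
      then show ?thesis using C(2)[of "z $ 1"] unfolding F_def by linarith
    qed
    then show ?thesis using C(1) by blast
  qed
  moreover have "(\<lambda>t :: real ^ 1. \<phi> (of_real (norm t))) = real_trace F"
  proof
    fix t :: "real ^ 1"
    have "norm t = \<bar>t $ 1\<bar>" by (simp add: norm_vec_def L2_set_def)
    then show "\<phi> (of_real (norm t)) = real_trace F t"
      using ev[of "of_real (t $ 1)"] unfolding real_trace_def F_def by (cases "t $ 1 \<ge> 0") auto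
  qed
  ultimately show ?thesis unfolding B_1e_def exp_type_class_def by blast
qed

section \<open>The sharp constants\<close>

text \<open>
  The outer operation in the definition of the weighted norm.
\<close>

definition root_or_top :: "real \<Rightarrow> ennreal \<Rightarrow> ennreal" where
  "root_or_top p I = (if I = \<infinity> then \<infinity> else ennreal (enn2real I powr (1 / p)))"

lemma wnorm_eq_root:
  "wnorm p W \<Omega> F = root_or_top p (\<integral>\<^sup>+ x. ennreal (cmod (F x) powr p) * W x \<partial>lebesgue_on \<Omega>)"
  unfolding wnorm_def root_or_top_def Let_def ..

lemma le_root_mult:
  assumes p: "p \<ge> 1" and c: "c > 0" and x: "x \<ge> 0" and I: "ennreal (c * x powr p) \<le> I"
  shows "ennreal x \<le> root_or_top p I * ennreal (c powr (- 1 / p))"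
proof (cases "I = \<infinity>")
  case True
  then show ?thesis using c by (simp add: root_or_top_def ennreal_top_mult)
next
  case False
  define i where "i = enn2real I"
  have i: "I = ennreal i" "i \<ge> 0" using False by (simp_all add: i_def less_top)
  have "c * x powr p \<le> i" using I i by (simp add: ennreal_le_iff)
  then have A: "(c * x powr p) powr (1 / p) \<le> i powr (1 / p)" using c x p by (intro powr_mono2) auto
  have B: "(c * x powr p) powr (1 / p) = c powr (1 / p) * x"
    using x p by (simp add: powr_mult powr_powr)
  have D: "c powr (1 / p) * c powr (- 1 / p) = 1" using c by (simp add: powr_add[symmetric])
  have "x = (c powr (1 / p) * c powr (- 1 / p)) * x" unfolding D by simp
  also have "\<dots> = (c powr (1 / p) * x) * c powr (- 1 / p)" by (simp only: mult_ac)
  also have "\<dots> \<le> i powr (1 / p) * c powr (- 1 / p)" using A unfolding B by (rule mult_right_mono) simp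
  finally have "x \<le> i powr (1 / p) * c powr (- 1 / p)" .
  then show ?thesis using False by (simp add: root_or_top_def i_def ennreal_mult'[symmetric] ennreal_leI)
qed

lemma ennreal_divide_le_of_le_mult:
  fixes X Y Z :: ennreal
  assumes "X \<le> Y * Z"
  shows "X / Y \<le> Z"
proof -
  consider "Y = 0" | "Y = top" | "Y \<noteq> 0" "Y \<noteq> top" by blast
  then show ?thesis
  proof cases
    case 1
    then show ?thesis using assms by simp
  next
    case 2
    then show ?thesis by simp
  next
    case 3
    have "X * inverse Y \<le> (Y * Z) * inverse Y" using assms by (rule mult_right_mono) simp
    also have "\<dots> = Z * (Y * inverse Y)" by (simp add: mult_ac)
    also have "Y * inverse Y = 1" using ennreal_divide_self[of Y] 3 by (simp add: divide_ennreal_def less_top)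
    finally show ?thesis by (simp add: divide_ennreal_def)
  qed
qed

lemma root_or_top_ratio_ge:
  assumes p: "p \<ge> 1" and c: "c > 0" and I: "I \<le> ennreal c" and X: "1 \<le> X"
  shows "ennreal (c powr (- 1 / p)) \<le> X / root_or_top p I"
proof -
  define e where "e = enn2real I powr (1 / p)"
  have "I \<noteq> \<infinity>" using I by (auto simp: top_unique)
  then have er: "root_or_top p I = ennreal e" by (simp add: root_or_top_def e_def)
  have "enn2real I \<le> c" using I c by (simp add: enn2real_leI)
  then have ec: "e \<le> c powr (1 / p)" unfolding e_def using p by (intro powr_mono2) auto
  have "inverse (ennreal (c powr (1 / p))) \<le> inverse (root_or_top p I)"
  proof (cases "e = 0")
    case False
    then have "e > 0" by (simp add: e_def)
    then show ?thesis unfolding er using ec c by (simp add: inverse_ennreal ennreal_leI le_imp_inverse_le)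
  qed (simp add: er)
  then have "1 * inverse (ennreal (c powr (1 / p))) \<le> X * inverse (root_or_top p I)" using X by (intro mult_mono) auto
  moreover have "inverse (ennreal (c powr (1 / p))) = ennreal (c powr (- 1 / p))"
    using c by (simp add: inverse_ennreal powr_minus[symmetric])
  ultimately show ?thesis by (simp add: divide_ennreal_def)
qed

text \<open>
  Both constants for entire functions are computed from a sharp inequality between the value at 0 and the
  integral of the \<open>p\<close>-th power, together with a function for which it is an equality.
\<close>

lemma N0_const_eq:
  fixes B :: "(real ^ 'm \<Rightarrow> complex) set"
  assumes p: "p \<ge> 1" and c: "c > 0"
    and le: "\<And>h. h \<in> B \<Longrightarrow> ennreal (c * cmod (h 0) powr p) \<le> (\<integral>\<^sup>+ x. ennreal (cmod (h x) powr p) * W x \<partial>lebesgue_on UNIV)"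
    and h0: "h0 \<in> B" "h0 0 = 1" "(\<integral>\<^sup>+ x. ennreal (cmod (h0 x) powr p) * W x \<partial>lebesgue_on UNIV) \<le> ennreal c"
  shows "N0_const B p W UNIV = ennreal (c powr (- 1 / p))"
    and "ennreal (cmod (h0 0)) / wnorm p W UNIV h0 = ennreal (c powr (- 1 / p))"
proof -
  have ub: "ennreal (cmod (h 0)) / wnorm p W UNIV h \<le> ennreal (c powr (- 1 / p))" if "h \<in> B" for h
    unfolding wnorm_eq_root by (intro ennreal_divide_le_of_le_mult le_root_mult[OF p c _ le[OF that]]) simp
  have lb: "ennreal (c powr (- 1 / p)) \<le> ennreal (cmod (h0 0)) / wnorm p W UNIV h0"
    unfolding wnorm_eq_root by (rule root_or_top_ratio_ge[OF p c h0(3)]) (simp add: h0(2))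
  show e: "ennreal (cmod (h0 0)) / wnorm p W UNIV h0 = ennreal (c powr (- 1 / p))"
    using ub[OF h0(1)] lb by (rule antisym)
  have "h0 \<in> B - {\<lambda>_. 0}" using h0 by auto
  then have "ennreal (c powr (- 1 / p)) \<le> N0_const B p W UNIV"
    unfolding N0_const_def e[symmetric] by (rule SUP_upper)
  moreover have "N0_const B p W UNIV \<le> ennreal (c powr (- 1 / p))"
    unfolding N0_const_def by (rule SUP_least) (use ub in auto)
  ultimately show "N0_const B p W UNIV = ennreal (c powr (- 1 / p))" by (rule antisym[rotated])
qed

lemma continuous_lebesgue_on_measurable:
  fixes h :: "'a::euclidean_space \<Rightarrow> complex"
  assumes "continuous_on UNIV h"
  shows "h \<in> borel_measurable (lebesgue_on S)"
  using borel_measurable_continuous_onI[OF assms]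
  by (intro measurable_restrict_space1 measurable_completion) simp

lemma ball_weight_integral:
  fixes P :: "real ^ 'm \<Rightarrow> complex"
  shows "(\<integral>\<^sup>+ x. ennreal (cmod (P x) powr p) * ball_weight l x \<partial>lebesgue_on (cball 0 1)) = ball_integral p l P"
proof -
  have "(\<integral>\<^sup>+ x. ennreal (cmod (P x) powr p) * ball_weight l x \<partial>lebesgue_on (cball 0 1))
     = (\<integral>\<^sup>+ x. ennreal (cmod (P x) powr p) * ball_weight l x * indicator (cball 0 1) x \<partial>lborel)"
    by (subst nn_integral_restrict_space) (auto simp: nn_integral_completion)
  also have "\<dots> = ball_integral p l P"
    unfolding ball_integral_def
  proof (rule nn_integral_cong)
    fix x :: "real ^ 'm"
    consider "norm x < 1" | "norm x = 1" | "norm x > 1" by linarith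
    then show "ennreal (cmod (P x) powr p) * ball_weight l x * indicator (cball 0 1) x
       = ennreal (cmod (P x) powr p * (1 - (norm x)\<^sup>2) powr (l - 1/2)) * indicator (ball 0 1) x"
      by cases (auto simp: ball_weight_def ennreal_mult')
  qed
  finally show ?thesis .
qed

text \<open>
  For a continuous function the essential supremum over the ball controls all values, those on the
  sphere included, since the open ball is dense in the closed ball.
\<close>

lemma supnorm_ge_value:
  fixes h :: "real ^ 'm \<Rightarrow> complex"
  assumes h: "continuous_on UNIV h" and x: "norm x \<le> 1"
  shows "ennreal (cmod (h x)) \<le> supnorm (cball 0 1) h"
proof (rule ccontr)
  assume "\<not> ?thesis"
  then have lt: "supnorm (cball 0 1) h < ennreal (cmod (h x))" by simp
  define s where "s = enn2real (supnorm (cball 0 1) h)"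
  have s: "supnorm (cball 0 1) h = ennreal s" "s \<ge> 0"
  proof -
    have "supnorm (cball 0 1) h < top" using lt by (rule order.strict_trans) simp
    then show "supnorm (cball 0 1) h = ennreal s" by (simp add: s_def)
  qed (simp add: s_def)
  have "AE y in lebesgue_on (cball 0 1). ennreal (cmod (h y)) \<le> ennreal s"
    unfolding s(1)[symmetric] supnorm_def by (rule esssup_AE)
  then have "AE y in lebesgue_on (cball 0 1). cmod (h y) \<le> s" using s(2) by (simp add: ennreal_le_iff)
  then have "AE y in lebesgue. y \<in> cball 0 1 \<longrightarrow> cmod (h y) \<le> s" by (subst (asm) AE_restrict_space_iff) auto
  then have ae: "AE y in lebesgue. y \<in> ball 0 1 \<longrightarrow> y \<in> {y. cmod (h y) \<le> s}" by (rule AE_mp) (auto intro!: AE_I2)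
  have cl: "closed {y. cmod (h y) \<le> s}" using h by (intro closed_Collect_le continuous_intros) auto
  have "y \<in> {y. cmod (h y) \<le> s}" if "y \<in> ball 0 1" for y
    using mem_closed_if_AE_lebesgue_open[OF open_ball cl _ that] ae by blast
  then have "closure (ball 0 1) \<subseteq> {y. cmod (h y) \<le> s}" using cl by (intro closure_minimal) auto
  then have "cmod (h x) \<le> s" using x by (auto simp: closure_ball)
  then show False using lt unfolding s(1) by (simp add: ennreal_leI leD)
qed

text \<open>
  The upper bound is \<open>ball_upper_bound\<close>. For the lower bound zonal polynomials of near-minimal \<open>q\<close> are used,
  whose supremum is at least the value 1 at the pole.
\<close>

lemma N_const_poly_space:
  fixes l :: real
  assumes p: "p \<ge> 1" and l: "l \<ge> 0" and d: "d > 0"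
    and D: "arc_min p (real CARD('m::finite) + 2 * l - 1) n = ennreal d"
  shows "N_const (poly_space n :: (real ^ 'm \<Rightarrow> complex) set) p (ball_weight l) (cball 0 1)
     = ennreal ((ball_const (real CARD('m)) l * d) powr (- 1 / p))"
proof (rule antisym)
  define C where "C = ball_const (real CARD('m)) l"
  have C: "C > 0" unfolding C_def by (rule ball_const_pos) (use l in auto)
  show "N_const (poly_space n :: (real ^ 'm \<Rightarrow> complex) set) p (ball_weight l) (cball 0 1)
     \<le> ennreal ((ball_const (real CARD('m)) l * d) powr (- 1 / p))"
    unfolding N_const_def
  proof (rule SUP_least)
    fix h :: "real ^ 'm \<Rightarrow> complex" assume "h \<in> poly_space n - {\<lambda>_. 0}"
    then have h: "h \<in> poly_space n" by simp
    have hc: "continuous_on UNIV h" by (rule poly_space_continuous[OF h])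
    have pt: "ennreal (cmod (h x)) \<le> root_or_top p (ball_integral p l h) * ennreal ((C * d) powr (- 1 / p))" if "norm x \<le> 1" for x
    proof (rule le_root_mult[OF p])
      have "ennreal C * (ennreal (cmod (h x) powr p) * ennreal d) \<le> ball_integral p l h"
        using ball_upper_bound[OF hc poly_space_slice[OF h] p that l] D by (simp add: C_def)
      then show "ennreal (C * d * cmod (h x) powr p) \<le> ball_integral p l h"
        using C d by (simp add: ennreal_mult' mult_ac)
    qed (use C d in auto)
    have "supnorm (cball 0 1) h \<le> root_or_top p (ball_integral p l h) * ennreal ((C * d) powr (- 1 / p))"
      unfolding supnorm_def
    proof (rule esssup_I)
      show "(\<lambda>x. ennreal (cmod (h x))) \<in> borel_measurable (lebesgue_on (cball 0 1))"
        using continuous_lebesgue_on_measurable[OF hc] by measurable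
      show "AE x in lebesgue_on (cball 0 1). ennreal (cmod (h x)) \<le> root_or_top p (ball_integral p l h) * ennreal ((C * d) powr (- 1 / p))"
        by (rule AE_I2) (use pt in \<open>auto simp: space_restrict_space\<close>)
    qed
    then show "supnorm (cball 0 1) h / wnorm p (ball_weight l) (cball 0 1) h \<le> ennreal ((ball_const (real CARD('m)) l * d) powr (- 1 / p))"
      unfolding wnorm_eq_root ball_weight_integral C_def by (rule ennreal_divide_le_of_le_mult)
  qed
  have lo: "ennreal ((C * t) powr (- 1 / p)) \<le> N_const (poly_space n :: (real ^ 'm \<Rightarrow> complex) set) p (ball_weight l) (cball 0 1)"
    if t: "t > d" for t
  proof -
    have "arc_min p (real CARD('m) + 2 * l - 1) n < ennreal t" unfolding D using t d by (simp add: ennreal_less_iff)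
    then obtain q where q: "degree q \<le> n" "poly q 1 = 1" "arc_int p (real CARD('m) + 2 * l - 1) q < ennreal t"
      unfolding arc_min_def INF_less_iff by auto
    define k :: 'm where "k = undefined"
    define e :: "real ^ 'm" where "e = axis k 1"
    have e: "norm e = 1" "e $ k = 1" "x \<bullet> e = x $ k" for x
      by (simp add: e_def, simp add: e_def axis_def, simp add: e_def inner_axis)
    define h :: "real ^ 'm \<Rightarrow> complex" where "h x = poly q (of_real (x $ k))" for x
    have hP: "h \<in> poly_space n" unfolding h_def by (rule zonal_in_poly_space[OF q(1)])
    have he: "h e = 1" by (simp add: h_def e(2) q(2))
    have "ball_integral p l h \<le> ennreal C * arc_int p (real CARD('m) + 2 * l - 1) q"
      using ball_zonal_bound[OF p e(1) l, of q] unfolding h_def e(3) C_def by simp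
    also have "\<dots> \<le> ennreal C * ennreal t" using q(3) by (intro mult_left_mono) auto
    also have "\<dots> = ennreal (C * t)" using C by (simp add: ennreal_mult')
    finally have I: "ball_integral p l h \<le> ennreal (C * t)" .
    have "1 \<le> supnorm (cball 0 1) h"
      using supnorm_ge_value[OF poly_space_continuous[OF hP], of e] e(1) he by simp
    then have "ennreal ((C * t) powr (- 1 / p)) \<le> supnorm (cball 0 1) h / wnorm p (ball_weight l) (cball 0 1) h"
      unfolding wnorm_eq_root ball_weight_integral by (intro root_or_top_ratio_ge[OF p _ I]) (use C t d in auto)
    also have "\<dots> \<le> N_const (poly_space n :: (real ^ 'm \<Rightarrow> complex) set) p (ball_weight l) (cball 0 1)"
      unfolding N_const_def by (rule SUP_upper) (use hP he in auto)
    finally show ?thesis .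
  qed
  have "((\<lambda>t. ennreal ((C * t) powr (- 1 / p))) \<longlongrightarrow> ennreal ((C * d) powr (- 1 / p))) (at_right d)"
    using C d by (intro tendsto_ennrealI tendsto_powr tendsto_intros) auto
  moreover have "\<forall>\<^sub>F t in at_right d. ennreal ((C * t) powr (- 1 / p)) \<le> N_const (poly_space n :: (real ^ 'm \<Rightarrow> complex) set) p (ball_weight l) (cball 0 1)"
    using lo by (auto simp: eventually_at_filter)
  ultimately have "ennreal ((C * d) powr (- 1 / p)) \<le> N_const (poly_space n :: (real ^ 'm \<Rightarrow> complex) set) p (ball_weight l) (cball 0 1)"
    by (rule tendsto_upperbound) simp
  then show "ennreal ((ball_const (real CARD('m)) l * d) powr (- 1 / p)) \<le> N_const (poly_space n :: (real ^ 'm \<Rightarrow> complex) set) p (ball_weight l) (cball 0 1)"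
    by (simp add: C_def)
qed

lemma power_weight_integral:
  fixes h :: "real ^ 'm \<Rightarrow> complex"
  shows "(\<integral>\<^sup>+ x. ennreal (cmod (h x) powr p) * power_weight b x \<partial>lebesgue_on UNIV)
    = (\<integral>\<^sup>+ x. ennreal (cmod (h x) powr p * norm x powr b) \<partial>lborel)"
  by (simp add: lebesgue_on_UNIV_eq nn_integral_completion power_weight_def ennreal_mult')

lemma even_exp_type_real_continuous:
  assumes "\<phi> \<in> even_exp_type"
  shows "continuous_on A (\<lambda>r::real. \<phi> (of_real r))"
  using assms unfolding even_exp_type_def
  by (intro continuous_on_compose2[OF holomorphic_on_imp_continuous_on[of \<phi> UNIV]] continuous_intros) auto

lemma radial_power_integral:
  fixes b :: real
  assumes \<phi>: "\<phi> \<in> even_exp_type"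
  shows "(\<integral>\<^sup>+ x. ennreal (cmod (\<phi> (of_real (norm (x :: real ^ 'm)))) powr p) * power_weight b x \<partial>lebesgue_on UNIV)
    = ennreal (real CARD('m) * unit_ball_vol (real CARD('m))) * half_line_int p (real CARD('m) + b - 1) \<phi>"
proof -
  have [measurable]: "(\<lambda>r::real. \<phi> (of_real r)) \<in> borel_measurable borel"
    by (intro borel_measurable_continuous_onI even_exp_type_real_continuous \<phi>)
  have "(\<integral>\<^sup>+ x. ennreal (cmod (\<phi> (of_real (norm (x :: real ^ 'm)))) powr p) * power_weight b x \<partial>lebesgue_on UNIV)
    = (\<integral>\<^sup>+ x. ennreal (cmod (\<phi> (of_real (norm (x :: real ^ 'm)))) powr p * norm x powr b) \<partial>lborel)"
    by (rule power_weight_integral)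
  also have "\<dots> = ennreal (DIM(real ^ 'm) * unit_ball_vol DIM(real ^ 'm)) *
     (\<integral>\<^sup>+r. ennreal (cmod (\<phi> (of_real r)) powr p * r powr b) * ennreal (r ^ (DIM(real ^ 'm) - 1)) * indicator {0<..} r \<partial>lborel)"
    by (rule nn_integral_radial) measurable
  also have "(\<integral>\<^sup>+r. ennreal (cmod (\<phi> (of_real r)) powr p * r powr b) * ennreal (r ^ (DIM(real ^ 'm) - 1)) * indicator {0<..} r \<partial>lborel)
    = half_line_int p (real CARD('m) + b - 1) \<phi>"
    unfolding half_line_int_def
  proof (rule nn_integral_cong)
    fix r :: real
    consider "r < 0" | "r = 0" | "r > 0" by linarith
    then show "ennreal (cmod (\<phi> (of_real r)) powr p * r powr b) * ennreal (r ^ (DIM(real ^ 'm) - 1)) * indicator {0<..} r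
      = ennreal (cmod (\<phi> (of_real r)) powr p * r powr (real CARD('m) + b - 1)) * indicator {0..} r"
    proof cases
      case 3
      have "r ^ (DIM(real ^ 'm) - 1) = r powr (real CARD('m) - 1)"
        using 3 by (simp add: powr_realpow[symmetric] of_nat_diff Suc_leI)
      then have "r powr b * r ^ (DIM(real ^ 'm) - 1) = r powr (b + (real CARD('m) - 1))" by (simp only: powr_add)
      also have "b + (real CARD('m) - 1) = real CARD('m) + b - 1" by simp
      finally have "cmod (\<phi> (of_real r)) powr p * r powr b * r ^ (DIM(real ^ 'm) - 1) = cmod (\<phi> (of_real r)) powr p * r powr (real CARD('m) + b - 1)"
        by (simp only: mult.assoc)
      then show ?thesis using 3 by (simp add: ennreal_mult''[symmetric] del: DIM_cart)
    qed auto
  qed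
  finally show ?thesis by simp
qed

lemma radial_in_wspace:
  fixes b :: real
  assumes \<phi>: "\<phi> \<in> even_exp_type" and fin: "half_line_int p (real CARD('n) + b - 1) \<phi> < \<infinity>"
  shows "(\<lambda>t :: real ^ 'n. \<phi> (of_real (norm t))) \<in> wspace p (power_weight b) UNIV"
proof -
  have "(\<lambda>t :: real ^ 'n. \<phi> (of_real (norm t))) \<in> borel_measurable (lebesgue_on UNIV)"
    by (intro continuous_lebesgue_on_measurable continuous_on_compose2[OF even_exp_type_real_continuous[OF \<phi>, of UNIV]] continuous_intros) auto
  moreover have "(\<integral>\<^sup>+ x. ennreal (cmod (\<phi> (of_real (norm (x :: real ^ 'n)))) powr p) * power_weight b x \<partial>lebesgue_on UNIV) \<noteq> \<infinity>"
    unfolding radial_power_integral[OF \<phi>] using fin by (simp add: ennreal_mult_eq_top_iff)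
  ultimately show ?thesis unfolding wspace_def wnorm_eq_root by (simp add: root_or_top_def)
qed

text \<open>
  The homogeneous form of the extremal property.
\<close>

lemma half_line_int_scaled_lower:
  assumes p: "p \<ge> 1" and min: "\<And>g. g \<in> even_exp_type \<Longrightarrow> g 0 = 1 \<Longrightarrow> L \<le> half_line_int p a g"
    and \<phi>: "\<phi> \<in> even_exp_type"
  shows "ennreal (cmod (\<phi> 0) powr p) * L \<le> half_line_int p a \<phi>"
proof (cases "\<phi> 0 = 0")
  case True
  then show ?thesis using p by simp
next
  case False
  define k where "k = \<phi> 0"
  have k: "cmod k > 0" using False by (simp add: k_def)
  define g where "g z = inverse k * \<phi> z" for z
  have "g \<in> even_exp_type"
  proof -
    have "g holomorphic_on UNIV" unfolding g_def using \<phi> by (intro holomorphic_intros) (auto simp: even_exp_type_def)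
    moreover have "\<exists>C>0. \<forall>z. cmod (g z) \<le> C * exp ((1 + \<epsilon>) * cmod z)" if e: "\<epsilon> > 0" for \<epsilon>
    proof -
      obtain C where C: "C > 0" "\<And>z. cmod (\<phi> z) \<le> C * exp ((1 + \<epsilon>) * cmod z)" using \<phi> e unfolding even_exp_type_def by blast
      have "cmod (g z) \<le> (C / cmod k) * exp ((1 + \<epsilon>) * cmod z)" for z
      proof -
        have "cmod (g z) = inverse (cmod k) * cmod (\<phi> z)" by (simp only: g_def norm_mult norm_inverse)
        also have "\<dots> \<le> inverse (cmod k) * (C * exp ((1 + \<epsilon>) * cmod z))" using C(2)[of z] by (intro mult_left_mono) auto
        finally show ?thesis by (simp only: divide_inverse mult_ac)
      qed
      then show ?thesis using C(1) k by (intro exI[of _ "C / cmod k"]) auto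
    qed
    ultimately show ?thesis using \<phi> by (auto simp: even_exp_type_def g_def)
  qed
  moreover have "g 0 = 1" using False by (simp add: g_def k_def)
  ultimately have "ennreal (cmod k powr p) * L \<le> ennreal (cmod k powr p) * half_line_int p a g"
    using min by (intro mult_left_mono) auto
  also have "\<dots> = half_line_int p a \<phi>"
  proof -
    have gh: "g holomorphic_on UNIV" unfolding g_def using \<phi> by (intro holomorphic_intros) (auto simp: even_exp_type_def)
    have "ennreal (cmod k powr p) * half_line_int p a g = (\<integral>\<^sup>+u. ennreal (cmod k powr p) * (ennreal (cmod (g (of_real u)) powr p * u powr a) * indicator {0..} u) \<partial>lborel)"
      unfolding half_line_int_def by (rule nn_integral_cmult[symmetric]) (rule half_line_int_measurable[OF gh])
    also have "\<dots> = half_line_int p a \<phi>"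
      unfolding half_line_int_def
    proof (rule nn_integral_cong)
      fix u :: real
      have "cmod k * cmod (g (of_real u)) = cmod (\<phi> (of_real u))" using k by (simp add: g_def norm_mult norm_inverse)
      then have "cmod k powr p * cmod (g (of_real u)) powr p = cmod (\<phi> (of_real u)) powr p" by (metis powr_mult)
      then show "ennreal (cmod k powr p) * (ennreal (cmod (g (of_real u)) powr p * u powr a) * indicator {0..} u) = ennreal (cmod (\<phi> (of_real u)) powr p * u powr a) * indicator {0..} u"
        by (metis (no_types, lifting) ennreal_mult' mult.assoc powr_ge_zero)
    qed
    finally show ?thesis .
  qed
  finally show ?thesis by (simp add: k_def)
qed

lemma B_ball_continuous:
  fixes h :: "real ^ 'm \<Rightarrow> complex"
  assumes "h \<in> B_ball"
  shows "continuous_on UNIV h"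
proof -
  obtain F where F: "h = real_trace F" "entire F" using assms unfolding B_ball_def exp_type_class_def by auto
  have "continuous (at z) F" for z using F(2) unfolding entire_def by (meson has_derivative_continuous)
  then have "continuous_on UNIV F" by (simp add: continuous_at_imp_continuous_on)
  then show ?thesis unfolding F(1) real_trace_def
    by (rule continuous_on_compose2) (auto intro!: continuous_intros)
qed

text \<open>
  Along the line in direction \<open>w / |w|\<close> the even part of \<open>h\<close> is a competitor. Averaging over \<open>w\<close> in the ball,
  where \<open>w\<close> and \<open>- w\<close> contribute equally, gives the integral over the space by polar coordinates.
\<close>

lemma B_ball_lower_bound:
  fixes h :: "real ^ 'm \<Rightarrow> complex" and b :: real
  assumes p: "p \<ge> 1" and h: "h \<in> B_ball"
    and min: "\<And>g. g \<in> even_exp_type \<Longrightarrow> g 0 = 1 \<Longrightarrow> L \<le> half_line_int p (real CARD('m) + b - 1) g"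
  shows "ennreal (real CARD('m) * unit_ball_vol (real CARD('m))) * (ennreal (cmod (h 0) powr p) * L)
     \<le> (\<integral>\<^sup>+ x. ennreal (cmod (h x) powr p) * power_weight b x \<partial>lebesgue_on UNIV)"
proof -
  define a where "a = real CARD('m) + b - 1"
  have [measurable]: "h \<in> borel_measurable borel" by (intro borel_measurable_continuous_onI B_ball_continuous h)
  define F where "F x = ennreal (cmod (h x) powr p * norm x powr b)" for x
  have Fm[measurable]: "F \<in> borel_measurable borel" unfolding F_def by measurable
  define T where "T w = (\<integral>\<^sup>+r. F ((r / norm w) *\<^sub>R w) * ennreal (r ^ (DIM(real ^ 'm) - 1)) * indicator {0<..} r \<partial>lborel)" for w
  have Tm[measurable]: "T \<in> borel_measurable borel" unfolding T_def by measurable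
  let ?B = "{w :: real ^ 'm. 0 < norm w \<and> norm w < 1}"
  have T: "T w = (\<integral>\<^sup>+r. ennreal (cmod (h (r *\<^sub>R (w /\<^sub>R norm w))) powr p * r powr a) * indicator {0..} r \<partial>lborel)" if w: "norm w > 0" for w
    unfolding T_def
  proof (rule nn_integral_cong)
    fix r :: real
    consider "r < 0" | "r = 0" | "r > 0" by linarith
    then show "F ((r / norm w) *\<^sub>R w) * ennreal (r ^ (DIM(real ^ 'm) - 1)) * indicator {0<..} r
      = ennreal (cmod (h (r *\<^sub>R (w /\<^sub>R norm w))) powr p * r powr a) * indicator {0..} r"
    proof cases
      case 3
      have v: "(r / norm w) *\<^sub>R w = r *\<^sub>R (w /\<^sub>R norm w)" by (simp add: divide_inverse)
      have nv: "norm (r *\<^sub>R (w /\<^sub>R norm w)) = r" using 3 w by simp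
      have "r ^ (DIM(real ^ 'm) - 1) = r powr (real CARD('m) - 1)"
        using 3 by (simp add: powr_realpow[symmetric] of_nat_diff Suc_leI)
      then have "r powr b * r ^ (DIM(real ^ 'm) - 1) = r powr (b + (real CARD('m) - 1))" by (simp only: powr_add)
      also have "b + (real CARD('m) - 1) = a" by (simp add: a_def)
      finally have "cmod (h (r *\<^sub>R (w /\<^sub>R norm w))) powr p * r powr b * r ^ (DIM(real ^ 'm) - 1) = cmod (h (r *\<^sub>R (w /\<^sub>R norm w))) powr p * r powr a"
        by (simp only: mult.assoc)
      then show ?thesis unfolding v F_def nv using 3 by (simp add: ennreal_mult''[symmetric] del: DIM_cart)
    qed auto
  qed
  have pt: "ennreal (cmod (h 0) powr p) * L \<le> ennreal (1/2) * T w + ennreal (1/2) * T (- w)" if w: "norm w > 0" for w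
  proof -
    define e where "e = w /\<^sub>R norm w"
    have e: "norm e = 1" using w by (simp add: e_def)
    obtain \<phi> where \<phi>: "\<phi> \<in> even_exp_type" "\<And>u. \<phi> (of_real u) = (h (u *\<^sub>R e) + h (- (u *\<^sub>R e))) / 2"
      using B_ball_slice[OF h e] by blast
    have [measurable]: "(\<lambda>u. h (u *\<^sub>R e)) \<in> borel_measurable borel" "(\<lambda>u. h (- (u *\<^sub>R e))) \<in> borel_measurable borel" by measurable
    have "ennreal (cmod (h 0) powr p) * L \<le> half_line_int p a \<phi>"
      using half_line_int_scaled_lower[OF p min \<phi>(1)] \<phi>(2)[of 0] by (simp add: a_def)
    also have "\<dots> \<le> (\<integral>\<^sup>+u. ennreal (1/2) * (ennreal (cmod (h (u *\<^sub>R e)) powr p * u powr a) * indicator {0..} u)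
        + ennreal (1/2) * (ennreal (cmod (h (- (u *\<^sub>R e))) powr p * u powr a) * indicator {0..} u) \<partial>lborel)"
      unfolding half_line_int_def
    proof (rule nn_integral_mono)
      fix u :: real
      let ?x = "cmod (h (u *\<^sub>R e))" and ?y = "cmod (h (- (u *\<^sub>R e)))"
      have "cmod (\<phi> (of_real u)) \<le> (?x + ?y) / 2"
        unfolding \<phi>(2) norm_divide using norm_triangle_ineq[of "h (u *\<^sub>R e)" "h (- (u *\<^sub>R e))"] by simp
      then have "cmod (\<phi> (of_real u)) powr p \<le> ((?x + ?y) / 2) powr p" using p by (intro powr_mono2) auto
      also have "\<dots> \<le> (?x powr p + ?y powr p) / 2" by (rule convex_powr_avg[OF p]) auto
      finally have "cmod (\<phi> (of_real u)) powr p * u powr a \<le> (?x powr p + ?y powr p) / 2 * u powr a" by (rule mult_right_mono) simp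
      also have "\<dots> = 1/2 * (?x powr p * u powr a) + 1/2 * (?y powr p * u powr a)" by (simp add: field_simps)
      finally have "ennreal (cmod (\<phi> (of_real u)) powr p * u powr a) \<le> ennreal (1/2 * (?x powr p * u powr a) + 1/2 * (?y powr p * u powr a))"
        by (rule ennreal_leI)
      also have "\<dots> = ennreal (1/2) * ennreal (?x powr p * u powr a) + ennreal (1/2) * ennreal (?y powr p * u powr a)"
        by (simp only: ennreal_plus ennreal_mult mult_nonneg_nonneg powr_ge_zero zero_le_divide_1_iff zero_le_numeral)
      finally show "ennreal (cmod (\<phi> (of_real u)) powr p * u powr a) * indicator {0..} u \<le> ennreal (1/2) * (ennreal (?x powr p * u powr a) * indicator {0..} u)
        + ennreal (1/2) * (ennreal (?y powr p * u powr a) * indicator {0..} u)"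
        by (auto split: split_indicator)
    qed
    also have "\<dots> = ennreal (1/2) * (\<integral>\<^sup>+u. ennreal (cmod (h (u *\<^sub>R e)) powr p * u powr a) * indicator {0..} u \<partial>lborel)
        + ennreal (1/2) * (\<integral>\<^sup>+u. ennreal (cmod (h (- (u *\<^sub>R e))) powr p * u powr a) * indicator {0..} u \<partial>lborel)"
      by (simp add: nn_integral_add nn_integral_cmult)
    also have "\<dots> = ennreal (1/2) * T w + ennreal (1/2) * T (- w)"
      using T[of w] T[of "- w"] w by (simp add: e_def)
    finally show ?thesis .
  qed
  have reflect: "(\<integral>\<^sup>+w. indicator ?B w * T (- w) \<partial>lborel) = (\<integral>\<^sup>+w. indicator ?B w * T w \<partial>lborel)"
  proof -
    have "(\<lambda>w. indicator ?B w * T w) \<in> borel_measurable borel" by measurable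
    from nn_integral_lborel_uminus[OF this] show ?thesis by (simp add: indicator_def)
  qed
  have "(ennreal (cmod (h 0) powr p) * L) * ennreal (unit_ball_vol (real CARD('m))) = (\<integral>\<^sup>+w. (ennreal (cmod (h 0) powr p) * L) * indicator ?B w \<partial>lborel)"
  proof -
    have "?B \<in> sets lborel" by measurable
    from nn_integral_cmult_indicator[OF this] show ?thesis
      using emeasure_punctured_ball[where 'a = "real ^ 'm"] by simp
  qed
  also have "\<dots> \<le> (\<integral>\<^sup>+w. ennreal (1/2) * (indicator ?B w * T w) + ennreal (1/2) * (indicator ?B w * T (- w)) \<partial>lborel)"
    by (intro nn_integral_mono) (use pt in \<open>auto split: split_indicator\<close>)
  also have "\<dots> = ennreal (1/2) * (\<integral>\<^sup>+w. indicator ?B w * T w \<partial>lborel) + ennreal (1/2) * (\<integral>\<^sup>+w. indicator ?B w * T (- w) \<partial>lborel)"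
    by (subst nn_integral_add, measurable) (subst nn_integral_cmult, measurable, subst nn_integral_cmult, measurable)
  also have "\<dots> = (\<integral>\<^sup>+w. indicator ?B w * T w \<partial>lborel)" unfolding reflect by (rule ennreal_half_add_half)
  finally have "of_nat CARD('m) * ((ennreal (cmod (h 0) powr p) * L) * ennreal (unit_ball_vol (real CARD('m)))) \<le> of_nat CARD('m) * (\<integral>\<^sup>+w. indicator ?B w * T w \<partial>lborel)"
    by (rule mult_left_mono) simp
  also have "\<dots> = (\<integral>\<^sup>+ x. F x \<partial>lborel)"
    using nn_integral_polar[OF Fm] unfolding T_def by simp
  also have "\<dots> = (\<integral>\<^sup>+ x. ennreal (cmod (h x) powr p) * power_weight b x \<partial>lebesgue_on UNIV)"
    unfolding power_weight_integral F_def ..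
  finally show ?thesis by (simp add: ennreal_mult' ennreal_of_nat_eq_real_of_nat mult_ac)
qed

theorem theorem1p5:
  fixes p lam m :: real and S :: "nat \<Rightarrow> ennreal"
  assumes p: "1 \<le> p" and lam: "0 \<le> lam"
    and m_def: "m = real CARD('m::finite)"
    and S_def: "\<And>n. S n = ennreal (real n powr (- (m + 2 * lam) / p)) *
        N_const (poly_space n :: (real ^ 'm \<Rightarrow> complex) set) p (ball_weight lam) (cball 0 1)"
  shows
    "S \<longlonglongrightarrow> ennreal (A1 m p lam) *
        N0_const (B_1e \<inter> wspace p (power_weight (m + 2 * lam - 1)) UNIV)
          p (power_weight (m + 2 * lam - 1)) UNIV
     \<and> ennreal (A1 m p lam) *
        N0_const (B_1e \<inter> wspace p (power_weight (m + 2 * lam - 1)) UNIV)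
          p (power_weight (m + 2 * lam - 1)) UNIV
       = ennreal (A2 m p lam) *
        N0_const ((B_ball :: (real ^ 'm \<Rightarrow> complex) set) \<inter> wspace p (power_weight (2 * lam)) UNIV)
          p (power_weight (2 * lam)) UNIV
     \<and> (\<exists>f0 \<in> ((B_ball :: (real ^ 'm \<Rightarrow> complex) set)
               \<inter> wspace p (power_weight (2 * lam)) UNIV) - {\<lambda>_. 0}.
          S \<longlonglongrightarrow> ennreal (A2 m p lam) *
            (ennreal (cmod (f0 0)) / wnorm p (power_weight (2 * lam)) UNIV f0))"
proof -
  define a where "a = m + 2 * lam - 1"
  have m1: "m \<ge> 1" unfolding m_def by (simp add: Suc_leI)
  have a0: "a \<ge> 0" using m1 lam by (simp add: a_def)
  define C where "C = ball_const m lam"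
  have C: "C > 0" unfolding C_def by (rule ball_const_pos) (use m1 lam in auto)
  obtain f where f: "f \<in> even_exp_type" "f 0 = 1" and lim: "(\<lambda>n. scaled_arc_min p a n) \<longlonglongrightarrow> half_line_int p a f"
    and pos: "0 < half_line_int p a f" "half_line_int p a f < \<infinity>"
    and min: "\<And>g. g \<in> even_exp_type \<Longrightarrow> g 0 = 1 \<Longrightarrow> half_line_int p a f \<le> half_line_int p a g"
    using scaled_arc_min_limit[OF p a0] by blast
  define i where "i = enn2real (half_line_int p a f)"
  have i: "half_line_int p a f = ennreal i" "i > 0"
    using pos by (simp_all add: i_def less_top enn2real_positive_iff)

  \<comment> \<open>rescaling by \<open>n\<close> to the power \<open>a + 1\<close>, where \<open>a + 1 = m + 2 lam\<close>, absorbs the factor in \<open>S n\<close>\<close>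
  have S_lim: "S \<longlonglongrightarrow> ennreal ((C * i) powr (- 1 / p))"
  proof -
    have "(\<lambda>n. enn2real (scaled_arc_min p a n)) \<longlonglongrightarrow> i"
      using lim i by (intro tendsto_enn2real) auto
    then have "(\<lambda>n. ennreal ((C * enn2real (scaled_arc_min p a n)) powr (- 1 / p))) \<longlonglongrightarrow> ennreal ((C * i) powr (- 1 / p))"
      using C i by (intro tendsto_ennrealI tendsto_powr tendsto_mult tendsto_const) auto
    moreover have "\<forall>\<^sub>F n in sequentially. S n = ennreal ((C * enn2real (scaled_arc_min p a n)) powr (- 1 / p))"
      using order_tendstoD(1)[OF lim pos(1)] order_tendstoD(2)[OF lim pos(2)] eventually_ge_at_top[of 1]
    proof eventually_elim
      case (elim n)
      have n0: "real n powr (a + 1) > 0" using elim by simp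
      have e: "scaled_arc_min p a n = ennreal (real n powr (a + 1)) * arc_min p a n"
        by (rule scaled_arc_min_eq_arc_min) (use elim in auto)
      have "arc_min p a n \<noteq> 0" "arc_min p a n \<noteq> \<infinity>"
        using elim(1,2) n0 unfolding e by (auto simp: ennreal_mult_top)
      then obtain d where d: "arc_min p a n = ennreal d" "d > 0"
        by (cases "arc_min p a n") auto
      have "enn2real (scaled_arc_min p a n) = real n powr (a + 1) * d" unfolding e d(1) using d(2) by (simp add: ennreal_mult'[symmetric])
      have "S n = ennreal (real n powr (- (m + 2 * lam) / p)) * ennreal ((C * d) powr (- 1 / p))"
        unfolding S_def C_def m_def
        by (subst N_const_poly_space[OF p lam d(2)]) (use d(1) in \<open>simp_all add: a_def m_def\<close>)
      also have "\<dots> = ennreal (real n powr (- (m + 2 * lam) / p) * (C * d) powr (- 1 / p))"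
        by (simp add: ennreal_mult')
      also have "real n powr (- (m + 2 * lam) / p) * (C * d) powr (- 1 / p) = (C * (real n powr (a + 1) * d)) powr (- 1 / p)"
      proof -
        have "real n powr (- (m + 2 * lam) / p) = (real n powr (a + 1)) powr (- 1 / p)"
        proof -
          have "- (m + 2 * lam) / p = (a + 1) * (- 1 / p)" using p by (simp add: a_def field_simps)
          then show ?thesis by (simp only: powr_powr)
        qed
        then show ?thesis by (simp add: powr_mult mult_ac)
      qed
      finally show ?case unfolding \<open>enn2real (scaled_arc_min p a n) = real n powr (a + 1) * d\<close> .
    qed
    ultimately show ?thesis by (simp add: tendsto_cong)
  qed

  have low: "ennreal (cmod (\<phi> 0) powr p) * half_line_int p a f \<le> half_line_int p a \<phi>" if "\<phi> \<in> even_exp_type" for \<phi>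
    by (rule half_line_int_scaled_lower[OF p min that])

  \<comment> \<open>the extremal function on the line is even, so its integral over the line is twice that over the half line\<close>
  define h1 where "h1 = (\<lambda>t :: real ^ 1. f (of_real (norm t)))"
  have N1: "N0_const (B_1e \<inter> wspace p (power_weight a) UNIV) p (power_weight a) UNIV = ennreal ((2 * i) powr (- 1 / p))"
  proof (rule N0_const_eq(1)[OF p, of _ _ _ h1])
    fix h :: "real ^ 1 \<Rightarrow> complex" assume "h \<in> B_1e \<inter> wspace p (power_weight a) UNIV"
    then obtain \<phi> where \<phi>: "\<phi> \<in> even_exp_type" "h = (\<lambda>t. \<phi> (of_real (norm t)))"
      using B_1e_profile[of h] by (metis Int_iff ext)
    have "ennreal (2 * i * cmod (h 0) powr p) = ennreal 2 * (ennreal (cmod (\<phi> 0) powr p) * half_line_int p a f)"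
      unfolding i(1) \<phi>(2) using i(2) by (simp add: ennreal_mult' mult_ac)
    also have "\<dots> \<le> ennreal 2 * half_line_int p a \<phi>" by (rule mult_left_mono[OF low[OF \<phi>(1)]]) simp
    also have "\<dots> = (\<integral>\<^sup>+ x. ennreal (cmod (h x) powr p) * power_weight a x \<partial>lebesgue_on UNIV)"
      unfolding \<phi>(2) radial_power_integral[OF \<phi>(1)] by simp
    finally show "ennreal (2 * i * cmod (h 0) powr p) \<le> (\<integral>\<^sup>+ x. ennreal (cmod (h x) powr p) * power_weight a x \<partial>lebesgue_on UNIV)" .
  next
    show "h1 \<in> B_1e \<inter> wspace p (power_weight a) UNIV"
      unfolding h1_def using profile_in_B_1e[OF f(1)] radial_in_wspace[OF f(1), where 'n = 1 and b = a] pos(2) by simp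
    show "h1 0 = 1" by (simp add: h1_def f(2))
    show "(\<integral>\<^sup>+ x. ennreal (cmod (h1 x) powr p) * power_weight a x \<partial>lebesgue_on UNIV) \<le> ennreal (2 * i)"
      unfolding h1_def radial_power_integral[OF f(1)] using i by (simp add: ennreal_mult')
  qed (use i in auto)

  \<comment> \<open>the surface area of the unit sphere\<close>
  define V where "V = m * unit_ball_vol m"
  have V: "V > 0" unfolding V_def using m1 by simp
  define h0 where "h0 = (\<lambda>t :: real ^ 'm. f (of_real (norm t)))"
  let ?Bb = "(B_ball :: (real ^ 'm \<Rightarrow> complex) set) \<inter> wspace p (power_weight (2 * lam)) UNIV"
  have am: "real CARD('m) + 2 * lam - 1 = a" by (simp add: a_def m_def)
  have le_ball: "ennreal (V * i * cmod (h 0) powr p) \<le> (\<integral>\<^sup>+ x. ennreal (cmod (h x) powr p) * power_weight (2 * lam) x \<partial>lebesgue_on UNIV)"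
    if "h \<in> ?Bb" for h
  proof -
    have "ennreal V * (ennreal (cmod (h 0) powr p) * half_line_int p a f) \<le> (\<integral>\<^sup>+ x. ennreal (cmod (h x) powr p) * power_weight (2 * lam) x \<partial>lebesgue_on UNIV)"
      unfolding V_def m_def by (rule B_ball_lower_bound[OF p]) (use that min am in auto)
    then show ?thesis unfolding i(1) using V i(2) by (simp add: ennreal_mult' mult_ac)
  qed
  have h0B: "h0 \<in> ?Bb"
    unfolding h0_def using radial_in_B_ball[OF f(1)] radial_in_wspace[OF f(1), where 'n = 'm and b = "2 * lam"] pos(2) am by simp
  have h00: "h0 0 = 1" by (simp add: h0_def f(2))
  have h0I: "(\<integral>\<^sup>+ x. ennreal (cmod (h0 x) powr p) * power_weight (2 * lam) x \<partial>lebesgue_on UNIV) \<le> ennreal (V * i)"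
    unfolding h0_def radial_power_integral[OF f(1)] am i(1) V_def m_def by (simp add: ennreal_mult')
  have Vi: "V * i > 0" using V i by simp
  have N2: "N0_const ?Bb p (power_weight (2 * lam)) UNIV = ennreal ((V * i) powr (- 1 / p))"
    by (rule N0_const_eq(1)[OF p Vi le_ball h0B h00 h0I])
  have h0_ratio: "ennreal (cmod (h0 0)) / wnorm p (power_weight (2 * lam)) UNIV h0 = ennreal ((V * i) powr (- 1 / p))"
    by (rule N0_const_eq(2)[OF p Vi le_ball h0B h00 h0I])

  have G: "Gamma (lam + m / 2) > 0" "Gamma (lam + 1 / 2) > 0" "Gamma (m / 2) > 0"
    using m1 lam by (auto intro!: Gamma_real_pos)
  \<comment> \<open>both \<open>A1\<close> and \<open>A2\<close> are \<open>p\<close>-th roots of a quotient with \<open>ball_const\<close>\<close>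
  have root: "x powr (1 / p) * (y * i) powr (- 1 / p) = (C * i) powr (- 1 / p)"
    if "x > 0" "y > 0" "x * C = y" for x y
  proof -
    have "(y * i) powr (- 1 / p) = x powr (- 1 / p) * (C * i) powr (- 1 / p)"
      unfolding that(3)[symmetric] by (simp add: powr_mult mult.assoc)
    moreover have "x powr (1 / p) * x powr (- 1 / p) = 1" using that by (simp add: powr_add[symmetric])
    ultimately show ?thesis by (simp add: mult.assoc[symmetric])
  qed
  have A1': "ennreal (A1 m p lam) * ennreal ((2 * i) powr (- 1 / p)) = ennreal ((C * i) powr (- 1 / p))"
  proof -
    have "A1 m p lam * (2 * i) powr (- 1 / p) = (C * i) powr (- 1 / p)"
      unfolding A1_def by (rule root) (use G in \<open>auto simp: C_def ball_const_def field_simps\<close>)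
    then show ?thesis by (simp add: ennreal_mult'[symmetric] A1_def)
  qed
  have A2': "ennreal (A2 m p lam) * ennreal ((V * i) powr (- 1 / p)) = ennreal ((C * i) powr (- 1 / p))"
  proof -
    have g: "Gamma (m / 2 + 1) = m / 2 * Gamma (m / 2)"
      using m1 by (intro Gamma_plus1) (auto dest: nonpos_Ints_nonpos)
    have pi: "pi powr (m / 2) = pi powr (1 / 2) * pi powr ((m - 1) / 2)"
    proof -
      have "m / 2 = 1 / 2 + (m - 1) / 2" by (simp add: field_simps)
      then show ?thesis by (metis powr_add)
    qed
    have "A2 m p lam * (V * i) powr (- 1 / p) = (C * i) powr (- 1 / p)"
      unfolding A2_def
    proof (rule root)
      have "V = 2 * pi powr (m / 2) / Gamma (m / 2)"
        unfolding V_def unit_ball_vol_def g using m1 by (simp add: field_simps)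
      then show "2 * pi powr (1 / 2) * Gamma (lam + m / 2) / (Gamma (m / 2) * Gamma (lam + 1 / 2)) * C = V"
        unfolding pi C_def ball_const_def using G by simp
    qed (use G V in auto)
    then show ?thesis by (simp add: ennreal_mult'[symmetric] A2_def)
  qed
  have "h0 \<noteq> (\<lambda>_. 0)" using h00 by auto
  then have "h0 \<in> ?Bb - {\<lambda>_. 0}" using h0B by blast
  moreover have "S \<longlonglongrightarrow> ennreal (A2 m p lam) * (ennreal (cmod (h0 0)) / wnorm p (power_weight (2 * lam)) UNIV h0)"
    unfolding h0_ratio A2' by (rule S_lim)
  ultimately show ?thesis
    unfolding a_def[symmetric] N1 N2 A1' A2' using S_lim by blast
qed

end
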